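(* Let $N\ge 1$, $1<p<\infty$ and $p^\star-1:=\max\{p-1,(p-1)^{-1}\}$. Let $\mathcal{A}$ be any subset of $\{1,\ldots,N\}^2$ such that: $(i,j)\in\mathcal{A}$ implies $(j,i)\in\mathcal{A}$; $(i,j)\in\mathcal{A}$ implies $i\ne j$; $(i,j)\in\mathcal{A}$ implies $(i,j')\notin\mathcal{A}$ for every $j'\ne j$. Let $\mathcal{A}'=\{i\in\{1,\ldots,N\}:(i,j)\notin\mathcal{A}\text{ for all }j\}$. Let $\alpha=(\alpha_i)_{1\le i\le N}$ be any sequence of real numbers with $|\alpha_i|\le 1$ for all $i$ and $\alpha_i=\alpha_j$ whenever $(i,j)\in\mathcal{A}$. Define $$R_{\alpha,\mathcal{A}}^2=\sum_{i\in\mathcal{A}'}\alpha_i R_{(i,i)}^2+\sum_{\{i,j\}\in\mathcal{A}}2\alpha_i R_{(i,j)}^2 ,$$ the second sum being over unordered pairs $\{i,j\}$ with $(i,j)\in\mathcal{A}$, each counted once. Then, for any such $\mathcal{A}$ and $\alpha$, one has the sharp bound $$\bigl\|R_{\alpha,\mathcal{A}}^2\bigr\|_{\ell^p(\mathbb{Z}^N)\to\ell^p(\mathbb{Z}^N)}\le p^\star-1 .$$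
   Context: Functions are real valued on $\mathbb{Z}^N$, with canonical basis $e_1,\ldots,e_N$. Put $\partial_i^+f(x)=f(x+e_i)-f(x)$, $\partial_i^-f(x)=f(x)-f(x-e_i)$, and $\Delta f(x)=\sum_{i=1}^N\bigl(f(x+e_i)-2f(x)+f(x-e_i)\bigr)$. On $\ell^2(\mathbb{Z}^N)$ one has $\Delta\le 0$, with Fourier multiplier $-4\sum_{k}\sin^2(\theta_k/2)$, $\theta\in\mathbb{T}^N$. The discrete Riesz transforms are $R_i^\pm=\partial_i^\pm\circ(-\Delta)^{-1/2}$, understood via the functional calculus of $-\Delta$, or equivalently as Fourier multipliers. They all commute and are bounded on $\ell^p(\mathbb{Z}^N)$ for $1<p<\infty$. For $i,j\in\{1,\ldots,N\}$, $$R_{(i,j)}^2:=\tfrac14\bigl(R_i^+R_j^-+R_j^+R_i^-+R_i^-R_j^++R_j^-R_i^+\bigr),$$ so that $R_{(i,j)}^2=R_{(j,i)}^2$ and $R_{(i,i)}^2=R_i^+R_i^-$. *)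

theory Defs
  imports "HOL-Analysis.Analysis"
begin

section \<open>Functions on the lattice\<close>

text \<open>
  The lattice \<open>Z^N\<close> is the type \<open>int ^ 'n\<close> with \<open>N = CARD('n)\<close>; the canonical basis vector
  \<open>e_i\<close> is \<^term>\<open>axis i 1\<close>.  The index type is linearly ordered, like \<open>{1,\<dots>,N}\<close>.
\<close>

definition diff_plus :: "'n::finite \<Rightarrow> (int ^ 'n \<Rightarrow> 'a::real_vector) \<Rightarrow> int ^ 'n \<Rightarrow> 'a" where
  "diff_plus i f x = f (x + axis i 1) - f x"

definition diff_minus :: "'n::finite \<Rightarrow> (int ^ 'n \<Rightarrow> 'a::real_vector) \<Rightarrow> int ^ 'n \<Rightarrow> 'a" where
  "diff_minus i f x = f x - f (x - axis i 1)"

definition laplacian :: "(int ^ 'n::finite \<Rightarrow> 'a::real_vector) \<Rightarrow> int ^ 'n \<Rightarrow> 'a" where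
  "laplacian f x = (\<Sum>i\<in>UNIV. f (x + axis i 1) - 2 *\<^sub>R f x + f (x - axis i 1))"

definition lp :: "real \<Rightarrow> ('x \<Rightarrow> real) set" where
  "lp p = {f. (\<lambda>x. \<bar>f x\<bar> powr p) summable_on UNIV}"

definition lp_norm :: "real \<Rightarrow> ('x \<Rightarrow> real) \<Rightarrow> real" where
  "lp_norm p f = (\<Sum>\<^sub>\<infinity>x. \<bar>f x\<bar> powr p) powr (1 / p)"

text \<open>
  The operator norm takes values in \<open>[0,\<infinity>]\<close>; it is \<open>\<infinity>\<close> as soon as the operator does not map
  \<open>\<ell>\<^sup>p\<close> into itself, so a finite bound includes the statement that it does.
\<close>

definition lp_enorm :: "real \<Rightarrow> ('x \<Rightarrow> real) \<Rightarrow> ennreal" where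
  "lp_enorm p f = (if f \<in> lp p then ennreal (lp_norm p f) else \<infinity>)"

definition lp_opnorm :: "real \<Rightarrow> (('x \<Rightarrow> real) \<Rightarrow> ('x \<Rightarrow> real)) \<Rightarrow> ennreal" where
  "lp_opnorm p T = (SUP f\<in>{f. lp_enorm p f \<le> 1}. lp_enorm p (T f))"

section \<open>Fourier multipliers\<close>

definition char_at :: "real ^ 'n::finite \<Rightarrow> int ^ 'n \<Rightarrow> complex" where
  "char_at \<theta> x = cis (\<Sum>k\<in>UNIV. \<theta> $ k * of_int (x $ k))"

definition torus :: "(real ^ 'n::finite) set" where
  "torus = cbox (\<chi> k. - pi) (\<chi> k. pi)"

definition fourier :: "(int ^ 'n::finite \<Rightarrow> real) \<Rightarrow> real ^ 'n \<Rightarrow> complex" where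
  "fourier f \<theta> = (\<Sum>y | f y \<noteq> 0. of_real (f y) * cnj (char_at \<theta> y))"

text \<open>
  The Fourier multiplier with symbol \<open>m\<close> on finitely supported functions.  The symbols below satisfy
  \<open>m (- \<theta>) = cnj (m \<theta>)\<close>, hence the integral is real and \<^const>\<open>Re\<close> only adjusts the type.
\<close>

definition multiplier_fin ::
    "(real ^ 'n::finite \<Rightarrow> complex) \<Rightarrow> (int ^ 'n \<Rightarrow> real) \<Rightarrow> int ^ 'n \<Rightarrow> real" where
  "multiplier_fin m f x =
     Re ((LINT \<theta>:torus|lborel. m \<theta> * fourier f \<theta> * char_at \<theta> x) / (2 * pi) ^ CARD('n))"

text \<open>
  Extension to \<open>\<ell>\<^sup>p\<close>: the pointwise limit along truncations to finite sets.  Lemma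
  \<open>multiplier_unique_extension\<close> shows that on \<open>\<ell>\<^sup>p\<close> this is the only possible bounded extension,
  so the same formula serves every exponent (with \<open>p = 2\<close> giving the multiplier on \<open>\<ell>\<^sup>2\<close>).
\<close>

definition restrict0 :: "'x set \<Rightarrow> ('x \<Rightarrow> real) \<Rightarrow> 'x \<Rightarrow> real" where
  "restrict0 F f y = (if y \<in> F then f y else 0)"

definition multiplier ::
    "(real ^ 'n::finite \<Rightarrow> complex) \<Rightarrow> (int ^ 'n \<Rightarrow> real) \<Rightarrow> int ^ 'n \<Rightarrow> real" where
  "multiplier m f x = Lim (finite_subsets_at_top UNIV) (\<lambda>F. multiplier_fin m (restrict0 F f) x)"

lemma multiplier_eq_multiplier_fin:
  assumes "finite {y. f y \<noteq> 0}"
  shows "multiplier m f = multiplier_fin m f"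
proof
  fix x
  have "restrict0 F f = f" if "{y. f y \<noteq> 0} \<subseteq> F" for F
    using that by (auto simp: restrict0_def fun_eq_iff)
  then have "eventually (\<lambda>F. multiplier_fin m (restrict0 F f) x = multiplier_fin m f x)
          (finite_subsets_at_top UNIV)"
    unfolding eventually_finite_subsets_at_top
    using assms by (intro exI[of _ "{y. f y \<noteq> 0}"]) auto
  then have "((\<lambda>F. multiplier_fin m (restrict0 F f) x) \<longlongrightarrow> multiplier_fin m f x)
          (finite_subsets_at_top UNIV)"
    by (rule tendsto_eventually)
  then show "multiplier m f x = multiplier_fin m f x"
    unfolding multiplier_def by (intro tendsto_Lim) auto
qed

lemma lp_norm_ge_point:
  assumes "g \<in> lp p" "0 < p"
  shows "\<bar>g x\<bar> \<le> lp_norm p g"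
proof -
  have "(\<Sum>\<^sub>\<infinity>y\<in>{x}. \<bar>g y\<bar> powr p) \<le> (\<Sum>\<^sub>\<infinity>y. \<bar>g y\<bar> powr p)"
    using assms by (intro infsum_mono_neutral) (auto simp: lp_def)
  then have "\<bar>g x\<bar> powr p \<le> (\<Sum>\<^sub>\<infinity>y. \<bar>g y\<bar> powr p)" by simp
  then have "(\<bar>g x\<bar> powr p) powr (1 / p) \<le> lp_norm p g"
    unfolding lp_norm_def using assms by (intro powr_mono2) auto
  then show ?thesis using assms by (simp add: powr_powr)
qed

lemma lp_restrict0:
  assumes "f \<in> lp p"
  shows "restrict0 F f \<in> lp p"
proof -
  have "(\<lambda>x. \<bar>f x\<bar> powr p) summable_on UNIV" using assms by (simp add: lp_def)
  then have "(\<lambda>x. \<bar>f x\<bar> powr p) summable_on F" by (rule summable_on_subset_banach) simp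
  then have "(\<lambda>x. \<bar>restrict0 F f x\<bar> powr p) summable_on UNIV"
    by (rule summable_on_cong_neutral[THEN iffD1, rotated 3]) (auto simp: restrict0_def)
  then show ?thesis by (simp add: lp_def)
qed

lemma lp_restrict0_tendsto:
  assumes "f \<in> lp p" "0 < p"
  shows "((\<lambda>F. lp_norm p (restrict0 (- F) f)) \<longlongrightarrow> 0) (finite_subsets_at_top UNIV)"
proof -
  let ?g = "\<lambda>x. \<bar>f x\<bar> powr p"
  have g: "?g summable_on UNIV" using assms by (simp add: lp_def)
  have eq: "(\<Sum>\<^sub>\<infinity>x. \<bar>restrict0 (- F) f x\<bar> powr p) = infsum ?g UNIV - sum ?g F" if "finite F" for F
  proof -
    have "(\<Sum>\<^sub>\<infinity>x. \<bar>restrict0 (- F) f x\<bar> powr p) = infsum ?g (UNIV - F)"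
      by (rule infsum_cong_neutral) (auto simp: restrict0_def)
    also have "\<dots> = infsum ?g UNIV - infsum ?g F"
      using g that by (intro infsum_Diff) auto
    finally show ?thesis using that by simp
  qed
  have "((\<lambda>F. infsum ?g UNIV - sum ?g F) \<longlongrightarrow> infsum ?g UNIV - infsum ?g UNIV)
          (finite_subsets_at_top UNIV)"
    by (intro tendsto_diff tendsto_const infsum_tendsto g)
  then have "((\<lambda>F. \<Sum>\<^sub>\<infinity>x. \<bar>restrict0 (- F) f x\<bar> powr p) \<longlongrightarrow> 0) (finite_subsets_at_top UNIV)"
    by (subst tendsto_cong[of _ "\<lambda>F. infsum ?g UNIV - sum ?g F"])
       (auto intro!: eventually_finite_subsets_at_top_weakI eq)
  then have "((\<lambda>F. (\<Sum>\<^sub>\<infinity>x. \<bar>restrict0 (- F) f x\<bar> powr p) powr (1 / p)) \<longlongrightarrow> 0 powr (1 / p))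
          (finite_subsets_at_top UNIV)"
    using assms
    by (intro tendsto_powr2 tendsto_const) (auto intro!: always_eventually infsum_nonneg)
  then show ?thesis by (simp add: lp_norm_def)
qed

lemma multiplier_unique_extension:
  assumes p: "0 < p" and f: "f \<in> lp p"
    and diff: "\<And>g h x. g \<in> lp p \<Longrightarrow> h \<in> lp p \<Longrightarrow> T (\<lambda>y. g y - h y) x = T g x - T h x"
    and bound: "\<And>g. g \<in> lp p \<Longrightarrow> T g \<in> lp p \<and> lp_norm p (T g) \<le> C * lp_norm p g"
    and fin: "\<And>g. finite {y. g y \<noteq> 0} \<Longrightarrow> T g = multiplier_fin m g"
  shows "T f = multiplier m f"
proof
  fix x
  have *: "norm (multiplier_fin m (restrict0 F f) x - T f x) \<le> C * lp_norm p (restrict0 (- F) f)"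
    if "finite F" for F
  proof -
    have "finite {y. restrict0 F f y \<noteq> 0}"
      by (rule finite_subset[OF _ that]) (auto simp: restrict0_def)
    then have "multiplier_fin m (restrict0 F f) x = T (restrict0 F f) x"
      by (simp add: fin)
    moreover have "(\<lambda>y. f y - restrict0 F f y) = restrict0 (- F) f"
      by (auto simp: restrict0_def)
    then have "T f x - T (restrict0 F f) x = T (restrict0 (- F) f) x"
      using diff[OF f lp_restrict0[OF f], of F x] by simp
    moreover have "\<bar>T (restrict0 (- F) f) x\<bar> \<le> C * lp_norm p (restrict0 (- F) f)"
      using bound[OF lp_restrict0[OF f, of "- F"]] p
        lp_norm_ge_point[of "T (restrict0 (- F) f)" p x] by linarith
    ultimately show ?thesis by simp
  qed
  have "((\<lambda>F. C * lp_norm p (restrict0 (- F) f)) \<longlongrightarrow> C * 0) (finite_subsets_at_top UNIV)"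
    by (intro tendsto_mult tendsto_const lp_restrict0_tendsto f p)
  then have "((\<lambda>F. C * lp_norm p (restrict0 (- F) f)) \<longlongrightarrow> 0) (finite_subsets_at_top UNIV)"
    by simp
  then have "((\<lambda>F. multiplier_fin m (restrict0 F f) x - T f x) \<longlongrightarrow> 0) (finite_subsets_at_top UNIV)"
    by (rule Lim_null_comparison[rotated])
       (rule eventually_finite_subsets_at_top_weakI, rule *)
  then have "((\<lambda>F. multiplier_fin m (restrict0 F f) x) \<longlongrightarrow> T f x) (finite_subsets_at_top UNIV)"
    by (rule LIM_zero_cancel)
  then show "T f x = multiplier m f x"
    unfolding multiplier_def by (intro tendsto_Lim[symmetric]) auto
qed

section \<open>Discrete Riesz transforms\<close>

text \<open>
  Symbols of \<open>\<partial>_i\<^sup>+\<close>, \<open>\<partial>_i\<^sup>-\<close> and \<open>-\<Delta>\<close>, i.e. their eigenvalues on the characters; see lemmas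
  \<open>diff_plus_char\<close>, \<open>diff_minus_char\<close> and \<open>laplacian_char\<close>.
\<close>

definition sym_plus :: "'n::finite \<Rightarrow> real ^ 'n \<Rightarrow> complex" where
  "sym_plus i \<theta> = cis (\<theta> $ i) - 1"

definition sym_minus :: "'n::finite \<Rightarrow> real ^ 'n \<Rightarrow> complex" where
  "sym_minus i \<theta> = 1 - cis (- (\<theta> $ i))"

definition sym_neg_lap :: "real ^ 'n::finite \<Rightarrow> real" where
  "sym_neg_lap \<theta> = 4 * (\<Sum>k\<in>UNIV. (sin (\<theta> $ k / 2))\<^sup>2)"

lemma char_at_add: "char_at \<theta> (x + y) = char_at \<theta> x * char_at \<theta> y"
  by (simp add: char_at_def cis_mult sum.distrib algebra_simps)

lemma char_at_axis: "char_at \<theta> (axis i 1) = cis (\<theta> $ i)" 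
  "char_at \<theta> (- axis i 1) = cis (- (\<theta> $ i))"
proof -
  have "(\<Sum>k\<in>UNIV. \<theta> $ k * of_int (axis i 1 $ k)) = (\<Sum>k\<in>UNIV. if k = i then \<theta> $ k else 0)"
    by (rule sum.cong) (auto simp: axis_def)
  then have *: "(\<Sum>k\<in>UNIV. \<theta> $ k * of_int (axis i 1 $ k)) = \<theta> $ i" by simp
  show "char_at \<theta> (axis i 1) = cis (\<theta> $ i)" "char_at \<theta> (- axis i 1) = cis (- (\<theta> $ i))"
    using * by (simp_all add: char_at_def sum_negf)
qed

lemma diff_plus_char: "diff_plus i (char_at \<theta>) x = sym_plus i \<theta> * char_at \<theta> x"
  by (simp add: diff_plus_def sym_plus_def char_at_add char_at_axis algebra_simps)

lemma diff_minus_char: "diff_minus i (char_at \<theta>) x = sym_minus i \<theta> * char_at \<theta> x"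
  using char_at_add[of \<theta> x "- axis i 1"]
  by (simp add: diff_minus_def sym_minus_def char_at_axis algebra_simps)

lemma laplacian_char: "laplacian (char_at \<theta>) x = - of_real (sym_neg_lap \<theta>) * char_at \<theta> x"
proof -
  have s: "cis t - 2 + cis (- t) = - of_real (4 * (sin (t / 2))\<^sup>2)" for t
    using cos_double_sin[of "t/2"] by (simp add: complex_eq_iff)
  have "char_at \<theta> (x + axis i 1) - 2 *\<^sub>R char_at \<theta> x + char_at \<theta> (x - axis i 1)
      = (cis (\<theta> $ i) - 2 + cis (- (\<theta> $ i))) * char_at \<theta> x" for i
    using char_at_add[of \<theta> x "- axis i 1"]
    by (simp add: char_at_add char_at_axis algebra_simps scaleR_conv_of_real)
  then show ?thesis
    unfolding laplacian_def sym_neg_lap_def s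
    by (simp add: sum_distrib_left sum_distrib_right sum_negf)
qed

text \<open>
  \<open>\<partial>_i\<^sup>\<plusminus> \<circ> (-\<Delta>)\<^sup>-\<^sup>1\<^sup>/\<^sup>2\<close> as one Fourier multiplier; the two factors cannot be separated since the symbol
  of the second is unbounded at the origin.  At \<open>\<theta> = 0\<close>, a null set, the quotient is \<open>0 / 0 = 0\<close>.
\<close>

definition riesz_plus :: "'n::finite \<Rightarrow> (int ^ 'n \<Rightarrow> real) \<Rightarrow> int ^ 'n \<Rightarrow> real" where
  "riesz_plus i = multiplier (\<lambda>\<theta>. sym_plus i \<theta> / of_real (sqrt (sym_neg_lap \<theta>)))"

definition riesz_minus :: "'n::finite \<Rightarrow> (int ^ 'n \<Rightarrow> real) \<Rightarrow> int ^ 'n \<Rightarrow> real" where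
  "riesz_minus i = multiplier (\<lambda>\<theta>. sym_minus i \<theta> / of_real (sqrt (sym_neg_lap \<theta>)))"

definition riesz_sq :: "'n::finite \<Rightarrow> 'n \<Rightarrow> (int ^ 'n \<Rightarrow> real) \<Rightarrow> int ^ 'n \<Rightarrow> real" where
  "riesz_sq i j f x =
     1 / 4 * (riesz_plus i (riesz_minus j f) x + riesz_plus j (riesz_minus i f) x
            + riesz_minus i (riesz_plus j f) x + riesz_minus j (riesz_plus i f) x)"

definition pairing :: "('n \<times> 'n) set \<Rightarrow> bool" where
  "pairing A \<longleftrightarrow>
     (\<forall>i j. (i, j) \<in> A \<longrightarrow> (j, i) \<in> A) \<and>
     (\<forall>i j. (i, j) \<in> A \<longrightarrow> i \<noteq> j) \<and>
     (\<forall>i j j'. (i, j) \<in> A \<longrightarrow> j' \<noteq> j \<longrightarrow> (i, j') \<notin> A)"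

definition admissible_weights :: "('n \<times> 'n) set \<Rightarrow> ('n \<Rightarrow> real) \<Rightarrow> bool" where
  "admissible_weights A \<alpha> \<longleftrightarrow> (\<forall>i. \<bar>\<alpha> i\<bar> \<le> 1) \<and> (\<forall>i j. (i, j) \<in> A \<longrightarrow> \<alpha> i = \<alpha> j)"

definition unpaired :: "('n \<times> 'n) set \<Rightarrow> 'n set" where
  "unpaired A = {i. \<forall>j. (i, j) \<notin> A}"

text \<open>An unordered pair \<open>{i,j}\<close> is represented by its member \<open>(i, j)\<close> of \<open>A\<close> with \<open>i < j\<close>.\<close>

definition riesz_sq_comb ::
    "('n \<Rightarrow> real) \<Rightarrow> ('n \<times> 'n) set \<Rightarrow>
      (int ^ 'n::{finite,linorder} \<Rightarrow> real) \<Rightarrow> int ^ 'n::{finite,linorder} \<Rightarrow> real" where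
  "riesz_sq_comb \<alpha> A f x =
     (\<Sum>i\<in>unpaired A. \<alpha> i * riesz_sq i i f x) +
     (\<Sum>(i, j)\<in>{(i, j). (i, j) \<in> A \<and> i < j}. 2 * \<alpha> i * riesz_sq i j f x)"

definition pstar :: "real \<Rightarrow> real" where
  "pstar p = 1 + max (p - 1) (inverse (p - 1))"

end

theory Submission
  imports Defs "HOL-Real_Asymp.Real_Asymp"
begin

text \<open>
  Upper bound.  Burkholder's function \<open>U(x, y)\<close> is even in both variables, concave along lines of
  slope \<open>\<plusminus>1\<close>, dominates a multiple of \<open>|y|\<^sup>p - (p\<^sup>* - 1)\<^sup>p |x|\<^sup>p\<close> and satisfies \<open>U(x, 0) \<le> 0\<close>.
  Run a lazy random walk one pair of coordinates \<open>{i, j}\<close> at a time and transform the martingale of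
  \<open>f\<close> by letting a jump in direction \<open>i\<close> move the transform by the increment of \<open>f\<close> in
  direction \<open>j\<close>.  The two swapped jumps \<open>(a, b)\<close> and \<open>(b, a)\<close> share the coordinate \<open>x + y\<close>, so
  concavity in \<open>x - y\<close> merges them and concavity in \<open>x + y\<close> then gives Jensen's inequality:
  no smoothness of \<open>U\<close> is needed.  Affine minorants \<open>A(x) + B(x) y \<le> U(f(x), y)\<close> are propagated
  through the steps, which encodes the conditional expectation given the end point of the walk
  without any probability space.  As the step size tends to zero the symbols of these operators
  converge to that of \<open>- R\<^sup>2\<close>.  To pass from finitely supported functions to \<open>\<ell>\<^sup>p\<close> one needs
  that the kernels of \<open>R\<^sub>i\<^sup>\<plusminus>\<close> belong to \<open>\<ell>\<^sup>q\<close> for all \<open>q > 1\<close>; this follows from the binomial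
  series of \<open>(1 - \<lambda>)\<^sup>-\<^sup>1\<^sup>/\<^sup>2\<close> and gradient bounds for the lazy random walk.

  Sharpness.  For \<open>f = \<Delta> u\<close> the operator \<open>R\<^sub>i\<^sup>2 - R\<^sub>j\<^sup>2\<close> is local: it is the difference of two pure second
  differences of \<open>u\<close>.  Rapidly oscillating \<open>u\<close> realise laminates of diagonal Hessians, that is,
  zigzag martingales for the pair \<open>(f, R f)\<close>, and Burkholder's extremal zigzag yields \<open>p\<^sup>* - 1\<close>.
\<close>

section \<open>Finite-range convolution operators and their Fourier symbols\<close>

section \<open>Characters and multipliers with finitely supported kernels\<close>

text \<open>The swap of directions is what produces the mixed transforms. Pairing a test function at
  the end of a jump \<open>v\<close> with \<open>f\<close> at the end of the swapped jump
  \<open>w\<close>, and summing over the lattice, leaves only the shift by \<open>w - v\<close>, a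
  multiple of \<open>e_i - e_j\<close>; this is the source of the term cos(\<theta>_i - \<theta>_j).

  The obstacle on the way to l^p is that R_(i,j)^2 iterates two multipliers, each defined as a limit
  over truncations, while a single Riesz kernel is not absolutely summable. The order of summation
  is exchanged by means of kernels in l^q with q > 1 close to 1, and no l^p bound for the single
  transforms enters.

  The lower bound uses only the empty set of pairs with weights 1 and -1 on two coordinates and 0
  elsewhere. The remaining coordinates are filled by functions that are constant in them over a long
  range. The two candidates p - 1 and 1/(p - 1) come from one and the same zigzag, run once as it
  stands and once with the roles of \<open>f\<close> and its transform exchanged.\<close>

lemma set_integral_cis:
  fixes n :: int
  shows "integrable lborel (\<lambda>t::real. indicator {-pi..pi} t *\<^sub>R cis (of_int n * t))"
    "(\<integral>t. indicator {-pi..pi} t *\<^sub>R cis (of_int n * t) \<partial>lborel) = (if n = 0 then 2 * pi else 0)"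
proof -
  let ?f = "\<lambda>t::real. cis (of_int n * t)"
  have cont: "continuous_on {-pi..pi} ?f"
    unfolding cis_conv_exp by (intro continuous_intros)
  show int: "integrable lborel (\<lambda>t::real. indicator {-pi..pi} t *\<^sub>R ?f t)"
    using borel_integrable_atLeastAtMost'[OF cont] by (simp add: set_integrable_def)
  show "(\<integral>t. indicator {-pi..pi} t *\<^sub>R ?f t \<partial>lborel) = (if n = 0 then 2 * pi else 0)"
  proof (cases "n = 0")
    case True
    then show ?thesis by (simp add: scaleR_conv_of_real)
  next
    case False
    let ?F = "\<lambda>t::real. cis (of_int n * t) / (\<i> * of_int n)"
    have "(?F has_vector_derivative ?f t) (at t within A)" for t A
    proof -
      have "((\<lambda>z. exp (\<i> * (of_int n * z)) / (\<i> * of_int n)) has_field_derivative exp (\<i> * (of_int n * of_real t)))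
              (at (of_real t))"
        using False by (auto intro!: derivative_eq_intros simp: mult.left_commute[of \<i> _ \<i>])
      from has_vector_derivative_real_field[OF this]
      show ?thesis by (simp add: cis_conv_exp)
    qed
    then have "has_bochner_integral lborel (\<lambda>t. indicator {-pi..pi} t *\<^sub>R ?f t) (?F pi - ?F (-pi))"
      by (intro has_bochner_integral_FTC_Icc) (auto intro: cont)
    moreover have "?F pi - ?F (-pi) = 0"
    proof -
      have "cis (of_int n * pi) = cis (- (of_int n * pi))"
        using sin_times_pi_eq_0[of "of_int n"] by (simp add: complex_eq_iff mult.commute)
      then show ?thesis by simp
    qed
    ultimately show ?thesis using False by (simp add: has_bochner_integral_iff)
  qed
qed

lemma char_at_inner: "char_at \<theta> x = cis (\<theta> \<bullet> (\<chi> k. real_of_int (x $ k)))"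
  by (simp add: char_at_def inner_vec_def)

lemma cis_sum: "finite A \<Longrightarrow> cis (\<Sum>a\<in>A. f a) = (\<Prod>a\<in>A. cis (f a))"
  by (induction A rule: finite_induct) (auto simp: cis_mult[symmetric])

text \<open>Fubini over the product form of Lebesgue measure given by \<open>lborel_eq\<close>,
  whose factors are indexed by the vectors of \<open>Basis\<close>. For this reason the integer
  coordinates of \<open>x\<close> are read off again as inner products \<open>ix b\<close>.\<close>

lemma integral_char_at:
  "(LINT \<theta>:torus|lborel. char_at \<theta> (x :: int ^ 'n::finite)) =
     (if x = 0 then (2 * complex_of_real pi) ^ CARD('n) else 0)"
proof -
  define xr :: "real ^ 'n" where "xr = (\<chi> k. real_of_int (x $ k))"
  define ix where "ix b = (SOME n :: int. xr \<bullet> b = real_of_int n)" for b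
  have ix: "xr \<bullet> b = real_of_int (ix b)" if "b \<in> Basis" for b
  proof -
    have "\<exists>n :: int. xr \<bullet> b = real_of_int n"
      using that by (auto simp: Basis_vec_def xr_def inner_axis)
    then show ?thesis unfolding ix_def by (rule someI_ex)
  qed
  define g where "g b t = indicator {-pi..pi} t *\<^sub>R cis (of_int (ix b) * t)" for b and t :: real
  have meas: "g b \<in> borel_measurable borel" for b
    using borel_measurable_integrable[OF set_integral_cis(1)[of "ix b"]] by (simp add: g_def[abs_def])
  have prod: "indicator torus \<theta> *\<^sub>R char_at \<theta> x = (\<Prod>b\<in>Basis. g b (\<theta> \<bullet> b))" for \<theta> :: "real ^ 'n"
  proof -
    have "char_at \<theta> x = cis (\<Sum>b\<in>Basis. (\<theta> \<bullet> b) * (xr \<bullet> b))"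
      using euclidean_inner[of \<theta> xr] by (simp add: char_at_inner xr_def)
    also have "\<dots> = (\<Prod>b\<in>Basis. cis (of_int (ix b) * (\<theta> \<bullet> b)))"
      by (subst cis_sum) (auto simp: ix mult.commute intro!: prod.cong)
    finally have 1: "char_at \<theta> x = (\<Prod>b\<in>Basis. cis (of_int (ix b) * (\<theta> \<bullet> b)))" .
    have b: "(\<chi> k::'n. - pi) \<bullet> b = - pi" "(\<chi> k::'n. pi) \<bullet> b = pi" if "b \<in> Basis" for b :: "real ^ 'n"
      using that by (auto simp: Basis_vec_def inner_axis)
    have "\<theta> \<in> torus \<longleftrightarrow> (\<forall>b\<in>Basis. \<theta> \<bullet> b \<in> {-pi..pi})"
      unfolding torus_def mem_box by (simp add: b)
    then have 2: "indicator torus \<theta> = (\<Prod>b\<in>Basis. indicator {-pi..pi} (\<theta> \<bullet> b) :: real)"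
      by (auto simp: indicator_def prod_zero_iff)
    show ?thesis unfolding 1 2 g_def by (simp add: prod.distrib scaleR_conv_of_real)
  qed
  interpret product_sigma_finite "\<lambda>b::real ^ 'n. lborel :: real measure"
    by standard
  have "(LINT \<theta>:torus|lborel. char_at \<theta> x) = (\<integral>\<theta>. (\<Prod>b\<in>Basis. g b (\<theta> \<bullet> b)) \<partial>(lborel :: (real ^ 'n) measure))"
    unfolding set_lebesgue_integral_def prod ..
  also have "\<dots> = (\<integral>f. (\<Prod>b\<in>(Basis :: (real ^ 'n) set). g b (f b)) \<partial>(\<Pi>\<^sub>M b\<in>(Basis :: (real^'n) set). lborel))"
    using meas
    apply (subst lborel_eq)
    apply (subst integral_distr)
      apply measurable
    apply (auto intro!: Bochner_Integration.integral_cong prod.cong simp: inner_sum_left inner_Basis if_distrib cong: if_cong)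
    done
  also have "\<dots> = (\<Prod>b\<in>(Basis :: (real ^ 'n) set). \<integral>t. g b t \<partial>lborel)"
    by (rule product_integral_prod) (use set_integral_cis(1) in \<open>auto simp: g_def\<close>)
  also have "\<dots> = (\<Prod>b\<in>(Basis :: (real ^ 'n) set). if ix b = 0 then 2 * complex_of_real pi else 0)"
    unfolding g_def set_integral_cis(2) by (intro prod.cong) auto
  also have "\<dots> = (if x = 0 then (2 * complex_of_real pi) ^ CARD('n) else 0)"
  proof (cases "x = 0")
    case True
    then have "ix b = 0" if "b \<in> Basis" for b using ix[OF that] by (simp add: xr_def vec_eq_iff[symmetric] inner_vec_def)
    then show ?thesis using True by simp
  next
    case False
    then obtain k where "x $ k \<noteq> 0" by (auto simp: vec_eq_iff)
    then have "xr \<bullet> axis k 1 \<noteq> 0" by (simp add: xr_def inner_axis)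
    moreover have "axis k (1::real) \<in> Basis" by (simp add: axis_in_Basis_iff)
    ultimately have "\<exists>b\<in>(Basis :: (real ^ 'n) set). ix b \<noteq> 0" using ix by (metis of_int_0)
    then show ?thesis using False by (auto simp: prod_zero_iff)
  qed
  finally show ?thesis .
qed


lemma norm_char_at [simp]: "norm (char_at \<theta> x) = 1"
  by (simp add: char_at_def)

lemma char_at_uminus: "char_at \<theta> (- x) = cnj (char_at \<theta> x)"
  by (simp add: char_at_def cis_cnj sum_negf)

lemma char_at_diff: "char_at \<theta> (x - y) = char_at \<theta> x * cnj (char_at \<theta> y)"
  using char_at_add[of \<theta> x "- y"] by (simp add: char_at_uminus)

lemma char_at_0 [simp]: "char_at \<theta> 0 = 1"
  by (simp add: char_at_def)

lemma continuous_on_char_at [continuous_intros]: "continuous_on A (\<lambda>\<theta>. char_at \<theta> x)"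
  unfolding char_at_def cis_conv_exp by (intro continuous_intros)

abbreviation fin_supp :: "('x \<Rightarrow> real) \<Rightarrow> bool" where
  "fin_supp f \<equiv> finite {x. f x \<noteq> 0}"

lemma fourier_superset:
  assumes "finite S" "\<And>y. f y \<noteq> 0 \<Longrightarrow> y \<in> S"
  shows "fourier f \<theta> = (\<Sum>y\<in>S. of_real (f y) * cnj (char_at \<theta> y))"
  unfolding fourier_def using assms by (intro sum.mono_neutral_left) auto

lemma continuous_on_fourier [continuous_intros]: "continuous_on A (fourier f)"
proof -
  have "fourier f = (\<lambda>\<theta>. \<Sum>y | f y \<noteq> 0. of_real (f y) * cnj (char_at \<theta> y))"
    by (simp add: fourier_def fun_eq_iff)
  then show ?thesis by (simp only:) (intro continuous_intros)
qed

lemma torus_sets [measurable, simp]: "(torus :: (real ^ 'n::finite) set) \<in> sets borel"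
  by (simp add: torus_def)

lemma integrable_indicator_torus:
  "integrable lborel (indicator torus :: real ^ 'n::finite \<Rightarrow> real)"
proof (rule integrable_real_indicator)
  show "emeasure lborel (torus :: (real ^ 'n) set) < \<infinity>"
    unfolding torus_def using emeasure_lborel_cbox_finite by blast
qed simp

lemma set_integrable_torus:
  fixes m :: "real ^ 'n::finite \<Rightarrow> complex"
  assumes meas: "(\<lambda>\<theta>. indicator torus \<theta> *\<^sub>R m \<theta>) \<in> borel_measurable borel"
    and bound: "\<And>\<theta>. \<theta> \<in> torus \<Longrightarrow> norm (m \<theta>) \<le> B"
  shows "set_integrable lborel torus m"
  unfolding set_integrable_def
proof (rule Bochner_Integration.integrable_bound)
  show "integrable lborel (\<lambda>\<theta>. B * indicator torus (\<theta> :: real ^ 'n))"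
    by (simp add: integrable_indicator_torus)
  show "AE \<theta> in lborel. norm (indicator torus \<theta> *\<^sub>R m \<theta>) \<le> norm (B * indicator torus \<theta>)"
  proof (rule AE_I2)
    fix \<theta> :: "real ^ 'n"
    show "norm (indicator torus \<theta> *\<^sub>R m \<theta>) \<le> norm (B * indicator torus \<theta>)"
      using bound[of \<theta>] by (auto simp: indicator_def intro: order_trans)
  qed
qed (use meas in simp)

lemma set_integrable_torus_mult:
  fixes m g :: "real ^ 'n::finite \<Rightarrow> complex"
  assumes m: "set_integrable lborel torus m" and g: "continuous_on UNIV g"
    and bound: "\<And>\<theta>. norm (g \<theta>) \<le> B"
  shows "set_integrable lborel torus (\<lambda>\<theta>. m \<theta> * g \<theta>)"
  unfolding set_integrable_def
proof (rule Bochner_Integration.integrable_bound)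
  have gm [measurable]: "g \<in> borel_measurable borel" using g by (rule borel_measurable_continuous_onI)
  have mm [measurable]: "(\<lambda>\<theta>. indicator torus \<theta> *\<^sub>R m \<theta>) \<in> borel_measurable borel"
    using m by (auto simp: set_integrable_def dest: borel_measurable_integrable)
  show "integrable lborel (\<lambda>\<theta>. B *\<^sub>R norm (indicator torus \<theta> *\<^sub>R m \<theta>))"
    by (intro integrable_scaleR_right integrable_norm) (use m in \<open>simp add: set_integrable_def\<close>)
  have "(\<lambda>\<theta>. (indicator torus \<theta> *\<^sub>R m \<theta>) * g \<theta>) \<in> borel_measurable borel" by measurable
  then show "(\<lambda>\<theta>. indicator torus \<theta> *\<^sub>R (m \<theta> * g \<theta>)) \<in> borel_measurable lborel" by simp
  show "AE \<theta> in lborel. norm (indicator torus \<theta> *\<^sub>R (m \<theta> * g \<theta>))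
      \<le> norm (B *\<^sub>R norm (indicator torus \<theta> *\<^sub>R m \<theta>))"
  proof (rule AE_I2)
    fix \<theta> :: "real ^ 'n"
    have B: "norm (g \<theta>) \<le> \<bar>B\<bar>" using bound[of \<theta>] by linarith
    have "norm (m \<theta>) * norm (g \<theta>) \<le> norm (m \<theta>) * \<bar>B\<bar>"
      using B by (rule mult_left_mono) simp
    then show "norm (indicator torus \<theta> *\<^sub>R (m \<theta> * g \<theta>))
      \<le> norm (B *\<^sub>R norm (indicator torus \<theta> *\<^sub>R m \<theta>))"
      by (auto simp: indicator_def norm_mult mult.commute)
  qed
qed

definition multiplier_kernel :: "(real ^ 'n::finite \<Rightarrow> complex) \<Rightarrow> int ^ 'n \<Rightarrow> real" where
  "multiplier_kernel m x = Re ((LINT \<theta>:torus|lborel. m \<theta> * char_at \<theta> x) / (2 * pi) ^ CARD('n))"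

lemma multiplier_fin_kernel:
  fixes m :: "real ^ 'n::finite \<Rightarrow> complex"
  assumes m: "set_integrable lborel torus m" and f: "finite S" "\<And>y. f y \<noteq> 0 \<Longrightarrow> y \<in> S"
  shows "multiplier_fin m f x = (\<Sum>y\<in>S. f y * multiplier_kernel m (x - y))"
proof -
  have int: "set_integrable lborel torus (\<lambda>\<theta>. m \<theta> * char_at \<theta> y)" for y
    by (rule set_integrable_torus_mult[OF m, where B = 1]) (auto intro: continuous_intros)
  have F: "fourier f \<theta> = (\<Sum>y\<in>S. of_real (f y) * cnj (char_at \<theta> y))" for \<theta>
    by (rule fourier_superset[OF f])
  have "(LINT \<theta>:torus|lborel. m \<theta> * fourier f \<theta> * char_at \<theta> x)
      = (LINT \<theta>:torus|lborel. (\<Sum>y\<in>S. of_real (f y) * (m \<theta> * char_at \<theta> (x - y))))"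
    unfolding set_lebesgue_integral_def
    by (intro Bochner_Integration.integral_cong refl arg_cong[where f = "scaleR _"])
       (simp add: F sum_distrib_left sum_distrib_right char_at_diff mult_ac)
  also have "\<dots> = (\<Sum>y\<in>S. of_real (f y) * (LINT \<theta>:torus|lborel. m \<theta> * char_at \<theta> (x - y)))"
  proof -
    have "indicator torus \<theta> *\<^sub>R (\<Sum>y\<in>S. complex_of_real (f y) * (m \<theta> * char_at \<theta> (x - y)))
        = (\<Sum>y\<in>S. complex_of_real (f y) * (indicator torus \<theta> *\<^sub>R (m \<theta> * char_at \<theta> (x - y))))" for \<theta>
      by (simp add: scaleR_sum_right)
    then show ?thesis
      using int by (simp add: set_lebesgue_integral_def set_integrable_def
        Bochner_Integration.integral_sum del: mult_scaleR_right)
  qed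
  finally have eq: "(LINT \<theta>:torus|lborel. m \<theta> * fourier f \<theta> * char_at \<theta> x) =
      (\<Sum>y\<in>S. of_real (f y) * (LINT \<theta>:torus|lborel. m \<theta> * char_at \<theta> (x - y)))" .
  show ?thesis unfolding multiplier_fin_def multiplier_kernel_def eq
    by (simp add: sum_divide_distrib)
qed

lemma kernel_1: "multiplier_kernel (\<lambda>\<theta> :: real ^ 'n::finite. 1) x = (if x = 0 then 1 else 0)"
proof -
  have "((2 :: complex) * complex_of_real pi) ^ CARD('n) \<noteq> 0" by simp
  then show ?thesis by (simp add: multiplier_kernel_def integral_char_at)
qed

lemma multiplier_fin_1:
  assumes "fin_supp f"
  shows "multiplier_fin (\<lambda>\<theta> :: real ^ 'n::finite. 1) f = f"
proof
  fix x
  have int: "set_integrable lborel torus (\<lambda>\<theta> :: real ^ 'n. 1 :: complex)"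
    by (rule set_integrable_torus[where B = 1]) auto
  have "multiplier_fin (\<lambda>\<theta> :: real ^ 'n. 1) f x
      = (\<Sum>y\<in>insert x {y. f y \<noteq> 0}. f y * multiplier_kernel (\<lambda>\<theta> :: real ^ 'n. 1) (x - y))"
    by (rule multiplier_fin_kernel[OF int]) (use assms in auto)
  also have "\<dots> = (\<Sum>y\<in>insert x {y. f y \<noteq> 0}. if y = x then f y else 0)"
    by (intro sum.cong refl) (auto simp: kernel_1)
  also have "\<dots> = f x" using assms by (subst sum.delta) auto
  finally show "multiplier_fin (\<lambda>\<theta> :: real ^ 'n. 1) f x = f x" .
qed

text \<open>The kernel of \<open>fourier k\<close> and the multiplier with symbol 1 applied to
  \<open>k\<close> are the same integral, so Fourier inversion applies.\<close>

lemma kernel_fourier: "fin_supp k \<Longrightarrow> multiplier_kernel (fourier k) = k"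
  using multiplier_fin_1[of k] by (simp add: multiplier_kernel_def[abs_def] multiplier_fin_def[abs_def])

text \<open>Restricted to finitely supported functions, where \<open>fourier\<close> is a finite
  sum. Preservation of finite support is part of the notion so that it is closed under
  composition.\<close>

definition has_symbol ::
    "((int ^ 'n::finite \<Rightarrow> real) \<Rightarrow> int ^ 'n \<Rightarrow> real) \<Rightarrow> (real ^ 'n \<Rightarrow> complex) \<Rightarrow> bool" where
  "has_symbol T m \<longleftrightarrow>
     (\<forall>f. fin_supp f \<longrightarrow> fin_supp (T f) \<and> (\<forall>\<theta>. fourier (T f) \<theta> = m \<theta> * fourier f \<theta>))"

lemma has_symbolD:
  assumes "has_symbol T m" "fin_supp f"
  shows "fin_supp (T f)" "fourier (T f) \<theta> = m \<theta> * fourier f \<theta>"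
  using assms by (auto simp: has_symbol_def)

lemma has_symbol_multiplier_fin:
  assumes "has_symbol T m" "fin_supp f"
  shows "multiplier_fin m f = T f"
proof -
  have "multiplier_fin m f = multiplier_fin (\<lambda>_. 1) (T f)"
    unfolding multiplier_fin_def[abs_def] by (simp add: has_symbolD[OF assms])
  then show ?thesis using multiplier_fin_1[OF has_symbolD(1)[OF assms]] by simp
qed

lemma has_symbol_shift:
  fixes v :: "int ^ 'n::finite"
  shows "has_symbol (\<lambda>f x. f (x + v)) (\<lambda>\<theta>. char_at \<theta> v)"
  unfolding has_symbol_def
proof (intro allI impI conjI)
  fix f :: "int ^ 'n \<Rightarrow> real" and \<theta>
  assume f: "fin_supp f"
  have eq: "{x. f (x + v) \<noteq> 0} = (\<lambda>y. y - v) ` {y. f y \<noteq> 0}"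
    by (auto simp: image_iff) (metis add_diff_cancel)
  show "fin_supp (\<lambda>x. f (x + v))" unfolding eq using f by simp
  have "fourier (\<lambda>x. f (x + v)) \<theta> = (\<Sum>y | f y \<noteq> 0. of_real (f y) * cnj (char_at \<theta> (y - v)))"
    unfolding fourier_def eq by (subst sum.reindex) (auto simp: inj_on_def)
  also have "\<dots> = char_at \<theta> v * fourier f \<theta>"
    unfolding fourier_def by (simp add: char_at_diff sum_distrib_left mult_ac)
  finally show "fourier (\<lambda>x. f (x + v)) \<theta> = char_at \<theta> v * fourier f \<theta>" .
qed

lemma has_symbol_id: "has_symbol (\<lambda>f. f) (\<lambda>\<theta>. 1)"
  by (simp add: has_symbol_def)

lemma has_symbol_comp:
  assumes "has_symbol S m" "has_symbol T n"
  shows "has_symbol (\<lambda>f. S (T f)) (\<lambda>\<theta>. m \<theta> * n \<theta>)"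
  using assms by (auto simp: has_symbol_def mult.assoc)

lemma fin_supp_add: "fin_supp f \<Longrightarrow> fin_supp g \<Longrightarrow> fin_supp (\<lambda>x. f x + g x)"
  by (rule finite_subset[of _ "{x. f x \<noteq> 0} \<union> {x. g x \<noteq> 0}"]) auto

lemma fin_supp_cmult: "fin_supp f \<Longrightarrow> fin_supp (\<lambda>x. c * f x)"
  by (rule finite_subset[of _ "{x. f x \<noteq> 0}"]) auto

lemma fin_supp_diff: "fin_supp f \<Longrightarrow> fin_supp g \<Longrightarrow> fin_supp (\<lambda>x. f x - g x)"
  by (rule finite_subset[of _ "{x. f x \<noteq> 0} \<union> {x. g x \<noteq> 0}"]) auto

lemma has_symbol_add:
  assumes "has_symbol S m" "has_symbol T n"
  shows "has_symbol (\<lambda>f x. S f x + T f x) (\<lambda>\<theta>. m \<theta> + n \<theta>)"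
  unfolding has_symbol_def
proof (intro allI impI conjI)
  fix f :: "int ^ 'a \<Rightarrow> real" and \<theta>
  assume f: "fin_supp f"
  let ?A = "{x. S f x \<noteq> 0} \<union> {x. T f x \<noteq> 0}"
  note S = has_symbolD[OF assms(1) f] and T = has_symbolD[OF assms(2) f]
  show "fin_supp (\<lambda>x. S f x + T f x)" using S T by (intro fin_supp_add)
  have fin: "finite ?A" using S T by simp
  have "fourier (\<lambda>x. S f x + T f x) \<theta> = fourier (S f) \<theta> + fourier (T f) \<theta>"
    by (subst (1 2 3) fourier_superset[OF fin]) (auto simp: sum.distrib distrib_right)
  then show "fourier (\<lambda>x. S f x + T f x) \<theta> = (m \<theta> + n \<theta>) * fourier f \<theta>"
    using S T by (simp add: distrib_right)
qed

lemma has_symbol_cmult: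
  assumes "has_symbol T m"
  shows "has_symbol (\<lambda>f x. c * T f x) (\<lambda>\<theta>. of_real c * m \<theta>)"
  unfolding has_symbol_def
proof (intro allI impI conjI)
  fix f :: "int ^ 'a \<Rightarrow> real" and \<theta>
  assume f: "fin_supp f"
  note T = has_symbolD[OF assms f]
  show "fin_supp (\<lambda>x. c * T f x)" using T by (intro fin_supp_cmult)
  have "fourier (\<lambda>x. c * T f x) \<theta> = of_real c * fourier (T f) \<theta>"
    by (subst (1 2) fourier_superset[OF T(1)]) (auto simp: sum_distrib_left mult_ac)
  then show "fourier (\<lambda>x. c * T f x) \<theta> = of_real c * m \<theta> * fourier f \<theta>"
    using T by simp
qed

lemma has_symbol_diff:
  assumes "has_symbol S m" "has_symbol T n"
  shows "has_symbol (\<lambda>f x. S f x - T f x) (\<lambda>\<theta>. m \<theta> - n \<theta>)"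
  using has_symbol_add[OF assms(1) has_symbol_cmult[OF assms(2), of "-1"]] by simp

lemma has_symbol_sum:
  assumes "finite A" "\<And>a. a \<in> A \<Longrightarrow> has_symbol (T a) (m a)"
  shows "has_symbol (\<lambda>f x. \<Sum>a\<in>A. T a f x) (\<lambda>\<theta>. \<Sum>a\<in>A. m a \<theta>)"
  using assms
proof (induction A rule: finite_induct)
  case empty
  then show ?case by (simp add: has_symbol_def fourier_def)
next
  case (insert a A)
  then show ?case using has_symbol_add[of "T a" "m a"] by simp
qed

lemma has_symbol_cong:
  "has_symbol T m \<Longrightarrow> (\<And>f x. T f x = T' f x) \<Longrightarrow> (\<And>\<theta>. m \<theta> = m' \<theta>) \<Longrightarrow> has_symbol T' m'"
  by (metis (no_types, lifting) ext)

text \<open>The bridge from finite-range approximations to the singular symbols. Measurability of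
  \<open>m\<close> is not assumed but inherited from the continuous \<open>\<mu> n\<close>.\<close>

lemma kernel_dominated_convergence:
  fixes \<mu> :: "nat \<Rightarrow> real ^ 'n::finite \<Rightarrow> complex"
  assumes cont: "\<And>n. continuous_on UNIV (\<mu> n)"
    and bound: "\<And>n \<theta>. \<theta> \<in> torus \<Longrightarrow> norm (\<mu> n \<theta>) \<le> B"
    and lim: "\<And>\<theta>. \<theta> \<in> torus \<Longrightarrow> (\<lambda>n. \<mu> n \<theta>) \<longlonglongrightarrow> m \<theta>"
  shows "set_integrable lborel torus m" "(\<lambda>n. multiplier_kernel (\<mu> n) x) \<longlonglongrightarrow> multiplier_kernel m x"
proof -
  have [measurable]: "\<mu> n \<in> borel_measurable borel" for n
    using cont by (rule borel_measurable_continuous_onI)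
  have lim': "(\<lambda>n. indicator torus \<theta> *\<^sub>R \<mu> n \<theta>) \<longlonglongrightarrow> indicator torus \<theta> *\<^sub>R m \<theta>" for \<theta>
    using lim[of \<theta>] by (auto simp: indicator_def)
  have meas: "(\<lambda>\<theta>. indicator torus \<theta> *\<^sub>R m \<theta>) \<in> borel_measurable borel"
    by (rule borel_measurable_LIMSEQ_metric[OF _ lim']) measurable
  have mB: "norm (m \<theta>) \<le> B" if "\<theta> \<in> torus" for \<theta>
    by (rule tendsto_upperbound[OF tendsto_norm[OF lim[OF that]]]) (use bound that in auto)
  show "set_integrable lborel torus m" using meas mB by (rule set_integrable_torus)
  have [measurable]: "(\<lambda>\<theta>. char_at \<theta> x) \<in> borel_measurable borel"
    by (intro borel_measurable_continuous_onI continuous_intros)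
  have "(\<lambda>n. LINT \<theta>:torus|lborel. \<mu> n \<theta> * char_at \<theta> x) \<longlonglongrightarrow> (LINT \<theta>:torus|lborel. m \<theta> * char_at \<theta> x)"
    unfolding set_lebesgue_integral_def
  proof (rule integral_dominated_convergence)
    show "integrable lborel (\<lambda>\<theta>. B * indicator torus (\<theta> :: real ^ 'n))"
      by (simp add: integrable_indicator_torus)
    have "(\<lambda>\<theta>. (indicator torus \<theta> *\<^sub>R m \<theta>) * char_at \<theta> x) \<in> borel_measurable borel"
      using meas by measurable
    then show "(\<lambda>\<theta>. indicator torus \<theta> *\<^sub>R (m \<theta> * char_at \<theta> x)) \<in> borel_measurable lborel" by simp
    show "AE \<theta> in lborel. (\<lambda>n. indicator torus \<theta> *\<^sub>R (\<mu> n \<theta> * char_at \<theta> x))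
        \<longlonglongrightarrow> indicator torus \<theta> *\<^sub>R (m \<theta> * char_at \<theta> x)"
      using lim by (intro AE_I2) (auto simp: indicator_def intro!: tendsto_intros)
    show "AE \<theta> in lborel. norm (indicator torus \<theta> *\<^sub>R (\<mu> n \<theta> * char_at \<theta> x)) \<le> B * indicator torus \<theta>" for n
      using bound by (intro AE_I2) (auto simp: indicator_def norm_mult)
  qed measurable
  then show "(\<lambda>n. multiplier_kernel (\<mu> n) x) \<longlonglongrightarrow> multiplier_kernel m x"
    unfolding multiplier_kernel_def by (intro tendsto_intros) auto
qed

section \<open>Upper bound on finitely supported functions\<close>

section \<open>Burkholder's function\<close>

text \<open>Here \<open>c\<close> plays the role of \<open>pstar p - 1\<close>. The usual leading
  constant p (1 - 1/pstar)^(p - 1) is left out; it reappears in \<open>burkholder_majorant\<close>,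
  since c / (1 + c) = 1 - 1 / pstar.\<close>

definition burkholder :: "real \<Rightarrow> real \<Rightarrow> real \<Rightarrow> real \<Rightarrow> real" where
  "burkholder p c x y = (\<bar>y\<bar> - c * \<bar>x\<bar>) * (\<bar>x\<bar> + \<bar>y\<bar>) powr (p - 1)"

lemma burkholder_uminus:
  "burkholder p c (- x) y = burkholder p c x y" "burkholder p c x (- y) = burkholder p c x y"
  by (simp_all add: burkholder_def)

text \<open>The line of slope \<open>L\<close> through the point at \<open>a\<close> lies above
  \<open>f\<close> on both sides, so a chord across \<open>a\<close> passes below
  \<open>f a\<close>. Such a chord is then compared with the chord from its end point to
  \<open>a\<close> on the side containing the intermediate point.\<close>

lemma concave_on_glue:
  fixes f :: "real \<Rightarrow> real"
  assumes S: "convex S" "a \<in> S"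
    and 1: "concave_on (S \<inter> {..a}) f" and 2: "concave_on (S \<inter> {a..}) f"
    and L: "\<And>x. x \<in> S \<Longrightarrow> f x \<le> f a + L * (x - a)"
  shows "concave_on S f"
proof -
  have main: "u * f x + v * f y \<le> f (u * x + v * y)"
    if xy: "x \<in> S" "y \<in> S" "x \<le> y" "0 \<le> u" "0 \<le> v" "u + v = 1" for x y u v
  proof -
    consider "y \<le> a" | "a \<le> x" | "x < a" "a < y" by linarith
    then show ?thesis
    proof cases
      case 1
      then show ?thesis using xy assms(3) by (auto simp: concave_on_iff)
    next
      case 2
      then show ?thesis using xy assms(4) by (auto simp: concave_on_iff)
    next
      case 3
      define z where "z = u * x + v * y"
      have u: "u = 1 - v" using xy by simp
      have zx: "z - x = v * (y - x)" unfolding z_def u by (simp add: algebra_simps)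
      have zy: "y - z = u * (y - x)" unfolding z_def u by (simp add: algebra_simps)
      have fx: "f x \<le> f a + L * (x - a)" and fy: "f y \<le> f a + L * (y - a)"
        using L xy by auto
      \<comment> \<open>Weighting the two bounds by \<open>y - a\<close> and \<open>a - x\<close>
        eliminates the slope \<open>L\<close>.\<close>
      have "f x * (y - a) + f y * (a - x) \<le> (f a + L * (x - a)) * (y - a) + (f a + L * (y - a)) * (a - x)"
        using 3 fx fy by (intro add_mono mult_right_mono) auto
      also have "\<dots> = f a * (y - x)" by (simp add: algebra_simps)
      finally have chord: "f x * (y - a) + f y * (a - x) \<le> f a * (y - x)" .
      have pos: "0 < y - x" using 3 by simp
      have "0 \<le> v * (y - x)" "0 \<le> u * (y - x)" using pos xy by auto
      then have zb: "x \<le> z" "z \<le> y" using zx zy by auto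
      show ?thesis
      proof (cases "z \<le> a")
        case True
        define t where "t = (z - x) / (a - x)"
        have t: "0 \<le> t" "t \<le> 1" using True 3 zb by (auto simp: t_def field_simps)
        have "t * (a - x) = z - x" using 3 by (simp add: t_def)
        then have zt: "z = (1 - t) * x + t * a" by (simp add: algebra_simps)
        have "(1 - t) * f x + t * f a \<le> f ((1 - t) * x + t * a)"
          using assms(3) t 3 xy S by (auto simp: concave_on_iff)
        moreover have "u * f x + v * f y \<le> (1 - t) * f x + t * f a"
        proof -
          have "(a - x) * (f y - f x) \<le> (y - x) * (f a - f x)" using chord by (simp add: algebra_simps)
          then have "t * ((a - x) * (f y - f x)) \<le> t * ((y - x) * (f a - f x))"
            using t by (intro mult_left_mono)
          moreover have "t * (a - x) = v * (y - x)" using zx 3 by (simp add: t_def)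
          then have "t * ((a - x) * (f y - f x)) = v * (y - x) * (f y - f x)" by (metis mult.assoc)
          ultimately have "(v * (f y - f x)) * (y - x) \<le> (t * (f a - f x)) * (y - x)"
            by (simp add: mult_ac)
          then have "v * (f y - f x) \<le> t * (f a - f x)" using pos by simp
          then show ?thesis unfolding u by (simp add: algebra_simps)
        qed
        ultimately show ?thesis using zt z_def by simp
      next
        case False
        define t where "t = (y - z) / (y - a)"
        have t: "0 \<le> t" "t \<le> 1" using False 3 zb by (auto simp: t_def field_simps)
        have "t * (y - a) = y - z" using 3 by (simp add: t_def)
        then have zt: "z = (1 - t) * y + t * a" by (simp add: algebra_simps)
        have "(1 - t) * f y + t * f a \<le> f ((1 - t) * y + t * a)"
          using assms(4) t 3 xy S by (auto simp: concave_on_iff)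
        moreover have "u * f x + v * f y \<le> (1 - t) * f y + t * f a"
        proof -
          have "(y - a) * (f x - f y) \<le> (y - x) * (f a - f y)" using chord by (simp add: algebra_simps)
          then have "t * ((y - a) * (f x - f y)) \<le> t * ((y - x) * (f a - f y))"
            using t by (intro mult_left_mono)
          moreover have "t * (y - a) = u * (y - x)" using zy 3 by (simp add: t_def)
          then have "t * ((y - a) * (f x - f y)) = u * (y - x) * (f x - f y)" by (metis mult.assoc)
          ultimately have "(u * (f x - f y)) * (y - x) \<le> (t * (f a - f y)) * (y - x)"
            by (simp add: mult_ac)
          then have "u * (f x - f y) \<le> t * (f a - f y)" using pos by simp
          moreover have v: "v = 1 - u" using xy by simp
          ultimately show ?thesis unfolding v by (simp add: algebra_simps)
        qed
        ultimately show ?thesis using zt z_def by simp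
      qed
    qed
  qed
  have "u * f x + v * f y \<le> f (u * x + v * y)"
    if "x \<in> S" "y \<in> S" "0 \<le> u" "0 \<le> v" "u + v = 1" for x y u v
    using main[of x y u v] main[of y x v u] that by (cases "x \<le> y") (auto simp: add.commute)
  then show ?thesis using S by (auto simp: concave_on_iff)
qed

text \<open>The second derivative equals 4 r (2k + d)^(r - 2) times \<alpha> (r + 1) k + (\<alpha> d
  + (r - 1) \<beta>), and the hypotheses make both summands nonpositive. The second claim is the
  tangent bound at 0, needed for gluing pieces there.\<close>

lemma concave_affine_powr:
  fixes \<alpha> \<beta> d r :: real
  assumes d: "0 < d" and r: "0 < r" and \<alpha>: "\<alpha> \<le> 0" and \<beta>: "\<alpha> * d + (r - 1) * \<beta> \<le> 0"
  defines "f \<equiv> \<lambda>k. (\<alpha> * k + \<beta>) * (2 * k + d) powr r"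
  shows "concave_on {0..} f"
    and "0 \<le> k \<Longrightarrow> f k \<le> f 0 + (\<alpha> * d + 2 * r * \<beta>) * d powr (r - 1) * k"
proof -
  define f' where "f' k = \<alpha> * (2 * k + d) powr r + (\<alpha> * k + \<beta>) * (2 * r) * (2 * k + d) powr (r - 1)" for k
  define f'' where "f'' k = 4 * r * \<alpha> * (2 * k + d) powr (r - 1)
    + (\<alpha> * k + \<beta>) * (4 * r * (r - 1)) * (2 * k + d) powr (r - 2)" for k
  have D: "((\<lambda>k. (2 * k + d) powr s) has_real_derivative 2 * s * (2 * k + d) powr (s - 1)) (at k)"
    if "0 \<le> k" for k s
  proof -
    have "0 < 2 * k + d" using that d by simp
    then show ?thesis by (auto intro!: derivative_eq_intros simp: powr_diff)
  qed
  have D1: "(f has_real_derivative f' k) (at k)" if "0 \<le> k" for k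
    unfolding f_def f'_def using that d
    by (auto intro!: derivative_eq_intros D simp: add_pos_nonneg algebra_simps)
  have D2: "(f' has_real_derivative f'' k) (at k)" if "0 \<le> k" for k
    unfolding f'_def f''_def using that d
    by (auto intro!: derivative_eq_intros D simp: add_pos_nonneg algebra_simps)
  have N: "f'' k \<le> 0" if "0 \<le> k" for k
  proof -
    have pos: "0 < 2 * k + d" using that d by simp
    have "f'' k = 4 * r * (2 * k + d) powr (r - 2) * (\<alpha> * (r + 1) * k + (\<alpha> * d + (r - 1) * \<beta>))"
    proof -
      have "(2 * k + d) powr (r - 1) = (2 * k + d) powr (r - 2) * (2 * k + d)"
        using pos powr_add[of "2 * k + d" "r - 2" 1] by simp
      then show ?thesis unfolding f''_def by (simp add: algebra_simps)
    qed
    moreover have "\<alpha> * (r + 1) * k \<le> 0" using \<alpha> r that by (intro mult_nonpos_nonneg) auto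
    then have "\<alpha> * (r + 1) * k + (\<alpha> * d + (r - 1) * \<beta>) \<le> 0" using \<beta> by simp
    ultimately show ?thesis using r by (simp add: mult_nonneg_nonpos)
  qed
  show conc: "concave_on {0..} f"
    by (rule f''_le0_imp_concave[where f' = f' and f'' = f'']) (use D1 D2 N in auto)
  show "f k \<le> f 0 + (\<alpha> * d + 2 * r * \<beta>) * d powr (r - 1) * k" if k: "0 \<le> k"
  proof (cases "k = 0")
    case False
    have "\<exists>z>0. z < k \<and> f k - f 0 = (k - 0) * f' z"
      using False k by (intro MVT2) (auto intro: D1)
    then obtain z where z: "0 < z" "z < k" "f k - f 0 = k * f' z" by auto
    have "f' z \<le> f' 0"
      by (rule DERIV_nonpos_imp_nonincreasing[of 0 z]) (use z D2 N in force)+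
    then have "k * f' z \<le> k * f' 0" using k by (intro mult_left_mono)
    moreover have "f' 0 = (\<alpha> * d + 2 * r * \<beta>) * d powr (r - 1)"
      using d powr_add[of d "r - 1" 1] by (simp add: f'_def algebra_simps)
    ultimately show ?thesis using z by (simp add: algebra_simps)
  qed simp
qed

lemma concave_on_reflect:
  fixes f :: "real \<Rightarrow> real"
  assumes "concave_on S f" "S' = (\<lambda>x. a - x) ` S"
  shows "concave_on S' (\<lambda>x. f (a - x))"
proof -
  have cS: "convex S" using assms(1) by (simp add: concave_on_iff)
  have key: "u * f (a - x) + v * f (a - y) \<le> f (a - (u * x + v * y)) \<and> a - (u * x + v * y) \<in> S"
    if "a - x \<in> S" "a - y \<in> S" "0 \<le> u" "0 \<le> v" "u + v = 1" for x y u v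
  proof -
    have "a - (u * x + v * y) = u * (a - x) + v * (a - y)"
    proof -
      have "u * (a - x) + v * (a - y) = (u + v) * a - (u * x + v * y)" by (simp add: algebra_simps)
      then show ?thesis using that by simp
    qed
    moreover have "u * (a - x) + v * (a - y) \<in> S"
      using cS that by (auto simp: convex_def)
    moreover have "u * f (a - x) + v * f (a - y) \<le> f (u * (a - x) + v * (a - y))"
      using assms(1) that by (auto simp: concave_on_iff)
    ultimately show ?thesis by simp
  qed
  have mem: "x \<in> S' \<longleftrightarrow> a - x \<in> S" for x
    unfolding assms(2) by (auto simp: image_iff) (metis add_diff_cancel_left' diff_add_cancel)
  show ?thesis unfolding concave_on_iff convex_def using key by (auto simp: mem)
qed

text \<open>The signs of \<open>h\<close> and \<open>d + h\<close> cut the line at 0 and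
  \<open>- d\<close>. Between the cuts |h| + |d + h| = d is constant and the function is the affine
  \<open>l\<close>; outside it has the form treated in \<open>concave_affine_powr\<close>. The slope
  of \<open>l\<close> is a supergradient at both cuts: at 0 this amounts to
  \<open>p - 1 \<le> c\<close>, at \<open>- d\<close> to \<open>1 \<le> c * (p - 1)\<close>. The
  same two inequalities give concavity of the outer pieces. They are the origin of the maximum in
  \<open>pstar\<close>.\<close>

lemma concave_burkholder_pos:
  assumes p: "1 < p" and c: "1 \<le> c" "p - 1 \<le> c" "1 \<le> c * (p - 1)" and d: "0 < d"
  shows "concave_on UNIV (\<lambda>h. burkholder p c h (d + h))"
proof -
  define \<phi> where "\<phi> h = burkholder p c h (d + h)" for h
  define r where "r = p - 1"
  have r: "0 < r" using p by (simp add: r_def)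
  define g1 where "g1 k = ((1 - c) * k + d) * (2 * k + d) powr r" for k
  define g3 where "g3 k = ((1 - c) * k + (- c * d)) * (2 * k + d) powr r" for k
  define l where "l h = ((1 + c) * h + d) * d powr r" for h
  have 1: "(1 - c) * d + (r - 1) * d \<le> 0"
  proof -
    have "(1 - c) * d + (r - 1) * d = (r - c) * d" by (simp add: algebra_simps)
    then show ?thesis using c d by (simp add: r_def mult_nonpos_nonneg)
  qed
  have 3: "(1 - c) * d + (r - 1) * (- c * d) \<le> 0"
  proof -
    have "(1 - c) * d + (r - 1) * (- c * d) = (1 - c * r) * d" by (simp add: algebra_simps)
    then show ?thesis using c d by (simp add: r_def mult_nonpos_nonneg)
  qed
  note g1 = concave_affine_powr[OF d r _ 1, folded g1_def]
  note g3 = concave_affine_powr[OF d r _ 3, folded g3_def]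
  have e1: "\<phi> h = g1 h" if "0 \<le> h" for h
    using that d by (simp add: \<phi>_def burkholder_def g1_def r_def algebra_simps)
  have e2: "\<phi> h = l h" if "- d \<le> h" "h \<le> 0" for h
    using that d by (simp add: \<phi>_def burkholder_def l_def r_def algebra_simps)
  have e3: "\<phi> h = g3 (- d - h)" if "h \<le> - d" for h
  proof -
    have "\<bar>d + h\<bar> = - d - h" "\<bar>h\<bar> = - h" using that d by auto
    then show ?thesis by (simp add: \<phi>_def burkholder_def g3_def r_def algebra_simps)
  qed
  have dr: "d powr (r - 1) * d = d powr r" using d powr_add[of d "r - 1" 1] by simp
  have le: "\<phi> h \<le> l h" for h
  proof -
    consider "0 \<le> h" | "- d \<le> h" "h \<le> 0" | "h \<le> - d" using d by linarith
    then show ?thesis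
    proof cases
      case 1
      have "\<phi> h \<le> g1 0 + ((1 - c) * d + 2 * r * d) * d powr (r - 1) * h"
        using g1(2)[OF _ 1] e1[OF 1] c by simp
      also have "\<dots> = d * d powr r + (1 - c + 2 * r) * h * (d powr (r - 1) * d)"
        by (simp add: g1_def algebra_simps)
      also have "\<dots> \<le> d * d powr r + (1 + c) * h * (d powr (r - 1) * d)"
        using c 1 d by (intro add_left_mono mult_right_mono) (auto simp: r_def)
      also have "\<dots> = l h" unfolding dr by (simp add: l_def algebra_simps)
      finally show ?thesis .
    next
      case 2
      then show ?thesis using e2 by simp
    next
      case 3
      then have k: "0 \<le> - d - h" by simp
      have "\<phi> h \<le> g3 0 + ((1 - c) * d + 2 * r * (- c * d)) * d powr (r - 1) * (- d - h)"
        using g3(2)[OF _ k] e3[OF 3] c by simp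
      also have "\<dots> = - c * d * d powr r + (1 - c - 2 * (c * r)) * (- d - h) * (d powr (r - 1) * d)"
        by (simp add: g3_def algebra_simps)
      also have "\<dots> \<le> - c * d * d powr r + (- (1 + c)) * (- d - h) * (d powr (r - 1) * d)"
        using c k d by (intro add_left_mono mult_right_mono) (auto simp: r_def)
      also have "\<dots> = l h" unfolding dr by (simp add: l_def algebra_simps)
      finally show ?thesis .
    qed
  qed
  have l0: "l h = l a + (1 + c) * d powr r * (h - a)" for h a
    by (simp add: l_def algebra_simps)
  have c3: "concave_on {..- d} \<phi>"
  proof -
    have "concave_on {..- d} (\<lambda>h. g3 (- d - h))"
      by (rule concave_on_reflect[OF g3(1)]) (use c in \<open>auto simp: image_iff intro!: bexI[of _ "- d - _"]\<close>)
    moreover have "concave_on {..- d} \<phi> = concave_on {..- d} (\<lambda>h. g3 (- d - h))"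
      unfolding concave_on_iff convex_def by (auto simp: e3)
    ultimately show ?thesis by simp
  qed
  have c2: "concave_on {- d..0} \<phi>"
  proof -
    have "\<phi> (u * x + v * y) = u * \<phi> x + v * \<phi> y"
      if "x \<in> {- d..0}" "y \<in> {- d..0}" "0 \<le> u" "0 \<le> v" "u + v = 1" for x y u v
    proof -
      have "u * x + v * y \<in> {- d..0}"
        using that convex_real_interval(5)[of "- d" 0] by (metis convex_def real_scaleR_def)
      then have "\<phi> (u * x + v * y) = l (u * x + v * y)" using e2 by auto
      also have "\<dots> = u * l x + v * l y"
      proof -
        have v: "v = 1 - u" using that by simp
        show ?thesis unfolding v l_def by (simp add: algebra_simps)
      qed
      finally show ?thesis using that e2 by auto
    qed
    then show ?thesis by (auto simp: concave_on_iff)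
  qed
  have c1: "concave_on {0..} \<phi>"
  proof -
    have "concave_on {0..} g1" using g1(1) c by simp
    moreover have "concave_on {0..} \<phi> = concave_on {0..} g1"
      unfolding concave_on_iff convex_def by (auto simp: e1)
    ultimately show ?thesis by simp
  qed
  have c23: "concave_on {..0} \<phi>"
  proof (rule concave_on_glue[where a = "- d" and L = "(1 + c) * d powr r"])
    have "{..0} \<inter> {..- d} = {..- d}" "{..0} \<inter> {- d..} = {- d..0}" using d by auto
    then show "concave_on ({..0} \<inter> {..- d}) \<phi>" "concave_on ({..0} \<inter> {- d..}) \<phi>" using c2 c3 by auto
    show "\<phi> x \<le> \<phi> (- d) + (1 + c) * d powr r * (x - - d)" for x
      using le[of x] l0[of x "- d"] e2[of "- d"] d by simp
  qed (use d in auto)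
  have "concave_on UNIV \<phi>"
  proof (rule concave_on_glue[where a = 0 and L = "(1 + c) * d powr r"])
    show "concave_on (UNIV \<inter> {..0}) \<phi>" "concave_on (UNIV \<inter> {0..}) \<phi>" using c23 c1 by auto
    show "\<phi> x \<le> \<phi> 0 + (1 + c) * d powr r * (x - 0)" for x
      using le[of x] l0[of x 0] e2[of 0] d by simp
  qed auto
  then show ?thesis by (simp add: \<phi>_def[abs_def])
qed

lemma concave_burkholder:
  assumes p: "1 < p" and c: "1 \<le> c" "p - 1 \<le> c" "1 \<le> c * (p - 1)"
  shows "concave_on UNIV (\<lambda>h. burkholder p c h (d + h))"
proof -
  consider "0 < d" | "d < 0" | "d = 0" by linarith
  then show ?thesis
  proof cases
    case 1
    then show ?thesis using concave_burkholder_pos[OF assms] by simp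
  next
    case 2
    then have "concave_on UNIV (\<lambda>h. burkholder p c (0 - h) (- d + (0 - h)))"
      using concave_on_reflect[OF concave_burkholder_pos[OF assms, of "- d"], of UNIV 0] by (simp add: surj_def)
    moreover have "burkholder p c (0 - h) (- d + (0 - h)) = burkholder p c h (d + h)" for h
      using burkholder_uminus(1)[of p c h] burkholder_uminus(2)[of p c h "d + h"] by (simp add: algebra_simps)
    ultimately show ?thesis by simp
  next
    case 3
    have lim: "((\<lambda>d. burkholder p c h (d + h)) \<longlongrightarrow> burkholder p c h (0 + h)) (at_right 0)" for h
      unfolding burkholder_def
      by (intro tendsto_intros tendsto_powr2 always_eventually) (use p in auto)
    have "u * burkholder p c x (0 + x) + v * burkholder p c y (0 + y)
            \<le> burkholder p c (u * x + v * y) (0 + (u * x + v * y))"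
      if "0 \<le> u" "0 \<le> v" "u + v = 1" for x y u v
    proof (rule tendsto_le)
      show "((\<lambda>d. burkholder p c (u * x + v * y) (d + (u * x + v * y))) \<longlongrightarrow>
          burkholder p c (u * x + v * y) (0 + (u * x + v * y))) (at_right 0)" by (rule lim)
      show "((\<lambda>d. u * burkholder p c x (d + x) + v * burkholder p c y (d + y)) \<longlongrightarrow>
          u * burkholder p c x (0 + x) + v * burkholder p c y (0 + y)) (at_right 0)"
        by (intro tendsto_intros lim)
      have "\<forall>\<^sub>F d::real in at_right 0. 0 < d" by (rule eventually_at_right_less)
      then show "\<forall>\<^sub>F d in at_right 0. u * burkholder p c x (d + x) + v * burkholder p c y (d + y)
          \<le> burkholder p c (u * x + v * y) (d + (u * x + v * y))"
        by eventually_elim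
          (use concave_burkholder_pos[OF assms] that in \<open>auto simp: concave_on_iff\<close>)
    qed simp
    then show ?thesis using 3 by (auto simp: concave_on_iff)
  qed
qed

text \<open>The function is concave up to \<open>s1\<close> and convex after it. On the convex part
  the double zero at \<open>s0\<close> is the minimum. On the concave part the minimum sits at an
  end point: \<open>f a\<close> is nonnegative by assumption, \<open>f s1\<close> by the convex
  part.\<close>

lemma nonneg_of_convex_concave:
  fixes f f' :: "real \<Rightarrow> real"
  assumes cont: "continuous_on {a..b} f"
    and D: "\<And>x. a < x \<Longrightarrow> x < b \<Longrightarrow> (f has_real_derivative f' x) (at x)"
    and s0: "a < s1" "s1 \<le> s0" "s0 < b" "f s0 = 0" "f' s0 = 0"
    and anti: "\<And>x y. a < x \<Longrightarrow> x \<le> y \<Longrightarrow> y \<le> s1 \<Longrightarrow> f' y \<le> f' x"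
    and mono: "\<And>x y. s1 \<le> x \<Longrightarrow> x \<le> y \<Longrightarrow> y < b \<Longrightarrow> f' x \<le> f' y"
    and fa: "0 \<le> f a" and x: "a \<le> x" "x \<le> b"
  shows "0 \<le> f x"
proof -
  have mvt: "\<exists>z. u < z \<and> z < v \<and> f v - f u = (v - u) * f' z" if "a \<le> u" "u < v" "v \<le> b" for u v
  proof -
    have "continuous_on {u..v} f" using cont that by (auto intro: continuous_on_subset)
    moreover have "f differentiable (at z)" if "u < z" "z < v" for z
      using D[of z] that \<open>a \<le> u\<close> \<open>v \<le> b\<close> by (auto simp: real_differentiable_def)
    ultimately obtain l z where z: "u < z" "z < v" "DERIV f z :> l" "f v - f u = (v - u) * l"
      using MVT[OF \<open>u < v\<close>] by blast
    moreover have "l = f' z" using D[of z] z \<open>a \<le> u\<close> \<open>v \<le> b\<close> DERIV_unique by force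
    ultimately show ?thesis by auto
  qed
  have right: "0 \<le> f x" if x: "s1 \<le> x" "x \<le> b" for x
  proof -
    consider "x = s0" | "s0 < x" | "x < s0" by linarith
    then show ?thesis
    proof cases
      case 2
      then obtain z where "s0 < z" "z < x" "f x - f s0 = (x - s0) * f' z"
        using mvt[of s0 x] s0 x by force
      moreover then have "0 \<le> f' z" using mono[of s0 z] s0 x by auto
      ultimately show ?thesis using s0 by (simp add: 2)
    next
      case 3
      then obtain z where "x < z" "z < s0" "f s0 - f x = (s0 - x) * f' z"
        using mvt[of x s0] s0 x by force
      moreover then have "f' z \<le> 0" using mono[of z s0] s0 x by auto
      then have "(s0 - x) * f' z \<le> 0" using 3 by (simp add: mult_nonneg_nonpos)
      ultimately show ?thesis using s0 by simp
    qed (use s0 in simp)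
  qed
  show ?thesis
  proof (rule ccontr)
    assume neg: "\<not> 0 \<le> f x"
    then have xs: "x < s1" using right[of x] x by (cases "x < s1") auto
    have "a < x" using neg fa x by (cases "a = x") auto
    then obtain z where z: "a < z" "z < x" "f x - f a = (x - a) * f' z"
      using mvt[of a x] x by auto
    have "f' z < 0"
    proof (rule ccontr)
      assume "\<not> f' z < 0"
      then have "0 \<le> (x - a) * f' z" using \<open>a < x\<close> by simp
      then show False using z neg fa by simp
    qed
    obtain w where w: "x < w" "w < s1" "f s1 - f x = (s1 - x) * f' w"
      using mvt[of x s1] xs x s0 by auto
    have "f' w \<le> f' z" using anti[of z w] z w by simp
    then have "(s1 - x) * f' w \<le> 0" using \<open>f' z < 0\<close> xs by (simp add: mult_nonneg_nonpos)
    moreover have "0 \<le> f s1" using right s0 by simp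
    ultimately show False using w neg by simp
  qed
qed

text \<open>Serves the end point condition of the majorisation. With \<open>r = p - 1\<close> it
  yields \<open>1 \<le> \<alpha>\<close> for \<open>p > 2\<close>, the value at
  \<open>s = 0\<close>; with \<open>r = 1 / (p - 1)\<close> it yields
  \<open>c * \<alpha> \<le> c powr p\<close> for \<open>p < 2\<close>, the value at
  \<open>s = 1\<close>.\<close>

lemma diff_mult_ln_le:
  fixes r :: real
  assumes "1 \<le> r"
  shows "(r - 1) * ln (1 + r) \<le> r * ln r"
proof -
  define \<psi> where "\<psi> r = r * ln r - (r - 1) * ln (1 + r)" for r :: real
  have "\<psi> 1 \<le> \<psi> r"
  proof (rule DERIV_nonneg_imp_nondecreasing[OF assms])
    fix x :: real assume x: "1 \<le> x" "x \<le> r"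
    have D: "(\<psi> has_real_derivative (ln x + 1 - ln (1 + x) - (x - 1) / (1 + x))) (at x)"
      unfolding \<psi>_def using x by (auto intro!: derivative_eq_intros simp: divide_inverse algebra_simps)
    have "1 + 1 / x = (1 + x) / x" using x by (simp add: field_simps)
    then have "ln (1 + x) - ln x = ln (1 + 1 / x)"
      using x by (simp add: ln_div)
    also have "\<dots> \<le> 1 / x" using x by (intro ln_add_one_self_le_self) auto
    also have "1 / x \<le> 2 / (1 + x)" using x by (simp add: field_simps)
    also have "2 / (1 + x) = 1 - (x - 1) / (1 + x)" using x by (simp add: field_simps)
    finally show "\<exists>y. (\<psi> has_real_derivative y) (at x) \<and> 0 \<le> y" using D by (intro exI conjI) auto
  qed
  then show ?thesis by (simp add: \<psi>_def)
qed

text \<open>The normalisation \<open>\<bar>x\<bar> + \<bar>y\<bar> = 1\<close>, \<open>s = \<bar>x\<bar>\<close> of Burkholder's majorisation.\<close>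

lemma burkholder_majorant_normalized:
  fixes p c s :: real
  assumes p: "1 < p" and c: "c = max (p - 1) (inverse (p - 1))" and s: "0 \<le> s" "s \<le> 1"
  shows "(1 - s) powr p - c powr p * s powr p \<le> p * (c / (1 + c)) powr (p - 1) * (1 - (1 + c) * s)"
proof -
  define \<alpha> where "\<alpha> = p * (c / (1 + c)) powr (p - 1)"
  define f where "f s = \<alpha> * (1 - (1 + c) * s) - (1 - s) powr p + c powr p * s powr p" for s
  define f' where "f' s = - \<alpha> * (1 + c) + p * (1 - s) powr (p - 1) + c powr p * p * s powr (p - 1)" for s
  define f'' where "f'' s = p * (p - 1) * (c powr p * s powr (p - 2) - (1 - s) powr (p - 2))" for s
  \<comment> \<open>The point |y| = c |x|, where both sides of the claim vanish. The factor \<alpha>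
    is the one that makes their derivatives agree there too, so the majorant touches to first
    order.\<close>
  define s0 where "s0 = 1 / (1 + c)"
  have c1: "1 \<le> c"
  proof (cases "2 \<le> p")
    case False
    then have "1 \<le> inverse (p - 1)" using p by (intro one_le_inverse) auto
    then show ?thesis by (simp add: c)
  qed (simp add: c)
  have s01: "0 < s0" "s0 < 1" "1 - s0 = c * s0" using c1 by (auto simp: s0_def field_simps)
  have cont: "continuous_on {0..1} f"
    unfolding f_def using p by (intro continuous_intros continuous_on_powr') auto
  have D1: "(f has_real_derivative f' x) (at x)" if "0 < x" "x < 1" for x
    unfolding f_def f'_def using that by (auto intro!: derivative_eq_intros simp: algebra_simps)
  have D2: "(f' has_real_derivative f'' x) (at x)" if "0 < x" "x < 1" for x
    unfolding f'_def f''_def using that by (auto intro!: derivative_eq_intros simp: algebra_simps)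
  have cs0: "(1 - s0) powr p = c powr p * s0 powr p" using s01 c1 by (simp add: powr_mult)
  have f0: "f s0 = 0" using cs0 c1 by (simp add: f_def) (simp add: s0_def)
  have f'0: "f' s0 = 0"
  proof -
    have "(1 - s0) powr (p - 1) = (c / (1 + c)) powr (p - 1)" by (simp add: s01) (simp add: s0_def)
    moreover have "c powr p * s0 powr (p - 1) = c * (c / (1 + c)) powr (p - 1)"
      using c1 powr_add[of c "p - 1" 1] by (simp add: s0_def powr_divide)
    ultimately show ?thesis by (simp add: f'_def \<alpha>_def algebra_simps)
  qed
  have main: "0 \<le> f s"
  proof (cases p "2 :: real" rule: linorder_cases)
    case equal
    then have "c = 1" by (simp add: c)
    then show ?thesis using equal s by (simp add: f_def \<alpha>_def power2_eq_square algebra_simps)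
  next
    case greater
    then have cp: "c = p - 1" using c by (simp add: max_def field_simps)
    \<comment> \<open>The sign of \<open>f''\<close> changes where (1 - x)^(p - 2) = c^p x^(p - 2),
      that is at 1 - x = \<kappa> x. This is the inflection point \<open>s1\<close>; since \<kappa>
      \<ge> c it lies to the left of \<open>s0\<close>.\<close>
    define \<kappa> where "\<kappa> = c powr (p / (p - 2))"
    define s1 where "s1 = 1 / (1 + \<kappa>)"
    have \<kappa>c: "c \<le> \<kappa>"
      using c1 greater powr_mono[of 1 "p / (p - 2)" c] by (simp add: \<kappa>_def)
    have \<kappa>p: "\<kappa> powr (p - 2) = c powr p" using greater by (simp add: \<kappa>_def powr_powr)
    have s1: "0 < s1" "s1 \<le> s0" using \<kappa>c c1 by (auto simp: s1_def s0_def field_simps)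
    have le1: "f'' x \<le> 0" if "0 < x" "x \<le> s1" for x
    proof -
      have "\<kappa> * x \<le> 1 - x" using that \<kappa>c c1 by (simp add: s1_def field_simps)
      then have "(\<kappa> * x) powr (p - 2) \<le> (1 - x) powr (p - 2)"
        using greater that \<kappa>c c1 by (intro powr_mono2) auto
      then have "c powr p * x powr (p - 2) \<le> (1 - x) powr (p - 2)"
        using that \<kappa>c c1 by (simp add: powr_mult \<kappa>p)
      then show ?thesis using p by (simp add: f''_def mult_nonneg_nonpos)
    qed
    have ge1: "0 \<le> f'' x" if "s1 \<le> x" "x < 1" for x
    proof -
      have "1 - x \<le> \<kappa> * x" using that \<kappa>c c1 by (simp add: s1_def field_simps)
      then have "(1 - x) powr (p - 2) \<le> (\<kappa> * x) powr (p - 2)"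
        using greater that \<kappa>c c1 by (intro powr_mono2) auto
      then have "(1 - x) powr (p - 2) \<le> c powr p * x powr (p - 2)"
        using that s1 \<kappa>c c1 by (simp add: powr_mult \<kappa>p)
      then show ?thesis using p by (simp add: f''_def)
    qed
    show ?thesis
    proof (rule nonneg_of_convex_concave[OF cont D1 s1 s01(2) f0 f'0])
      show "f' y \<le> f' x" if "0 < x" "x \<le> y" "y \<le> s1" for x y
      proof (rule DERIV_nonpos_imp_nonincreasing[where f = f'])
        fix z assume "x \<le> z" "z \<le> y"
        then have "0 < z" "z < 1" "z \<le> s1" using that s1 s01 by auto
        then show "\<exists>d. (f' has_real_derivative d) (at z) \<and> d \<le> 0" using D2 le1 by blast
      qed (use that in auto)
      show "f' x \<le> f' y" if "s1 \<le> x" "x \<le> y" "y < 1" for x y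
      proof (rule DERIV_nonneg_imp_nondecreasing[where f = f'])
        fix z assume "x \<le> z" "z \<le> y"
        then have "0 < z" "z < 1" "s1 \<le> z" using that s1 s01 by auto
        then show "\<exists>d. (f' has_real_derivative d) (at z) \<and> 0 \<le> d" using D2 ge1 by blast
      qed (use that in auto)
      have "0 \<le> ln p + (p - 1) * (ln (p - 1) - ln p)"
        using diff_mult_ln_le[of "p - 1"] greater by (simp add: algebra_simps)
      also have "\<dots> = ln \<alpha>"
        using greater by (simp add: \<alpha>_def cp ln_mult ln_powr ln_div)
      finally have "1 \<le> \<alpha>" using greater by (simp add: \<alpha>_def cp)
      then show "0 \<le> f 0" using p by (simp add: f_def)
    qed (use s in auto)
  next
    case less
    then have cp: "c = inverse (p - 1)"
      using c p one_le_inverse[of "p - 1"] by (simp add: max_def)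
    define \<kappa> where "\<kappa> = c powr (p / (p - 2))"
    define s1 where "s1 = 1 / (1 + \<kappa>)"
    have \<kappa>0: "0 < \<kappa>" using c1 by (simp add: \<kappa>_def)
    have \<kappa>c: "\<kappa> \<le> c"
      using c1 less p powr_mono[of "p / (p - 2)" 1 c] by (simp add: \<kappa>_def field_simps)
    have \<kappa>p: "\<kappa> powr (p - 2) = c powr p" using less by (simp add: \<kappa>_def powr_powr)
    have s1: "s0 \<le> s1" "s1 < 1" using \<kappa>c c1 \<kappa>0 by (auto simp: s1_def s0_def field_simps)
    have ge1: "0 \<le> f'' x" if "0 < x" "x \<le> s1" for x
    proof -
      have "\<kappa> * x \<le> 1 - x" using that \<kappa>0 by (simp add: s1_def field_simps)
      then have "(1 - x) powr (p - 2) \<le> (\<kappa> * x) powr (p - 2)"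
        using less that \<kappa>0 by (intro powr_mono2') auto
      then have "(1 - x) powr (p - 2) \<le> c powr p * x powr (p - 2)"
        using that \<kappa>0 by (simp add: powr_mult \<kappa>p)
      then show ?thesis using p by (simp add: f''_def)
    qed
    have le1: "f'' x \<le> 0" if "s1 \<le> x" "x < 1" for x
    proof -
      have "1 - x \<le> \<kappa> * x" using that \<kappa>0 by (simp add: s1_def field_simps)
      then have "(\<kappa> * x) powr (p - 2) \<le> (1 - x) powr (p - 2)"
        using less that \<kappa>0 by (intro powr_mono2') auto
      then have "c powr p * x powr (p - 2) \<le> (1 - x) powr (p - 2)"
        using that s1 s01 \<kappa>0 by (simp add: powr_mult \<kappa>p)
      then show ?thesis using p by (simp add: f''_def mult_nonneg_nonpos)
    qed
    \<comment> \<open>For \<open>p < 2\<close> the exponent \<open>p - 2\<close> is negative, and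
      the convex part precedes the concave one. Reflection at 1/2 restores the order required by
      \<open>nonneg_of_convex_concave\<close>.\<close>
    have "0 \<le> (\<lambda>x. f (1 - x)) (1 - s)"
    proof (rule nonneg_of_convex_concave[where f = "\<lambda>x. f (1 - x)" and x = "1 - s" and a = 0 and b = 1 and ?s1.0 = "1 - s1" and ?s0.0 = "1 - s0" and f' = "\<lambda>x. - f' (1 - x)"])
      show "continuous_on {0..1} (\<lambda>x. f (1 - x))"
        by (rule continuous_on_compose2[OF cont]) (auto intro!: continuous_intros)
      show "((\<lambda>x. f (1 - x)) has_real_derivative - f' (1 - x)) (at x)" if "0 < x" "x < 1" for x
      proof -
        have "(f has_real_derivative f' (1 - x)) (at (1 - x))" using that by (intro D1) auto
        moreover have "((\<lambda>x. 1 - x) has_real_derivative - 1) (at x)" by (auto intro!: derivative_eq_intros)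
        ultimately show ?thesis using DERIV_chain2 by fastforce
      qed
      show "- f' (1 - y) \<le> - f' (1 - x)" if "0 < x" "x \<le> y" "y \<le> 1 - s1" for x y
      proof -
        have "f' (1 - x) \<le> f' (1 - y)"
        proof (rule DERIV_nonpos_imp_nonincreasing[where f = f'])
          fix z assume "1 - y \<le> z" "z \<le> 1 - x"
          then have "0 < z" "z < 1" "s1 \<le> z" using that s1 s01 by auto
          then show "\<exists>d. (f' has_real_derivative d) (at z) \<and> d \<le> 0" using D2 le1 by blast
        qed (use that in auto)
        then show ?thesis by simp
      qed
      show "- f' (1 - x) \<le> - f' (1 - y)" if "1 - s1 \<le> x" "x \<le> y" "y < 1" for x y
      proof -
        have "f' (1 - y) \<le> f' (1 - x)"
        proof (rule DERIV_nonneg_imp_nondecreasing[where f = f'])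
          fix z assume "1 - y \<le> z" "z \<le> 1 - x"
          then have "0 < z" "z < 1" "z \<le> s1" using that s1 s01 by auto
          then show "\<exists>d. (f' has_real_derivative d) (at z) \<and> 0 \<le> d" using D2 ge1 by blast
        qed (use that in auto)
        then show ?thesis by simp
      qed
      have r: "1 \<le> 1 / (p - 1)" using p less by simp
      have "(1 / (p - 1) - 1) * (ln p - ln (p - 1)) \<le> - (1 / (p - 1)) * ln (p - 1)"
      proof -
        have "1 + 1 / (p - 1) = p / (p - 1)" using p by (simp add: field_simps)
        then show ?thesis using diff_mult_ln_le[OF r] p by (simp add: ln_div)
      qed
      then have "(p - 1) * ((1 / (p - 1) - 1) * (ln p - ln (p - 1))) \<le> (p - 1) * (- (1 / (p - 1)) * ln (p - 1))"
        using p by (intro mult_left_mono) auto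
      moreover have "(p - 1) * ((1 / (p - 1) - 1) * X) = (2 - p) * X" for X
      proof -
        have "(p - 1) * (1 / (p - 1) - 1) = 2 - p" using p by (simp add: right_diff_distrib)
        then show ?thesis by (metis mult.assoc)
      qed
      ultimately have ineq: "(2 - p) * (ln p - ln (p - 1)) \<le> - ln (p - 1)"
        using p by simp
      have "ln \<alpha> = ln p + (p - 1) * (- ln p)"
      proof -
        have "c / (1 + c) = 1 / p" using p by (simp add: cp field_simps)
        then show ?thesis using p by (simp add: \<alpha>_def ln_mult ln_powr ln_div)
      qed
      also have "\<dots> \<le> (p - 1) * ln c"
        using ineq p by (simp add: cp ln_inverse algebra_simps)
      also have "\<dots> = ln (c powr (p - 1))" using c1 by (simp add: ln_powr)
      finally have ln_le: "ln \<alpha> \<le> ln (c powr (p - 1))" .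
      have "0 < \<alpha>" "0 < c powr (p - 1)" using p c1 by (auto simp: \<alpha>_def)
      then have "\<alpha> \<le> c powr (p - 1)" using ln_le by (metis ln_le_cancel_iff)
      then have "c * \<alpha> \<le> c * c powr (p - 1)" using c1 by simp
      also have "\<dots> = c powr p" using c1 powr_add[of c "p - 1" 1] by simp
      finally show "0 \<le> f (1 - 0)" using p by (simp add: f_def algebra_simps)
    qed (use s s1 s01(1,2) f0 f'0 in auto)
    then show ?thesis by simp
  qed
  then show ?thesis by (simp add: f_def \<alpha>_def)
qed

text \<open>Both sides are homogeneous of degree \<open>p\<close> in (x, y), so dividing by |x| +
  |y| reduces to the normalised case.\<close>

lemma burkholder_majorant:
  assumes p: "1 < p" and c: "c = max (p - 1) (inverse (p - 1))"
  shows "\<bar>y\<bar> powr p - c powr p * \<bar>x\<bar> powr p \<le> p * (c / (1 + c)) powr (p - 1) * burkholder p c x y"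
proof (cases "x = 0 \<and> y = 0")
  case True
  then show ?thesis using p by (simp add: burkholder_def)
next
  case False
  define t where "t = \<bar>x\<bar> + \<bar>y\<bar>"
  have t: "0 < t" using False by (auto simp: t_def)
  define s where "s = \<bar>x\<bar> / t"
  have x: "\<bar>x\<bar> = t * s" using t by (simp add: s_def)
  have y: "\<bar>y\<bar> = t * (1 - s)" using t by (simp add: s_def t_def field_simps)
  have s: "0 \<le> s" "s \<le> 1" using t by (auto simp: s_def t_def)
  have tp: "t powr p = t * t powr (p - 1)" using t powr_add[of t "p - 1" 1] by simp
  have "\<bar>y\<bar> powr p - c powr p * \<bar>x\<bar> powr p = t powr p * ((1 - s) powr p - c powr p * s powr p)"
    unfolding x y powr_mult by (simp add: algebra_simps)
  also have "\<dots> \<le> t powr p * (p * (c / (1 + c)) powr (p - 1) * (1 - (1 + c) * s))"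
    using burkholder_majorant_normalized[OF p c s] by (intro mult_left_mono) auto
  also have "\<dots> = p * (c / (1 + c)) powr (p - 1) * burkholder p c x y"
    unfolding burkholder_def t_def[symmetric] by (simp add: x y tp algebra_simps)
  finally show ?thesis .
qed

section \<open>Finitely supported functions\<close>

text \<open>An infinite sum instead of a finite one over the support: translation and scaling then
  hold without side conditions, and supports need not be tracked.\<close>

definition lattice_sum :: "(int ^ 'n::finite \<Rightarrow> real) \<Rightarrow> real" where
  "lattice_sum f = (\<Sum>\<^sub>\<infinity>x. f x)"

lemma fin_supp_summable: "fin_supp f \<Longrightarrow> f summable_on UNIV"
  by (rule finite_nonzero_values_imp_summable_on) simp

lemma fin_supp_shift: "fin_supp f \<Longrightarrow> fin_supp (\<lambda>x. f (x + v))" for f :: "int ^ 'n::finite \<Rightarrow> real"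
  using has_symbolD(1)[OF has_symbol_shift] .

lemma fin_supp_mult: "fin_supp f \<Longrightarrow> fin_supp (\<lambda>x. f x * g x)"
  by (rule finite_subset[of _ "{x. f x \<noteq> 0}"]) auto

lemma fin_supp_powr: "fin_supp f \<Longrightarrow> fin_supp (\<lambda>x. \<bar>f x\<bar> powr p)"
  by (rule finite_subset[of _ "{x. f x \<noteq> 0}"]) auto

lemmas fin_supp_intros = fin_supp_add fin_supp_diff fin_supp_cmult fin_supp_shift fin_supp_mult fin_supp_powr

lemma lattice_sum_add: "fin_supp f \<Longrightarrow> fin_supp g \<Longrightarrow> lattice_sum (\<lambda>x. f x + g x) = lattice_sum f + lattice_sum g"
  unfolding lattice_sum_def by (intro infsum_add fin_supp_summable)

lemma lattice_sum_cmult: "lattice_sum (\<lambda>x. c * f x) = c * lattice_sum f"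
  unfolding lattice_sum_def by (rule infsum_cmult_right')

lemma lattice_sum_diff: "fin_supp f \<Longrightarrow> fin_supp g \<Longrightarrow> lattice_sum (\<lambda>x. f x - g x) = lattice_sum f - lattice_sum g"
  using lattice_sum_add[OF _ fin_supp_cmult, of f g "-1"] by (simp add: lattice_sum_cmult[of "-1", simplified])

lemma lattice_sum_shift: "lattice_sum (\<lambda>x. f (x + v)) = lattice_sum f"
  unfolding lattice_sum_def
  by (rule infsum_reindex_bij_betw) (rule bij_betwI[where g = "\<lambda>x. x - v"], auto)

lemma lattice_sum_shift_mult: "lattice_sum (\<lambda>x. g x * f (x + v)) = lattice_sum (\<lambda>x. g (x - v) * f x)"
  using lattice_sum_shift[of "\<lambda>x. g (x - v) * f x" v] by simp

lemma lattice_sum_nonpos: "(\<And>x. f x \<le> 0) \<Longrightarrow> lattice_sum f \<le> 0"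
proof -
  assume "\<And>x. f x \<le> 0"
  then have "0 \<le> (\<Sum>\<^sub>\<infinity>x. - f x)" by (intro infsum_nonneg) auto
  then show ?thesis by (simp add: lattice_sum_def infsum_uminus)
qed

section \<open>Block operators\<close>

abbreviation unit_vec :: "'n::finite \<Rightarrow> int ^ 'n" where
  "unit_vec i \<equiv> axis i 1"

text \<open>Transition operator of one lazy step: each of the four jumps has probability
  \<open>c\<close>. For \<open>i = j\<close> the jumps coincide in pairs and each direction has
  probability \<open>2 * c\<close>.\<close>

definition block_P :: "'n::finite \<Rightarrow> 'n \<Rightarrow> real \<Rightarrow> (int ^ 'n \<Rightarrow> real) \<Rightarrow> int ^ 'n \<Rightarrow> real" where
  "block_P i j c f x = (1 - 4 * c) * f x +
     c * (f (x + unit_vec i) + f (x + - unit_vec i) + f (x + unit_vec j) + f (x + - unit_vec j))"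

definition block_S :: "'n::finite \<Rightarrow> 'n \<Rightarrow> real \<Rightarrow> (int ^ 'n \<Rightarrow> real) \<Rightarrow> int ^ 'n \<Rightarrow> real" where
  "block_S i j c f x = (1 - 4 * c) * f x +
     2 * c * (f (x + (unit_vec i - unit_vec j)) + f (x + (unit_vec j - unit_vec i)))"

text \<open>The increment of the transform as an operator. Summed against \<open>B\<close>, the term
  with \<open>block_S\<close> is the mean of \<open>B\<close> at a jump times \<open>f\<close> at
  the swapped jump, and the squared \<open>block_P\<close> subtracts the product of the two means: a
  covariance. For \<open>i = j\<close> the operator \<open>block_S\<close> is the identity.\<close>

definition block_M :: "'n::finite \<Rightarrow> 'n \<Rightarrow> real \<Rightarrow> real \<Rightarrow> (int ^ 'n \<Rightarrow> real) \<Rightarrow> int ^ 'n \<Rightarrow> real" where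
  "block_M i j \<alpha> c f x = \<alpha> * (block_S i j c f x - block_P i j c (block_P i j c f) x)"

definition block_C :: "'n::finite \<Rightarrow> 'n \<Rightarrow> real \<Rightarrow> (int ^ 'n \<Rightarrow> real) \<Rightarrow> (int ^ 'n \<Rightarrow> real) \<Rightarrow> int ^ 'n \<Rightarrow> real" where
  "block_C i j c B f x = (1 - 4 * c) * (B x * f x) +
     c * (B (x + unit_vec i) * f (x + unit_vec j) + B (x + - unit_vec i) * f (x + - unit_vec j)
        + B (x + unit_vec j) * f (x + unit_vec i) + B (x + - unit_vec j) * f (x + - unit_vec i))"

lemma fin_supp_block_P: "fin_supp f \<Longrightarrow> fin_supp (block_P i j c f)"
  unfolding block_P_def[abs_def] by (intro fin_supp_intros)

lemma fin_supp_block_M: "fin_supp f \<Longrightarrow> fin_supp (block_M i j \<alpha> c f)"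
  unfolding block_M_def[abs_def] block_S_def by (intro fin_supp_intros fin_supp_block_P)

lemma lattice_sum_block_P: "fin_supp f \<Longrightarrow> lattice_sum (block_P i j c f) = lattice_sum f"
  unfolding block_P_def[abs_def]
  by (simp only: lattice_sum_add lattice_sum_cmult lattice_sum_shift fin_supp_intros) (simp add: algebra_simps)

lemma block_P_selfadjoint:
  assumes f: "fin_supp f" and g: "fin_supp g"
  shows "lattice_sum (\<lambda>x. block_P i j c g x * f x) = lattice_sum (\<lambda>x. g x * block_P i j c f x)"
proof -
  have "lattice_sum (\<lambda>x. g (x + v) * f x) = lattice_sum (\<lambda>x. g x * f (x + - v))" for v
    using lattice_sum_shift_mult[of g f "- v"] by simp
  moreover have "lattice_sum (\<lambda>x. g (x + - v) * f x) = lattice_sum (\<lambda>x. g x * f (x + v))" for v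
    using lattice_sum_shift_mult[of g f v] by simp
  moreover have "lattice_sum (\<lambda>x. block_P i j c g x * f x) = lattice_sum (\<lambda>x. (1 - 4 * c) * (g x * f x) +
     c * (g (x + unit_vec i) * f x + g (x + - unit_vec i) * f x + g (x + unit_vec j) * f x + g (x + - unit_vec j) * f x))"
    by (simp only: block_P_def distrib_left distrib_right mult_ac)
  moreover have "lattice_sum (\<lambda>x. g x * block_P i j c f x) = lattice_sum (\<lambda>x. (1 - 4 * c) * (g x * f x) +
     c * (g x * f (x + unit_vec i) + g x * f (x + - unit_vec i) + g x * f (x + unit_vec j) + g x * f (x + - unit_vec j)))"
    by (simp only: block_P_def distrib_left distrib_right mult_ac)
  ultimately show ?thesis
    using f g by (simp only: lattice_sum_add lattice_sum_cmult fin_supp_intros) (simp only: ac_simps)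
qed

text \<open>Undoing the jump of \<open>B\<close> by translation turns
  \<open>B (x + v) * f (x + w)\<close> into \<open>B x * f (x + (w - v))\<close>. Each of the two
  diagonal shifts arises from two of the four jumps, hence the coefficient \<open>2 * c\<close> in
  \<open>block_S\<close>.\<close>

lemma lattice_sum_block_C:
  assumes f: "fin_supp f" and B: "fin_supp B"
  shows "lattice_sum (block_C i j c B f) = lattice_sum (\<lambda>x. B x * block_S i j c f x)"
proof -
  have sh: "lattice_sum (\<lambda>x. B (x + v) * f (x + w)) = lattice_sum (\<lambda>x. B x * f (x + (w - v)))" for v w
    using lattice_sum_shift[of "\<lambda>x. B x * f (x + (w - v))" v] by (simp add: algebra_simps)
  have "lattice_sum (\<lambda>x. B x * block_S i j c f x) = lattice_sum (\<lambda>x. (1 - 4 * c) * (B x * f x) +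
     2 * c * (B x * f (x + (unit_vec i - unit_vec j)) + B x * f (x + (unit_vec j - unit_vec i))))"
    by (simp only: block_S_def distrib_left distrib_right mult_ac)
  also have "\<dots> = lattice_sum (block_C i j c B f)"
    unfolding block_C_def[abs_def]
    using f B by (simp only: lattice_sum_add lattice_sum_cmult fin_supp_intros sh)
      (simp add: algebra_simps)
  finally show ?thesis by simp
qed

section \<open>One step of the martingale transform\<close>

lemma concave_two_point:
  assumes "concave_on UNIV (g :: real \<Rightarrow> real)" "0 \<le> u" "0 \<le> v" "u + v = 1"
  shows "u * g x + v * g y \<le> g (u * x + v * y)"
  using assms by (auto simp: concave_on_iff)

lemma block_jensen:
  fixes U :: "real \<Rightarrow> real \<Rightarrow> real"
  assumes conc: "\<And>d. concave_on UNIV (\<lambda>h. U h (d + h))" and even: "\<And>x y. U x (- y) = U x y"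
    and c: "0 \<le> c" "4 * c \<le> 1"
    and \<mu>: "\<mu> = (1 - 4 * c) * f0 + c * (a + a' + b + b')"
  shows "(1 - 4 * c) * U f0 (y + (f0 - \<mu>)) +
      c * (U a (y + (b - \<mu>)) + U a' (y + (b' - \<mu>)) + U b (y + (a - \<mu>)) + U b' (y + (a' - \<mu>)))
      \<le> U \<mu> y"
proof -
  \<comment> \<open>The two points lie on a line of slope -1. Evenness of \<open>U\<close> in the
    second variable reflects it to the line of slope 1 with offset \<open>- (a + b + t)\<close>,
    where the assumed concavity applies.\<close>
  have mid: "U a (t + b) + U b (t + a) \<le> 2 * U ((a + b) / 2) (t + (a + b) / 2)" for a b t
  proof -
    have "1 / 2 * U a (- (a + b + t) + a) + 1 / 2 * U b (- (a + b + t) + b)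
        \<le> U (1 / 2 * a + 1 / 2 * b) (- (a + b + t) + (1 / 2 * a + 1 / 2 * b))"
      by (rule concave_two_point[OF conc]) auto
    moreover have "- (a + b + t) + a = - (t + b)" "- (a + b + t) + b = - (t + a)"
      "- (a + b + t) + (1 / 2 * a + 1 / 2 * b) = - (t + (a + b) / 2)"
      "1 / 2 * a + 1 / 2 * b = (a + b) / 2" by (simp_all add: field_simps)
    ultimately show ?thesis by (simp only: even)
  qed
  \<comment> \<open>After the merging all points, including the one for no jump, lie on the single
    line of slope 1 with offset \<open>d\<close>.\<close>
  define d where "d = y - \<mu>"
  define g where "g h = U h (d + h)" for h
  define s where "s = (a + b) / 2"
  define s' where "s' = (a' + b') / 2"
  have "U a (y + (b - \<mu>)) + U b (y + (a - \<mu>)) \<le> 2 * g s"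
    using mid[of a d b] by (simp add: g_def d_def s_def algebra_simps)
  moreover have "U a' (y + (b' - \<mu>)) + U b' (y + (a' - \<mu>)) \<le> 2 * g s'"
    using mid[of a' d b'] by (simp add: g_def d_def s'_def algebra_simps)
  moreover have "1 / 2 * g s + 1 / 2 * g s' \<le> g (1 / 2 * s + 1 / 2 * s')"
    unfolding g_def by (rule concave_two_point[OF conc]) auto
  ultimately have "U a (y + (b - \<mu>)) + U a' (y + (b' - \<mu>)) + U b (y + (a - \<mu>)) + U b' (y + (a' - \<mu>))
      \<le> 4 * g (1 / 2 * s + 1 / 2 * s')" by linarith
  then have "c * (U a (y + (b - \<mu>)) + U a' (y + (b' - \<mu>)) + U b (y + (a - \<mu>)) + U b' (y + (a' - \<mu>)))
      \<le> c * (4 * g (1 / 2 * s + 1 / 2 * s'))" using c by (intro mult_left_mono)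
  moreover have "(1 - 4 * c) * g f0 + (4 * c) * g (1 / 2 * s + 1 / 2 * s')
      \<le> g ((1 - 4 * c) * f0 + (4 * c) * (1 / 2 * s + 1 / 2 * s'))"
    unfolding g_def by (rule concave_two_point[OF conc]) (use c in auto)
  moreover have "(1 - 4 * c) * f0 + (4 * c) * (1 / 2 * s + 1 / 2 * s') = \<mu>"
    by (simp add: \<mu> s_def s'_def field_simps)
  moreover have "g \<mu> = U \<mu> y" by (simp add: g_def d_def)
  moreover have "g f0 = U f0 (y + (f0 - \<mu>))" by (simp add: g_def d_def algebra_simps)
  ultimately show ?thesis by simp
qed

text \<open>Intercept of the averaged minorant. Evaluating the minorant at the end
  \<open>x + v\<close> of each jump, with \<open>y\<close> moved by \<alpha> times the increment
  \<open>f (x + w) - block_P i j c f x\<close> of the swapped jump \<open>w\<close>, and averaging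
  over the jumps gives an affine function of \<open>y\<close> with slope
  \<open>block_P i j c B x\<close> and this intercept.\<close>

definition block_A :: "'n::finite \<Rightarrow> 'n \<Rightarrow> real \<Rightarrow> real \<Rightarrow> (int ^ 'n \<Rightarrow> real) \<Rightarrow> (int ^ 'n \<Rightarrow> real)
     \<Rightarrow> (int ^ 'n \<Rightarrow> real) \<Rightarrow> int ^ 'n \<Rightarrow> real" where
  "block_A i j \<alpha> c A B f x =
     block_P i j c A x + \<alpha> * (block_C i j c B f x - block_P i j c B x * block_P i j c f x)"

lemma block_step_sign:
  fixes U :: "real \<Rightarrow> real \<Rightarrow> real"
  assumes conc: "\<And>d. concave_on UNIV (\<lambda>h. U h (d + h))" and even: "\<And>x y. U x (- y) = U x y"
    and c: "0 \<le> c" "4 * c \<le> 1" and \<epsilon>: "\<epsilon> = 1 \<or> \<epsilon> = -1"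
    and H: "\<And>x y. A x + B x * y \<le> U (f x) y"
  shows "block_A i j \<epsilon> c A B f x + block_P i j c B x * y \<le> U (block_P i j c f x) y"
proof -
  define \<mu> where "\<mu> = block_P i j c f x"
  let ?t = "\<lambda>v w. A (x + v) + B (x + v) * (y + \<epsilon> * (f (x + w) - \<mu>))"
  let ?u = "\<lambda>v w. U (f (x + v)) (\<epsilon> * y + (f (x + w) - \<mu>))"
  let ?i = "unit_vec i" and ?j = "unit_vec j"
  have ev: "U a (\<epsilon> * w) = U a w" for a w using \<epsilon> even by auto
  have tu: "?t v w \<le> ?u v w" for v w
  proof -
    have "?t v w \<le> U (f (x + v)) (y + \<epsilon> * (f (x + w) - \<mu>))" by (rule H)
    moreover have "y + \<epsilon> * (f (x + w) - \<mu>) = \<epsilon> * (\<epsilon> * y + (f (x + w) - \<mu>))" using \<epsilon> by auto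
    ultimately show ?thesis by (metis ev)
  qed
  have "block_A i j \<epsilon> c A B f x + block_P i j c B x * y
      = (1 - 4 * c) * ?t 0 0 + c * (?t ?i ?j + ?t (- ?i) (- ?j) + ?t ?j ?i + ?t (- ?j) (- ?i))"
    unfolding block_A_def \<mu>_def[symmetric] block_C_def block_P_def[of i j c A] block_P_def[of i j c B]
    by (simp add: algebra_simps)
  also have "\<dots> \<le> (1 - 4 * c) * ?u 0 0 + c * (?u ?i ?j + ?u (- ?i) (- ?j) + ?u ?j ?i + ?u (- ?j) (- ?i))"
    using c by (intro add_mono mult_left_mono tu) auto
  also have "\<dots> \<le> U \<mu> (\<epsilon> * y)"
    using block_jensen[OF conc even c, of \<mu> "f x" "f (x + ?i)" "f (x + - ?i)" "f (x + ?j)" "f (x + - ?j)" "\<epsilon> * y"]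
    by (simp add: \<mu>_def block_P_def)
  also have "\<dots> = U \<mu> y" using \<epsilon> even by auto
  finally show ?thesis by (simp add: \<mu>_def)
qed

text \<open>The left side is affine in \<alpha>, so it suffices to treat the extreme values 1 and
  -1; there the sign is absorbed by the evenness of \<open>U\<close>.\<close>

lemma block_step:
  fixes U :: "real \<Rightarrow> real \<Rightarrow> real"
  assumes conc: "\<And>d. concave_on UNIV (\<lambda>h. U h (d + h))" and even: "\<And>x y. U x (- y) = U x y"
    and c: "0 \<le> c" "4 * c \<le> 1" and \<alpha>: "\<bar>\<alpha>\<bar> \<le> 1"
    and H: "\<And>x y. A x + B x * y \<le> U (f x) y"
  shows "block_A i j \<alpha> c A B f x + block_P i j c B x * y \<le> U (block_P i j c f x) y"
proof -
  let ?L = "\<lambda>\<alpha>. block_A i j \<alpha> c A B f x + block_P i j c B x * y"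
  have "?L \<alpha> = (1 + \<alpha>) / 2 * ?L 1 + (1 - \<alpha>) / 2 * ?L (-1)"
    by (simp add: block_A_def field_simps)
  also have "\<dots> \<le> (1 + \<alpha>) / 2 * U (block_P i j c f x) y + (1 - \<alpha>) / 2 * U (block_P i j c f x) y"
    using \<alpha> by (intro add_mono mult_left_mono block_step_sign[OF conc even c _ H]) auto
  also have "\<dots> = U (block_P i j c f x) y" by (simp add: field_simps)
  finally show ?thesis .
qed

lemma fin_supp_block_A:
  "fin_supp A \<Longrightarrow> fin_supp B \<Longrightarrow> fin_supp f \<Longrightarrow> fin_supp (block_A i j \<alpha> c A B f)"
  unfolding block_A_def[abs_def] block_C_def by (intro fin_supp_intros fin_supp_block_P)

text \<open>Since \<open>block_P\<close> preserves total sums and is self-adjoint, the total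
  intercept grows by exactly the pairing of \<open>B\<close> with the increment operator. Summation
  over the lattice thus replaces taking expectations.\<close>

lemma lattice_sum_block_A:
  assumes "fin_supp A" "fin_supp B" "fin_supp f"
  shows "lattice_sum (block_A i j \<alpha> c A B f) = lattice_sum A + lattice_sum (\<lambda>x. B x * block_M i j \<alpha> c f x)"
proof -
  have fC: "fin_supp (block_C i j c B f)"
    unfolding block_C_def[abs_def] using assms by (intro fin_supp_intros)
  have fS: "fin_supp (\<lambda>x. B x * block_S i j c f x)" "fin_supp (\<lambda>x. B x * block_P i j c (block_P i j c f) x)"
    using assms by (auto intro: fin_supp_mult)
  have fP: "fin_supp (\<lambda>x. block_P i j c B x * block_P i j c f x)"
    using assms by (intro fin_supp_mult fin_supp_block_P)
  have "lattice_sum (\<lambda>x. B x * block_M i j \<alpha> c f x) =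
      lattice_sum (\<lambda>x. \<alpha> * (B x * block_S i j c f x - B x * block_P i j c (block_P i j c f) x))"
    by (simp add: block_M_def algebra_simps)
  also have "\<dots> = \<alpha> * (lattice_sum (block_C i j c B f) - lattice_sum (\<lambda>x. block_P i j c B x * block_P i j c f x))"
    using assms fS by (simp add: lattice_sum_cmult lattice_sum_diff lattice_sum_block_C block_P_selfadjoint fin_supp_block_P)
  finally show ?thesis
    unfolding block_A_def[abs_def] using assms fC fP
    by (simp only: lattice_sum_add lattice_sum_cmult lattice_sum_diff lattice_sum_block_P fin_supp_intros fin_supp_block_P)
qed

section \<open>Composition of steps\<close>

type_synonym 'n block = "'n \<times> 'n \<times> real \<times> real"

text \<open>The list runs backwards in time: its head is the last step of the walk, at whose end the
  martingale takes the values of \<open>f\<close>. Passing from \<open>(B, f)\<close> to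
  \<open>(block_P B, block_P f)\<close> and moving the first \<open>block_P\<close> across the
  pairing puts one factor on each side of the operator of the remaining steps.\<close>

fun ops_M :: "'n::finite block list \<Rightarrow> (int ^ 'n \<Rightarrow> real) \<Rightarrow> int ^ 'n \<Rightarrow> real" where
  "ops_M [] f = (\<lambda>x. 0)"
| "ops_M ((i, j, \<alpha>, c) # bs) f =
     (\<lambda>x. block_M i j \<alpha> c f x + block_P i j c (ops_M bs (block_P i j c f)) x)"

text \<open>The bound \<open>8 * c \<le> 1\<close> keeps the symbol of \<open>block_P\<close>
  nonnegative, because 2 - cos a - cos b can be as large as 4.\<close>

definition valid_blocks :: "'n block list \<Rightarrow> bool" where
  "valid_blocks bs \<longleftrightarrow> (\<forall>(i, j, \<alpha>, c)\<in>set bs. \<bar>\<alpha>\<bar> \<le> 1 \<and> 0 \<le> c \<and> 8 * c \<le> 1)"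

lemma fin_supp_ops_M: "fin_supp f \<Longrightarrow> fin_supp (ops_M bs f)"
  by (induction bs f rule: ops_M.induct) (auto intro!: fin_supp_add fin_supp_block_M fin_supp_block_P)

text \<open>The quantity on the left is invariant when a block is removed from the list and
  \<open>(A, B, f)\<close> is replaced by \<open>(block_A, block_P B, block_P f)\<close>;
  \<open>block_step\<close> keeps the minorant property. When no block is left the transform is at
  its starting value 0, and the minorant at \<open>y = 0\<close> is at most
  \<open>U x 0 \<le> 0\<close>.\<close>

lemma ops_M_duality:
  fixes U :: "real \<Rightarrow> real \<Rightarrow> real"
  assumes conc: "\<And>d. concave_on UNIV (\<lambda>h. U h (d + h))" and even: "\<And>x y. U x (- y) = U x y"
    and U0: "\<And>x. U x 0 \<le> 0"
  shows "valid_blocks bs \<Longrightarrow> fin_supp A \<Longrightarrow> fin_supp B \<Longrightarrow> fin_supp f \<Longrightarrow>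
    (\<And>x y. A x + B x * y \<le> U (f x) y) \<Longrightarrow> lattice_sum A + lattice_sum (\<lambda>x. B x * ops_M bs f x) \<le> 0"
proof (induction bs f arbitrary: A B rule: ops_M.induct)
  case (1 f)
  have "lattice_sum A \<le> 0" by (rule lattice_sum_nonpos) (use 1(5)[of _ 0] U0 in \<open>auto intro: order_trans\<close>)
  then show ?case by (simp add: lattice_sum_def)
next
  case (2 i j \<alpha> c bs f)
  let ?P = "block_P i j c"
  have v: "valid_blocks bs" "\<bar>\<alpha>\<bar> \<le> 1" "0 \<le> c" "4 * c \<le> 1"
    using 2(2) by (auto simp: valid_blocks_def)
  have "lattice_sum (block_A i j \<alpha> c A B f) + lattice_sum (\<lambda>x. ?P B x * ops_M bs (?P f) x) \<le> 0"
    by (rule 2(1)[OF v(1)])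
       (use 2(3-5) in \<open>auto intro!: fin_supp_block_A fin_supp_block_P block_step[OF conc even v(3,4,2) 2(6)]\<close>)
  moreover have "lattice_sum (\<lambda>x. ?P B x * ops_M bs (?P f) x) = lattice_sum (\<lambda>x. B x * ?P (ops_M bs (?P f)) x)"
    using 2(3-5) by (intro block_P_selfadjoint fin_supp_ops_M fin_supp_block_P)
  moreover have "lattice_sum (\<lambda>x. B x * ops_M ((i, j, \<alpha>, c) # bs) f x)
      = lattice_sum (\<lambda>x. B x * block_M i j \<alpha> c f x) + lattice_sum (\<lambda>x. B x * ?P (ops_M bs (?P f)) x)"
    using 2(4) by (simp add: distrib_left lattice_sum_add fin_supp_mult)
  ultimately show ?case using lattice_sum_block_A[OF 2(3,4,5)] by simp
qed

text \<open>The left side is the tangent at \<open>t\<close> to the convex function |y|^p; the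
  inequality is Young's inequality for conjugate exponents.\<close>

lemma powr_tangent:
  fixes p s t :: real
  assumes p: "1 < p"
  shows "(1 - p) * \<bar>t\<bar> powr p + p * (sgn t * \<bar>t\<bar> powr (p - 1)) * y \<le> \<bar>y\<bar> powr p"
proof -
  define q where "q = p / (p - 1)"
  have q: "1 < q" "1 / p + 1 / q = 1" using p by (auto simp: q_def field_simps)
  have "\<bar>y\<bar> * \<bar>t\<bar> powr (p - 1) \<le> \<bar>y\<bar> powr p / p + (\<bar>t\<bar> powr (p - 1)) powr q / q"
    by (rule Youngs_inequality) (use p q in auto)
  also have "(\<bar>t\<bar> powr (p - 1)) powr q = \<bar>t\<bar> powr p" using p by (simp add: powr_powr q_def)
  finally have "p * (\<bar>y\<bar> * \<bar>t\<bar> powr (p - 1)) \<le> p * (\<bar>y\<bar> powr p / p + \<bar>t\<bar> powr p / q)"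
    using p by (intro mult_left_mono) auto
  also have "\<dots> = \<bar>y\<bar> powr p + (p - 1) * \<bar>t\<bar> powr p" using p by (simp add: q_def distrib_left)
  finally have "p * (\<bar>y\<bar> * \<bar>t\<bar> powr (p - 1)) \<le> \<bar>y\<bar> powr p + (p - 1) * \<bar>t\<bar> powr p" .
  moreover have "p * (sgn t * \<bar>t\<bar> powr (p - 1)) * y \<le> p * (\<bar>y\<bar> * \<bar>t\<bar> powr (p - 1))"
  proof -
    have "sgn t * y \<le> \<bar>y\<bar>" by (auto simp: sgn_if)
    then have "(p * \<bar>t\<bar> powr (p - 1)) * (sgn t * y) \<le> (p * \<bar>t\<bar> powr (p - 1)) * \<bar>y\<bar>"
      using p by (intro mult_left_mono) auto
    then show ?thesis by (simp add: mult_ac)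
  qed
  ultimately show ?thesis by (simp add: algebra_simps)
qed

lemma ops_M_bound:
  fixes f :: "int ^ 'n::finite \<Rightarrow> real"
  assumes p: "1 < p" and bs: "valid_blocks bs" and f: "fin_supp f"
  shows "lattice_sum (\<lambda>x. \<bar>ops_M bs f x\<bar> powr p) \<le> (pstar p - 1) powr p * lattice_sum (\<lambda>x. \<bar>f x\<bar> powr p)"
proof -
  define c where "c = max (p - 1) (inverse (p - 1))"
  have c1: "1 \<le> c"
  proof (cases "2 \<le> p")
    case False
    then have "1 \<le> inverse (p - 1)" using p by (intro one_le_inverse) auto
    then show ?thesis by (simp add: c_def)
  qed (simp add: c_def)
  have c2: "p - 1 \<le> c" by (simp add: c_def)
  have "inverse (p - 1) \<le> c" by (simp add: c_def)
  then have c3: "1 \<le> c * (p - 1)" using p by (simp add: field_simps)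
  define K where "K = p * (c / (1 + c)) powr (p - 1)"
  have K: "0 \<le> K" using p by (simp add: K_def)
  define U where "U x y = K * burkholder p c x y" for x y
  define t where "t = ops_M bs f"
  \<comment> \<open>The term |y|^p is linearised at the value \<open>t x\<close> that the operator
    actually takes. There the tangent is exact, so the duality inequality for these \<open>A\<close>
    and \<open>B\<close> is already the claimed bound.\<close>
  define A where "A x = (1 - p) * \<bar>t x\<bar> powr p - c powr p * \<bar>f x\<bar> powr p" for x
  define B where "B x = p * (sgn (t x) * \<bar>t x\<bar> powr (p - 1))" for x
  have t: "fin_supp t" unfolding t_def using f by (rule fin_supp_ops_M)
  have fA: "fin_supp A" unfolding A_def by (intro fin_supp_intros t f)
  have fB: "fin_supp B" by (rule finite_subset[OF _ t]) (auto simp: B_def)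
  have "lattice_sum A + lattice_sum (\<lambda>x. B x * ops_M bs f x) \<le> 0"
  proof (rule ops_M_duality[where U = U])
    show "concave_on UNIV (\<lambda>h. U h (d + h))" for d
      using concave_burkholder[OF p c1 c2 c3, of d] K
      unfolding U_def by (simp add: concave_on_cmul)
    show "U x (- y) = U x y" for x y by (simp add: U_def burkholder_uminus)
    show "U x 0 \<le> 0" for x using K c1 by (simp add: U_def burkholder_def mult_nonneg_nonpos mult_nonpos_nonneg)
    show "A x + B x * y \<le> U (f x) y" for x y
      using powr_tangent[OF p, of "t x" y] burkholder_majorant[OF p c_def, of y "f x"]
      by (simp add: A_def B_def U_def K_def)
  qed (use bs fA fB f in auto)
  moreover have "B x * ops_M bs f x = p * \<bar>t x\<bar> powr p" for x
  proof -
    have "\<bar>t x\<bar> powr (p - 1) * \<bar>t x\<bar> = \<bar>t x\<bar> powr p"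
      using powr_add[of "\<bar>t x\<bar>" "p - 1" 1] by (cases "t x = 0") auto
    moreover have "sgn (t x) * t x = \<bar>t x\<bar>" by (simp add: abs_sgn mult.commute)
    ultimately show ?thesis unfolding B_def t_def[symmetric] by (metis mult.assoc mult.commute)
  qed
  moreover have "lattice_sum A = (1 - p) * lattice_sum (\<lambda>x. \<bar>t x\<bar> powr p) - c powr p * lattice_sum (\<lambda>x. \<bar>f x\<bar> powr p)"
    unfolding A_def[abs_def] using t f by (simp add: lattice_sum_diff lattice_sum_cmult fin_supp_intros)
  ultimately have "lattice_sum (\<lambda>x. \<bar>t x\<bar> powr p) \<le> c powr p * lattice_sum (\<lambda>x. \<bar>f x\<bar> powr p)"
    by (simp add: lattice_sum_cmult algebra_simps)
  moreover have "pstar p - 1 = c" by (simp add: pstar_def c_def)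
  ultimately show ?thesis by (simp add: t_def)
qed

section \<open>Symbols of the block operators\<close>

definition sym_block_P :: "'n::finite \<Rightarrow> 'n \<Rightarrow> real \<Rightarrow> real ^ 'n \<Rightarrow> real" where
  "sym_block_P i j c \<theta> = 1 - 2 * c * (2 - cos (\<theta> $ i) - cos (\<theta> $ j))"

definition sym_block_M :: "'n::finite \<Rightarrow> 'n \<Rightarrow> real \<Rightarrow> real \<Rightarrow> real ^ 'n \<Rightarrow> real" where
  "sym_block_M i j \<alpha> c \<theta> =
     \<alpha> * (1 - 4 * c + 4 * c * cos (\<theta> $ i - \<theta> $ j) - (sym_block_P i j c \<theta>)\<^sup>2)"

fun sym_P :: "'n::finite block list \<Rightarrow> real ^ 'n \<Rightarrow> real" where
  "sym_P [] \<theta> = 1"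
| "sym_P ((i, j, \<alpha>, c) # bs) \<theta> = sym_block_P i j c \<theta> * sym_P bs \<theta>"

fun sym_M :: "'n::finite block list \<Rightarrow> real ^ 'n \<Rightarrow> real" where
  "sym_M [] \<theta> = 0"
| "sym_M ((i, j, \<alpha>, c) # bs) \<theta> = sym_block_M i j \<alpha> c \<theta> + (sym_block_P i j c \<theta>)\<^sup>2 * sym_M bs \<theta>"

lemma cis_add_cis_minus: "cis t + cis (- t) = of_real (2 * cos t)"
  by (simp add: complex_eq_iff)

lemma has_symbol_block_P: "has_symbol (block_P i j c) (\<lambda>\<theta>. of_real (sym_block_P i j c \<theta>))"
proof (rule has_symbol_cong)
  let ?S = "\<lambda>v f x. f (x + v)"
  show "has_symbol (\<lambda>f x. (1 - 4 * c) * f x +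
      c * (f (x + unit_vec i) + f (x + - unit_vec i) + f (x + unit_vec j) + f (x + - unit_vec j)))
    (\<lambda>\<theta>. of_real (1 - 4 * c) * 1 + of_real c * (char_at \<theta> (unit_vec i) + char_at \<theta> (- unit_vec i)
      + char_at \<theta> (unit_vec j) + char_at \<theta> (- unit_vec j)))"
    by (intro has_symbol_add has_symbol_cmult has_symbol_shift has_symbol_id)
  fix \<theta> :: "real ^ 'a"
  have "char_at \<theta> (unit_vec i) + char_at \<theta> (- unit_vec i) + char_at \<theta> (unit_vec j) + char_at \<theta> (- unit_vec j)
      = of_real (2 * cos (\<theta> $ i) + 2 * cos (\<theta> $ j))"
    unfolding char_at_axis using cis_add_cis_minus[of "\<theta> $ i"] cis_add_cis_minus[of "\<theta> $ j"]
    by (simp add: add.assoc)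
  then show "of_real (1 - 4 * c) * 1 + of_real c * (char_at \<theta> (unit_vec i) + char_at \<theta> (- unit_vec i)
      + char_at \<theta> (unit_vec j) + char_at \<theta> (- unit_vec j)) = complex_of_real (sym_block_P i j c \<theta>)"
    by (simp only: of_real_mult[symmetric] of_real_add[symmetric] mult_1_right)
       (simp add: sym_block_P_def algebra_simps)
qed (simp add: block_P_def)

lemma has_symbol_block_S:
  "has_symbol (block_S i j c) (\<lambda>\<theta>. of_real (1 - 4 * c + 4 * c * cos (\<theta> $ i - \<theta> $ j)))"
proof (rule has_symbol_cong)
  show "has_symbol (\<lambda>f x. (1 - 4 * c) * f x +
      2 * c * (f (x + (unit_vec i - unit_vec j)) + f (x + (unit_vec j - unit_vec i))))
    (\<lambda>\<theta>. of_real (1 - 4 * c) * 1 +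
      of_real (2 * c) * (char_at \<theta> (unit_vec i - unit_vec j) + char_at \<theta> (unit_vec j - unit_vec i)))"
    by (intro has_symbol_add has_symbol_cmult has_symbol_shift has_symbol_id)
  fix \<theta> :: "real ^ 'a"
  have "char_at \<theta> (unit_vec i - unit_vec j) + char_at \<theta> (unit_vec j - unit_vec i)
      = of_real (2 * cos (\<theta> $ i - \<theta> $ j))"
    unfolding char_at_diff char_at_axis cis_cnj cis_mult
    using cis_add_cis_minus[of "\<theta> $ i - \<theta> $ j"] by simp
  then show "of_real (1 - 4 * c) * 1 +
      of_real (2 * c) * (char_at \<theta> (unit_vec i - unit_vec j) + char_at \<theta> (unit_vec j - unit_vec i))
      = complex_of_real (1 - 4 * c + 4 * c * cos (\<theta> $ i - \<theta> $ j))"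
    by simp
qed (simp add: block_S_def)

lemma has_symbol_block_M:
  "has_symbol (block_M i j \<alpha> c) (\<lambda>\<theta>. of_real (sym_block_M i j \<alpha> c \<theta>))"
proof (rule has_symbol_cong)
  show "has_symbol (\<lambda>f x. \<alpha> * (block_S i j c f x - block_P i j c (block_P i j c f) x))
     (\<lambda>\<theta>. of_real \<alpha> * (of_real (1 - 4 * c + 4 * c * cos (\<theta> $ i - \<theta> $ j))
        - of_real (sym_block_P i j c \<theta>) * of_real (sym_block_P i j c \<theta>)))"
    by (intro has_symbol_cmult has_symbol_diff has_symbol_block_S
        has_symbol_comp[OF has_symbol_block_P has_symbol_block_P])
qed (simp_all add: block_M_def sym_block_M_def power2_eq_square)

lemma has_symbol_ops_M: "has_symbol (ops_M bs) (\<lambda>\<theta>. of_real (sym_M bs \<theta>))"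
proof (induction bs)
  case Nil
  then show ?case by (simp add: has_symbol_def fourier_def)
next
  case (Cons b bs)
  obtain i j \<alpha> c where b: "b = (i, j, \<alpha>, c)" by (cases b)
  show ?case
  proof (rule has_symbol_cong)
    show "has_symbol (\<lambda>f x. block_M i j \<alpha> c f x + block_P i j c (ops_M bs (block_P i j c f)) x)
      (\<lambda>\<theta>. of_real (sym_block_M i j \<alpha> c \<theta>) +
        of_real (sym_block_P i j c \<theta>) * (of_real (sym_M bs \<theta>) * of_real (sym_block_P i j c \<theta>)))"
      by (intro has_symbol_add has_symbol_block_M
          has_symbol_comp[OF has_symbol_block_P has_symbol_comp[OF Cons has_symbol_block_P]])
  qed (simp_all add: b power2_eq_square)
qed

lemma continuous_on_sym_M [continuous_intros]: "continuous_on S (sym_M bs)"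
proof (induction bs)
  case (Cons b bs)
  obtain i j \<alpha> c where b: "b = (i, j, \<alpha>, c)" by (cases b)
  have "continuous_on S (\<lambda>\<theta>. sym_block_M i j \<alpha> c \<theta> + (sym_block_P i j c \<theta>)\<^sup>2 * sym_M bs \<theta>)"
    unfolding sym_block_M_def sym_block_P_def by (intro continuous_intros Cons)
  then show ?case by (simp add: b)
next
  case Nil
  have "sym_M ([] :: 'a block list) = (\<lambda>\<theta>. 0)" by auto
  then show ?case by simp
qed

text \<open>Dominates the diagonal shift in \<open>block_S\<close> by the axis shifts in
  \<open>block_P\<close>. In half angles it is the square of |sin (u - v)| \<le> |sin u| + |sin
  v|.\<close>

lemma one_minus_cos_diff_le: "1 - cos (a - b) \<le> 2 * (2 - cos a - cos b)" for a b :: real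
proof -
  have *: "1 - cos (2 * u) = 2 * (sin u)\<^sup>2" for u :: real by (simp add: cos_double_sin)
  define u v where "u = a / 2" "v = b / 2"
  have "\<bar>sin (u - v)\<bar> \<le> \<bar>sin u\<bar> * \<bar>cos v\<bar> + \<bar>cos u\<bar> * \<bar>sin v\<bar>"
    unfolding sin_diff by (metis abs_mult abs_triangle_ineq4)
  also have "\<dots> \<le> \<bar>sin u\<bar> * 1 + 1 * \<bar>sin v\<bar>"
    by (intro add_mono mult_mono) auto
  finally have "(sin (u - v))\<^sup>2 \<le> (\<bar>sin u\<bar> + \<bar>sin v\<bar>)\<^sup>2"
    by (simp add: abs_le_square_iff[symmetric])
  also have "\<dots> \<le> 2 * (sin u)\<^sup>2 + 2 * (sin v)\<^sup>2"
    using sum_squares_bound[of "\<bar>sin u\<bar>" "\<bar>sin v\<bar>"] by (simp add: power2_sum)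
  finally have "2 * (sin (u - v))\<^sup>2 \<le> 2 * (2 * (sin u)\<^sup>2 + 2 * (sin v)\<^sup>2)" by simp
  then show ?thesis
    using *[of "u - v"] *[of u] *[of v] by (simp add: u_v_def algebra_simps)
qed

lemma sym_block_bounds:
  assumes "\<bar>\<alpha>\<bar> \<le> 1" "0 \<le> c" "8 * c \<le> 1"
  shows "0 \<le> sym_block_P i j c \<theta>" "sym_block_P i j c \<theta> \<le> 1"
    "\<bar>sym_block_M i j \<alpha> c \<theta>\<bar> \<le> 4 * (1 - (sym_block_P i j c \<theta>)\<^sup>2)"
proof -
  define D where "D = 2 * c * (2 - cos (\<theta> $ i) - cos (\<theta> $ j))"
  have P: "sym_block_P i j c \<theta> = 1 - D" by (simp add: D_def sym_block_P_def)
  have "-1 \<le> cos (\<theta> $ i)" "cos (\<theta> $ i) \<le> 1" "-1 \<le> cos (\<theta> $ j)" "cos (\<theta> $ j) \<le> 1" by auto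
  then have d: "0 \<le> 2 - cos (\<theta> $ i) - cos (\<theta> $ j)" "2 - cos (\<theta> $ i) - cos (\<theta> $ j) \<le> 4" by linarith+
  have D0: "0 \<le> D" unfolding D_def using d assms by (intro mult_nonneg_nonneg) auto
  have "D \<le> 2 * c * 4" unfolding D_def using d assms by (intro mult_left_mono) auto
  then have D1: "D \<le> 1" using assms by simp
  show "0 \<le> sym_block_P i j c \<theta>" "sym_block_P i j c \<theta> \<le> 1" using D0 D1 P by auto
  define Q where "Q = 1 - (sym_block_P i j c \<theta>)\<^sup>2"
  have "D * D \<le> D * 1" using D0 D1 by (intro mult_left_mono) auto
  then have QD: "D \<le> Q" unfolding Q_def P by (simp add: power2_eq_square algebra_simps)
  define E where "E = 4 * c * (1 - cos (\<theta> $ i - \<theta> $ j))"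
  have "E \<le> 4 * c * (2 * (2 - cos (\<theta> $ i) - cos (\<theta> $ j)))"
    unfolding E_def using assms one_minus_cos_diff_le by (intro mult_left_mono) auto
  then have ED: "E \<le> 4 * D" by (simp add: D_def algebra_simps)
  have E0: "0 \<le> E" using assms by (simp add: E_def)
  have "sym_block_M i j \<alpha> c \<theta> = \<alpha> * (Q - E)"
    by (simp add: sym_block_M_def Q_def E_def algebra_simps)
  moreover have "\<bar>Q - E\<bar> \<le> 4 * Q" using QD ED E0 D0 by linarith
  then have "\<bar>\<alpha>\<bar> * \<bar>Q - E\<bar> \<le> 1 * (4 * Q)" using assms by (intro mult_mono) auto
  ultimately show "\<bar>sym_block_M i j \<alpha> c \<theta>\<bar> \<le> 4 * (1 - (sym_block_P i j c \<theta>)\<^sup>2)"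
    by (simp add: abs_mult Q_def)
qed

text \<open>The bound reproduces itself under the recursion, since 4 (1 - P^2) + P^2 4 (1 - R^2) = 4
  (1 - (P R)^2). It therefore does not depend on the number of blocks, which provides the dominating
  constant for the limit.\<close>

lemma sym_bounds:
  assumes "valid_blocks bs"
  shows "0 \<le> sym_P bs \<theta> \<and> sym_P bs \<theta> \<le> 1 \<and> \<bar>sym_M bs \<theta>\<bar> \<le> 4 * (1 - (sym_P bs \<theta>)\<^sup>2)"
  using assms
proof (induction bs)
  case (Cons b bs)
  obtain i j \<alpha> c where b: "b = (i, j, \<alpha>, c)" by (cases b)
  have v: "\<bar>\<alpha>\<bar> \<le> 1" "0 \<le> c" "8 * c \<le> 1" "valid_blocks bs"
    using Cons.prems by (auto simp: b valid_blocks_def)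
  note B = sym_block_bounds[OF v(1,2,3), of i j \<theta>]
  let ?P = "sym_block_P i j c \<theta>" and ?R = "sym_P bs \<theta>"
  have IH: "0 \<le> ?R" "?R \<le> 1" "\<bar>sym_M bs \<theta>\<bar> \<le> 4 * (1 - ?R\<^sup>2)" using Cons.IH v by auto
  have "\<bar>?P\<^sup>2 * sym_M bs \<theta>\<bar> \<le> ?P\<^sup>2 * (4 * (1 - ?R\<^sup>2))"
    using IH by (simp add: abs_mult mult_left_mono)
  then have "\<bar>sym_block_M i j \<alpha> c \<theta> + ?P\<^sup>2 * sym_M bs \<theta>\<bar> \<le> 4 * (1 - ?P\<^sup>2) + ?P\<^sup>2 * (4 * (1 - ?R\<^sup>2))"
    using B(3) by linarith
  also have "\<dots> = 4 * (1 - (?P * ?R)\<^sup>2)" by (simp add: power_mult_distrib algebra_simps)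
  finally show ?case using B IH by (simp add: b mult_le_one)
qed simp

lemma abs_sym_M_le:
  assumes "valid_blocks bs"
  shows "\<bar>sym_M bs \<theta>\<bar> \<le> 4"
proof -
  have "\<bar>sym_M bs \<theta>\<bar> \<le> 4 * (1 - (sym_P bs \<theta>)\<^sup>2)" using sym_bounds[OF assms, of \<theta>] by simp
  moreover have "4 * (1 - (sym_P bs \<theta>)\<^sup>2) \<le> 4" by simp
  ultimately show ?thesis by (rule order_trans)
qed

lemma sym_append:
  "sym_P (xs @ ys) \<theta> = sym_P xs \<theta> * sym_P ys \<theta>"
  "sym_M (xs @ ys) \<theta> = sym_M xs \<theta> + (sym_P xs \<theta>)\<^sup>2 * sym_M ys \<theta>"
  by (induction xs \<theta> rule: sym_P.induct) (auto simp: algebra_simps power_mult_distrib)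

text \<open>A geometric series in P^2, kept multiplied by 1 - P^2 because P may equal 1.\<close>

lemma sym_replicate:
  "sym_P (concat (replicate n xs)) \<theta> = sym_P xs \<theta> ^ n"
  "(1 - (sym_P xs \<theta>)\<^sup>2) * sym_M (concat (replicate n xs)) \<theta> = (1 - ((sym_P xs \<theta>)\<^sup>2) ^ n) * sym_M xs \<theta>"
proof (induction n)
  case (Suc n)
  { case 1 show ?case using Suc by (simp add: sym_append) }
  { case 2
    have "(1 - (sym_P xs \<theta>)\<^sup>2) * sym_M (concat (replicate (Suc n) xs)) \<theta>
      = (1 - (sym_P xs \<theta>)\<^sup>2) * sym_M xs \<theta> +
        (sym_P xs \<theta>)\<^sup>2 * ((1 - (sym_P xs \<theta>)\<^sup>2) * sym_M (concat (replicate n xs)) \<theta>)"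
      by (simp add: sym_append algebra_simps)
    also have "\<dots> = (1 - ((sym_P xs \<theta>)\<^sup>2) ^ Suc n) * sym_M xs \<theta>"
      unfolding Suc by (simp add: algebra_simps)
    finally show ?case . }
qed auto

section \<open>The small step limit\<close>

text \<open>Equalises the rates: a block \<open>(i, i)\<close> jumps twice as often in direction
  \<open>i\<close> as a block \<open>(i, j)\<close> with the same coefficient. After weighting,
  every coordinate contributes equally and the contributions add up to the full Laplacian.\<close>

definition pair_weight :: "'n \<Rightarrow> 'n \<Rightarrow> real" where
  "pair_weight i j = (if i = j then 1 else 2)"

definition step_blocks :: "('n \<Rightarrow> real) \<Rightarrow> ('n \<times> 'n) list \<Rightarrow> real \<Rightarrow> 'n block list" where
  "step_blocks \<alpha> L c = map (\<lambda>(i, j). (i, j, \<alpha> i, c * pair_weight i j / 2)) L"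

definition lap_part :: "'n::finite \<times> 'n \<Rightarrow> real ^ 'n \<Rightarrow> real" where
  "lap_part = (\<lambda>(i, j) \<theta>. pair_weight i j * (2 - cos (\<theta> $ i) - cos (\<theta> $ j)))"

text \<open>\<open>pair_weight\<close> times the numerator of the symbol of R_(i,j)^2. For
  \<open>i \<noteq> j\<close> the weight is also the factor 2 in front of \<alpha>_i
  R_(i,j)^2.\<close>

definition riesz_part :: "'n::finite \<times> 'n \<Rightarrow> real ^ 'n \<Rightarrow> real" where
  "riesz_part = (\<lambda>(i, j) \<theta>. pair_weight i j * (cos (\<theta> $ i) + cos (\<theta> $ j) - cos (\<theta> $ i - \<theta> $ j) - 1))"

lemma valid_step_blocks:
  assumes "\<And>i. \<bar>\<alpha> i\<bar> \<le> 1" "0 \<le> c" "8 * c \<le> 1"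
  shows "valid_blocks (step_blocks \<alpha> L c)"
proof -
  have "0 \<le> c * pair_weight i j / 2 \<and> 8 * (c * pair_weight i j / 2) \<le> 1" for i j :: 'a
    using assms by (auto simp: pair_weight_def)
  then show ?thesis using assms by (fastforce simp: valid_blocks_def step_blocks_def)
qed

text \<open>First order expansion in the step size \<open>c\<close>. The factors P^2 picked up from
  earlier blocks tend to 1, so to this order the blocks of one round simply add, in whatever order
  they are listed.\<close>

lemma step_limits:
  "((\<lambda>c. sym_P (step_blocks \<alpha> L c) \<theta>) \<longlongrightarrow> 1) (at_right 0) \<and>
   ((\<lambda>c. (1 - (sym_P (step_blocks \<alpha> L c) \<theta>)\<^sup>2) / c) \<longlongrightarrow> 2 * (\<Sum>b\<leftarrow>L. lap_part b \<theta>)) (at_right 0) \<and>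
   ((\<lambda>c. sym_M (step_blocks \<alpha> L c) \<theta> / c) \<longlongrightarrow> - 2 * (\<Sum>b\<leftarrow>L. \<alpha> (fst b) * riesz_part b \<theta>)) (at_right 0)"
proof (induction L)
  case Nil
  then show ?case by (simp add: step_blocks_def)
next
  case (Cons b L)
  obtain i j where b: "b = (i, j)" by (cases b)
  let ?w = "pair_weight i j"
  let ?d = "2 - cos (\<theta> $ i) - cos (\<theta> $ j)"
  let ?P = "\<lambda>c. sym_block_P i j (c * ?w / 2) \<theta>" and ?M = "\<lambda>c. sym_block_M i j (\<alpha> i) (c * ?w / 2) \<theta>"
  let ?R = "\<lambda>c. sym_P (step_blocks \<alpha> L c) \<theta>" and ?N = "\<lambda>c. sym_M (step_blocks \<alpha> L c) \<theta>"
  have P: "?P c = 1 - c * (?w * ?d)" for c by (simp add: sym_block_P_def algebra_simps)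
  have e: "\<forall>\<^sub>F c::real in at_right 0. c \<noteq> 0"
    using eventually_at_right_less[of "0::real"] by eventually_elim simp
  have P1: "(?P \<longlongrightarrow> 1) (at_right 0)"
    unfolding P by (rule tendsto_eq_intros | simp)+
  have PQ: "((\<lambda>c. (1 - (?P c)\<^sup>2) / c) \<longlongrightarrow> 2 * lap_part b \<theta>) (at_right 0)"
  proof (rule Lim_transform_eventually)
    show "((\<lambda>c. 2 * (?w * ?d) - c * (?w * ?d)\<^sup>2) \<longlongrightarrow> 2 * lap_part b \<theta>) (at_right 0)"
      by (rule tendsto_eq_intros | simp add: lap_part_def b)+
    show "\<forall>\<^sub>F c in at_right 0. 2 * (?w * ?d) - c * (?w * ?d)\<^sup>2 = (1 - (?P c)\<^sup>2) / c"
      using e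
    proof eventually_elim
      case (elim c)
      have "1 - (1 - c * z)\<^sup>2 = c * (2 * z - c * z\<^sup>2)" for z by (simp add: power2_eq_square algebra_simps)
      then show ?case using elim unfolding P by simp
    qed
  qed
  have PM: "((\<lambda>c. ?M c / c) \<longlongrightarrow> - 2 * (\<alpha> i * riesz_part b \<theta>)) (at_right 0)"
  proof (rule Lim_transform_eventually)
    show "((\<lambda>c. \<alpha> i * (2 * ?w * (cos (\<theta> $ i - \<theta> $ j) - 1) + (1 - (?P c)\<^sup>2) / c)) \<longlongrightarrow>
        - 2 * (\<alpha> i * riesz_part b \<theta>)) (at_right 0)"
      by (rule tendsto_eq_intros PQ refl | simp add: riesz_part_def lap_part_def b algebra_simps)+
    show "\<forall>\<^sub>F c in at_right 0. \<alpha> i * (2 * ?w * (cos (\<theta> $ i - \<theta> $ j) - 1) + (1 - (?P c)\<^sup>2) / c) = ?M c / c"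
      using e
    proof eventually_elim
      case (elim c)
      have "?M c = c * (\<alpha> i * (2 * ?w * (cos (\<theta> $ i - \<theta> $ j) - 1))) + \<alpha> i * (1 - (?P c)\<^sup>2)"
        by (simp add: sym_block_M_def algebra_simps)
      then show ?case using elim by (simp add: add_divide_distrib distrib_left)
    qed
  qed
  have s: "step_blocks \<alpha> (b # L) c = (i, j, \<alpha> i, c * ?w / 2) # step_blocks \<alpha> L c" for c
    by (simp add: step_blocks_def b)
  have T1: "((\<lambda>c. ?P c * ?R c) \<longlongrightarrow> 1 * 1) (at_right 0)"
    by (intro tendsto_mult P1 conjunct1[OF Cons])
  have eq2: "(1 - (?P c)\<^sup>2) / c + (?P c)\<^sup>2 * ((1 - (?R c)\<^sup>2) / c) = (1 - (?P c * ?R c)\<^sup>2) / c" for c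
    by (simp add: power_mult_distrib add_divide_distrib[symmetric] algebra_simps)
  have "((\<lambda>c. (1 - (?P c)\<^sup>2) / c + (?P c)\<^sup>2 * ((1 - (?R c)\<^sup>2) / c)) \<longlongrightarrow>
      2 * lap_part b \<theta> + 1\<^sup>2 * (2 * (\<Sum>b\<leftarrow>L. lap_part b \<theta>))) (at_right 0)"
    using Cons by (intro tendsto_intros P1 PQ) auto
  then have T2: "((\<lambda>c. (1 - (?P c * ?R c)\<^sup>2) / c) \<longlongrightarrow> 2 * (lap_part b \<theta> + (\<Sum>b\<leftarrow>L. lap_part b \<theta>))) (at_right 0)"
    unfolding eq2 by (simp add: distrib_left)
  have eq3: "?M c / c + (?P c)\<^sup>2 * (?N c / c) = (?M c + (?P c)\<^sup>2 * ?N c) / c" for c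
    by (simp add: add_divide_distrib)
  have "((\<lambda>c. ?M c / c + (?P c)\<^sup>2 * (?N c / c)) \<longlongrightarrow>
      - 2 * (\<alpha> i * riesz_part b \<theta>) + 1\<^sup>2 * (- 2 * (\<Sum>b\<leftarrow>L. \<alpha> (fst b) * riesz_part b \<theta>))) (at_right 0)"
    using Cons by (intro tendsto_add tendsto_mult tendsto_power P1 PM) auto
  moreover have "- 2 * (\<alpha> i * riesz_part b \<theta>) + 1\<^sup>2 * (- 2 * (\<Sum>b\<leftarrow>L. \<alpha> (fst b) * riesz_part b \<theta>))
      = - 2 * (\<alpha> i * riesz_part b \<theta> + (\<Sum>b\<leftarrow>L. \<alpha> (fst b) * riesz_part b \<theta>))" by simp
  ultimately have T3: "((\<lambda>c. (?M c + (?P c)\<^sup>2 * ?N c) / c) \<longlongrightarrow>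
      - 2 * (\<alpha> i * riesz_part b \<theta> + (\<Sum>b\<leftarrow>L. \<alpha> (fst b) * riesz_part b \<theta>))) (at_right 0)"
    unfolding eq3 by (simp only:)
  have fb: "fst b = i" by (simp add: b)
  show ?case unfolding s sym_P.simps sym_M.simps list.map sum_list.Cons fb
    using T1 T2 T3 by (simp only: mult_1_right simp_thms)
qed

text \<open>The step size 1 / (8 (k + 1)) tends to 0 while the total time, the number (k + 1)^2 of
  rounds times the step size, is (k + 1) / 8 and tends to infinity. The factor 8 makes the blocks
  valid for every \<open>k\<close>.\<close>

definition approx_blocks :: "('n \<Rightarrow> real) \<Rightarrow> ('n \<times> 'n) list \<Rightarrow> nat \<Rightarrow> 'n block list" where
  "approx_blocks \<alpha> L k = concat (replicate ((k + 1)\<^sup>2) (step_blocks \<alpha> L (1 / (8 * (real k + 1)))))"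

lemma valid_approx_blocks:
  assumes "\<And>i. \<bar>\<alpha> i\<bar> \<le> 1"
  shows "valid_blocks (approx_blocks \<alpha> L k)"
proof -
  have "valid_blocks (step_blocks \<alpha> L (1 / (8 * (real k + 1))))"
    by (rule valid_step_blocks) (use assms in auto)
  then show ?thesis unfolding approx_blocks_def valid_blocks_def by auto
qed

lemma lap_part_nonneg: "0 \<le> lap_part b \<theta>"
proof (cases b)
  case (Pair i j)
  have "cos (\<theta> $ i) \<le> 1" "cos (\<theta> $ j) \<le> 1" by auto
  then have "0 \<le> 2 - cos (\<theta> $ i) - cos (\<theta> $ j)" by linarith
  then show ?thesis by (simp add: Pair lap_part_def pair_weight_def)
qed

lemma sym_M_approx_limit:
  assumes \<alpha>: "\<And>i. \<bar>\<alpha> i\<bar> \<le> 1"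
  shows "(\<lambda>k. sym_M (approx_blocks \<alpha> L k) \<theta>) \<longlonglongrightarrow>
     - (\<Sum>b\<leftarrow>L. \<alpha> (fst b) * riesz_part b \<theta>) / (\<Sum>b\<leftarrow>L. lap_part b \<theta>)"
proof (cases "(\<Sum>b\<leftarrow>L. lap_part b \<theta>) = 0")
  \<comment> \<open>At such a frequency all factors P are 1, so \<open>sym_bounds\<close> forces the
    symbol to vanish. This agrees with the value of the quotient under division by zero.\<close>
  case True
  then have z: "lap_part b \<theta> = 0" if "b \<in> set L" for b
    using that lap_part_nonneg by (subst (asm) sum_list_nonneg_eq_0_iff) auto
  have P1: "sym_P (step_blocks \<alpha> L c) \<theta> = 1" for c
    using z
  proof (induction L)
    case Nil
    then show ?case by (simp add: step_blocks_def)
  next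
    case (Cons b L)
    obtain i j where b: "b = (i, j)" by (cases b)
    have "2 - cos (\<theta> $ i) - cos (\<theta> $ j) = 0"
      using Cons.prems[of b] by (auto simp: b lap_part_def pair_weight_def split: if_splits)
    then show ?case using Cons by (auto simp: b step_blocks_def sym_block_P_def)
  qed
  have "valid_blocks (approx_blocks \<alpha> L k)" for k using \<alpha> by (rule valid_approx_blocks)
  note v = sym_bounds[OF this]
  have "sym_M (approx_blocks \<alpha> L k) \<theta> = 0" for k
    using v[of k \<theta>] by (simp add: approx_blocks_def sym_replicate(1) P1)
  then show ?thesis using True by simp
next
  case False
  define \<Lambda> where "\<Lambda> = (\<Sum>b\<leftarrow>L. lap_part b \<theta>)"
  define N where "N = (\<Sum>b\<leftarrow>L. \<alpha> (fst b) * riesz_part b \<theta>)"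
  have "0 \<le> \<Lambda>" unfolding \<Lambda>_def by (rule sum_list_nonneg) (auto simp: lap_part_nonneg)
  then have \<Lambda>: "0 < \<Lambda>" using False by (simp add: \<Lambda>_def)
  define c where "c k = 1 / (8 * (real k + 1))" for k
  have cpos: "0 < c k" for k by (simp add: c_def)
  have "(\<lambda>k. 1 / 8 * inverse (real (Suc k))) \<longlonglongrightarrow> 0"
    by (intro tendsto_mult_right_zero LIMSEQ_inverse_real_of_nat)
  moreover have "c = (\<lambda>k. 1 / 8 * inverse (real (Suc k)))" by (auto simp: c_def divide_simps)
  ultimately have "c \<longlonglongrightarrow> 0" by simp
  then have c0: "filterlim c (at_right 0) sequentially"
    using cpos by (intro tendsto_imp_filterlim_at_right) auto
  define P where "P k = sym_P (step_blocks \<alpha> L (c k)) \<theta>" for k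
  define M where "M k = sym_M (step_blocks \<alpha> L (c k)) \<theta>" for k
  have Q: "(\<lambda>k. (1 - (P k)\<^sup>2) / c k) \<longlonglongrightarrow> 2 * \<Lambda>"
    unfolding P_def \<Lambda>_def using step_limits[of \<alpha> L \<theta>] by (intro filterlim_compose[OF _ c0]) auto
  have R: "(\<lambda>k. M k / c k) \<longlonglongrightarrow> - 2 * N"
    unfolding M_def N_def using step_limits[of \<alpha> L \<theta>] by (intro filterlim_compose[OF _ c0]) auto
  have ev: "\<forall>\<^sub>F k in sequentially. \<Lambda> < (1 - (P k)\<^sup>2) / c k"
    using \<Lambda> by (intro order_tendstoD(1)[OF Q]) auto
  have Pn: "(\<lambda>k. ((P k)\<^sup>2) ^ ((k + 1)\<^sup>2)) \<longlonglongrightarrow> 0"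
  proof (rule tendsto_sandwich[where f = "\<lambda>_. 0" and h = "\<lambda>k. exp (- \<Lambda> * (real k + 1) / 8)"])
    show "\<forall>\<^sub>F k in sequentially. ((P k)\<^sup>2) ^ ((k + 1)\<^sup>2) \<le> exp (- \<Lambda> * (real k + 1) / 8)"
      using ev
    proof eventually_elim
      case (elim k)
      have "\<Lambda> * c k \<le> 1 - (P k)\<^sup>2" using elim cpos[of k] by (simp add: field_simps)
      then have "(P k)\<^sup>2 \<le> 1 + (- \<Lambda> * c k)" by simp
      also have "\<dots> \<le> exp (- \<Lambda> * c k)" by (rule exp_ge_add_one_self)
      finally have "((P k)\<^sup>2) ^ ((k + 1)\<^sup>2) \<le> exp (- \<Lambda> * c k) ^ ((k + 1)\<^sup>2)"
        by (intro power_mono) auto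
      also have "\<dots> = exp (real ((k + 1)\<^sup>2) * (- \<Lambda> * c k))" by (simp only: exp_of_nat_mult)
      also have "real ((k + 1)\<^sup>2) * (- \<Lambda> * c k) = - \<Lambda> * (real k + 1) / 8"
        by (simp add: c_def power2_eq_square field_simps)
      finally show ?case .
    qed
    have "(\<lambda>k. exp (- \<Lambda> / 8) ^ Suc k) \<longlonglongrightarrow> 0"
      using \<Lambda> by (intro LIMSEQ_Suc LIMSEQ_power_zero) auto
    moreover have "exp (- \<Lambda> / 8) ^ Suc k = exp (- \<Lambda> * (real k + 1) / 8)" for k
      by (simp only: exp_of_nat_mult[symmetric]) (simp add: field_simps)
    ultimately show "(\<lambda>k. exp (- \<Lambda> * (real k + 1) / 8)) \<longlonglongrightarrow> 0" by (simp only:)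
  qed (auto intro!: always_eventually)
  have "(\<lambda>k. (1 - ((P k)\<^sup>2) ^ ((k + 1)\<^sup>2)) * ((M k / c k) / ((1 - (P k)\<^sup>2) / c k))) \<longlonglongrightarrow>
      (1 - 0) * (- 2 * N / (2 * \<Lambda>))"
    using \<Lambda> by (intro tendsto_intros Pn R Q) auto
  moreover have "\<forall>\<^sub>F k in sequentially.
      (1 - ((P k)\<^sup>2) ^ ((k + 1)\<^sup>2)) * ((M k / c k) / ((1 - (P k)\<^sup>2) / c k)) = sym_M (approx_blocks \<alpha> L k) \<theta>"
    using ev
  proof eventually_elim
    case (elim k)
    have "0 < (1 - (P k)\<^sup>2) / c k" using elim \<Lambda> by linarith
    then have nz: "1 - (P k)\<^sup>2 \<noteq> 0" by auto
    have "(1 - (P k)\<^sup>2) * sym_M (approx_blocks \<alpha> L k) \<theta> = (1 - ((P k)\<^sup>2) ^ ((k + 1)\<^sup>2)) * M k"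
      unfolding approx_blocks_def P_def M_def c_def by (rule sym_replicate(2))
    then have "sym_M (approx_blocks \<alpha> L k) \<theta> = (1 - ((P k)\<^sup>2) ^ ((k + 1)\<^sup>2)) * M k / (1 - (P k)\<^sup>2)"
      using nz by (simp add: field_simps)
    then show ?case using cpos[of k] by simp
  qed
  ultimately have "(\<lambda>k. sym_M (approx_blocks \<alpha> L k) \<theta>) \<longlonglongrightarrow> (1 - 0) * (- 2 * N / (2 * \<Lambda>))"
    by (rule Lim_transform_eventually)
  moreover have "(1 - 0) * (- 2 * N / (2 * \<Lambda>)) = - N / \<Lambda>" by simp
  ultimately show ?thesis by (simp add: \<Lambda>_def N_def)
qed

definition limit_symbol :: "('n \<Rightarrow> real) \<Rightarrow> ('n::finite \<times> 'n) list \<Rightarrow> real ^ 'n \<Rightarrow> complex" where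
  "limit_symbol \<alpha> L \<theta> =
     of_real (- (\<Sum>b\<leftarrow>L. \<alpha> (fst b) * riesz_part b \<theta>) / (\<Sum>b\<leftarrow>L. lap_part b \<theta>))"

lemma limit_symbol_kernel:
  assumes \<alpha>: "\<And>i. \<bar>\<alpha> i\<bar> \<le> 1"
  shows "set_integrable lborel torus (limit_symbol \<alpha> L)"
    "(\<lambda>k. multiplier_kernel (\<lambda>\<theta>. of_real (sym_M (approx_blocks \<alpha> L k) \<theta>)) x) \<longlonglongrightarrow> multiplier_kernel (limit_symbol \<alpha> L) x"
proof -
  have "valid_blocks (approx_blocks \<alpha> L k)" for k using \<alpha> by (rule valid_approx_blocks)
  note v = abs_sym_M_le[OF this]
  have c: "continuous_on UNIV (\<lambda>\<theta>. complex_of_real (sym_M (approx_blocks \<alpha> L k) \<theta>))" for k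
    by (intro continuous_intros)
  have b: "norm (complex_of_real (sym_M (approx_blocks \<alpha> L k) \<theta>)) \<le> 4" for k \<theta>
    using v by simp
  have l: "(\<lambda>k. complex_of_real (sym_M (approx_blocks \<alpha> L k) \<theta>)) \<longlonglongrightarrow> limit_symbol \<alpha> L \<theta>" for \<theta>
    unfolding limit_symbol_def by (intro tendsto_of_real sym_M_approx_limit \<alpha>)
  show "set_integrable lborel torus (limit_symbol \<alpha> L)"
    "(\<lambda>k. multiplier_kernel (\<lambda>\<theta>. of_real (sym_M (approx_blocks \<alpha> L k) \<theta>)) x) \<longlonglongrightarrow> multiplier_kernel (limit_symbol \<alpha> L) x"
    by (rule kernel_dominated_convergence[where B = 4, OF c b l])+
qed

text \<open>An argument of Fatou type: with \<open>F\<close> and \<open>G\<close> finite only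
  finitely many kernel values occur, so their pointwise convergence is enough to pass to the limit
  in \<open>ops_M_bound\<close>.\<close>

lemma limit_kernel_bound:
  fixes f :: "int ^ 'n::finite \<Rightarrow> real"
  assumes p: "1 < p" and \<alpha>: "\<And>i. \<bar>\<alpha> i\<bar> \<le> 1" and G: "finite G" and F: "finite F"
  shows "(\<Sum>x\<in>F. \<bar>\<Sum>y\<in>G. f y * multiplier_kernel (limit_symbol \<alpha> L) (x - y)\<bar> powr p)
      \<le> (pstar p - 1) powr p * (\<Sum>y\<in>G. \<bar>f y\<bar> powr p)"
proof (rule tendsto_upperbound)
  let ?K = "\<lambda>k. multiplier_kernel (\<lambda>\<theta>. of_real (sym_M (approx_blocks \<alpha> L k) \<theta>))"
  show "(\<lambda>k. \<Sum>x\<in>F. \<bar>\<Sum>y\<in>G. f y * ?K k (x - y)\<bar> powr p) \<longlonglongrightarrow>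
      (\<Sum>x\<in>F. \<bar>\<Sum>y\<in>G. f y * multiplier_kernel (limit_symbol \<alpha> L) (x - y)\<bar> powr p)"
    using p by (intro tendsto_sum tendsto_powr2 tendsto_const tendsto_rabs tendsto_mult limit_symbol_kernel(2) \<alpha>)
      (auto intro!: always_eventually)
  show "\<forall>\<^sub>F k in sequentially. (\<Sum>x\<in>F. \<bar>\<Sum>y\<in>G. f y * ?K k (x - y)\<bar> powr p)
      \<le> (pstar p - 1) powr p * (\<Sum>y\<in>G. \<bar>f y\<bar> powr p)"
  proof (rule always_eventually, rule allI)
    fix k
    have bv: "valid_blocks (approx_blocks \<alpha> L k)" using \<alpha> by (rule valid_approx_blocks)
    note v = abs_sym_M_le[OF bv]
    define g where "g = restrict0 G f"
    have g: "fin_supp g" by (rule finite_subset[OF _ G]) (auto simp: g_def restrict0_def)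
    have gG: "g y \<noteq> 0 \<Longrightarrow> y \<in> G" for y by (auto simp: g_def restrict0_def split: if_splits)
    let ?T = "ops_M (approx_blocks \<alpha> L k) g"
    have int: "set_integrable lborel torus (\<lambda>\<theta>. complex_of_real (sym_M (approx_blocks \<alpha> L k) \<theta>))"
    proof (rule set_integrable_torus[where B = 4])
      have "continuous_on UNIV (\<lambda>\<theta>. complex_of_real (sym_M (approx_blocks \<alpha> L k) \<theta>))"
        by (intro continuous_intros)
      then have [measurable]: "(\<lambda>\<theta>. complex_of_real (sym_M (approx_blocks \<alpha> L k) \<theta>)) \<in> borel_measurable borel"
        by (rule borel_measurable_continuous_onI)
      show "(\<lambda>\<theta>. indicator torus \<theta> *\<^sub>R complex_of_real (sym_M (approx_blocks \<alpha> L k) \<theta>)) \<in> borel_measurable borel"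
        by measurable
      fix \<theta>
      show "norm (complex_of_real (sym_M (approx_blocks \<alpha> L k) \<theta>)) \<le> 4"
        using v by simp
    qed
    have T: "?T x = (\<Sum>y\<in>G. f y * ?K k (x - y))" for x
    proof -
      have "?T x = multiplier_fin (\<lambda>\<theta>. of_real (sym_M (approx_blocks \<alpha> L k) \<theta>)) g x"
        using has_symbol_multiplier_fin[OF has_symbol_ops_M g] by simp
      also have "\<dots> = (\<Sum>y\<in>G. g y * ?K k (x - y))"
        by (rule multiplier_fin_kernel[OF int G gG])
      also have "\<dots> = (\<Sum>y\<in>G. f y * ?K k (x - y))"
        by (intro sum.cong) (auto simp: g_def restrict0_def)
      finally show ?thesis .
    qed
    have fT: "fin_supp ?T" using g by (rule fin_supp_ops_M)
    have "(\<Sum>x\<in>F. \<bar>?T x\<bar> powr p) \<le> lattice_sum (\<lambda>x. \<bar>?T x\<bar> powr p)"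
      unfolding lattice_sum_def using F fT by (intro finite_sum_le_infsum fin_supp_summable fin_supp_powr) auto
    also have "\<dots> \<le> (pstar p - 1) powr p * lattice_sum (\<lambda>x. \<bar>g x\<bar> powr p)"
      by (rule ops_M_bound[OF p bv g])
    also have "lattice_sum (\<lambda>x. \<bar>g x\<bar> powr p) = (\<Sum>\<^sub>\<infinity>y\<in>G. \<bar>f y\<bar> powr p)"
      unfolding lattice_sum_def by (rule infsum_cong_neutral) (auto simp: g_def restrict0_def)
    also have "\<dots> = (\<Sum>y\<in>G. \<bar>f y\<bar> powr p)" using G by simp
    finally show "(\<Sum>x\<in>F. \<bar>\<Sum>y\<in>G. f y * ?K k (x - y)\<bar> powr p)
        \<le> (pstar p - 1) powr p * (\<Sum>y\<in>G. \<bar>f y\<bar> powr p)" by (simp add: T)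
  qed
qed simp

text \<open>Fatou once more, now along the truncations \<open>G\<close> of \<open>f\<close>. The
  pointwise convergence of the convolution is an input; it comes from writing the operator as sums
  of compositions of two multipliers with kernels in every l^q, q > 1.\<close>

lemma limit_kernel_lp_bound:
  fixes f :: "int ^ 'n::finite \<Rightarrow> real"
  assumes p: "1 < p" and \<alpha>: "\<And>i. \<bar>\<alpha> i\<bar> \<le> 1" and f: "f \<in> lp p"
    and g: "\<And>x. ((\<lambda>y. f y * multiplier_kernel (limit_symbol \<alpha> L) (x - y)) has_sum g x) UNIV"
  shows "g \<in> lp p \<and> lp_norm p g \<le> (pstar p - 1) * lp_norm p f"
proof -
  let ?I = "\<Sum>\<^sub>\<infinity>y. \<bar>f y\<bar> powr p"
  have fs: "(\<lambda>y. \<bar>f y\<bar> powr p) summable_on UNIV" using f by (simp add: lp_def)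
  have bound: "(\<Sum>x\<in>F. \<bar>g x\<bar> powr p) \<le> (pstar p - 1) powr p * ?I" if F: "finite F" for F
  proof (rule tendsto_upperbound)
    show "((\<lambda>G. \<Sum>x\<in>F. \<bar>\<Sum>y\<in>G. f y * multiplier_kernel (limit_symbol \<alpha> L) (x - y)\<bar> powr p) \<longlongrightarrow>
        (\<Sum>x\<in>F. \<bar>g x\<bar> powr p)) (finite_subsets_at_top UNIV)"
      using p g[unfolded has_sum_def]
      by (intro tendsto_sum tendsto_powr2 tendsto_const tendsto_rabs) (auto intro!: always_eventually)
    show "\<forall>\<^sub>F G in finite_subsets_at_top UNIV.
        (\<Sum>x\<in>F. \<bar>\<Sum>y\<in>G. f y * multiplier_kernel (limit_symbol \<alpha> L) (x - y)\<bar> powr p) \<le> (pstar p - 1) powr p * ?I"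
    proof (rule eventually_finite_subsets_at_top_weakI)
      fix G :: "(int ^ 'n) set" assume G: "finite G"
      have "(\<Sum>y\<in>G. \<bar>f y\<bar> powr p) \<le> ?I" using G fs by (intro finite_sum_le_infsum) auto
      then have "(pstar p - 1) powr p * (\<Sum>y\<in>G. \<bar>f y\<bar> powr p) \<le> (pstar p - 1) powr p * ?I"
        by (intro mult_left_mono) auto
      then show "(\<Sum>x\<in>F. \<bar>\<Sum>y\<in>G. f y * multiplier_kernel (limit_symbol \<alpha> L) (x - y)\<bar> powr p) \<le> (pstar p - 1) powr p * ?I"
        using limit_kernel_bound[where \<alpha> = \<alpha>, OF p \<alpha> G F, where f = f and L = L] by linarith
    qed
  qed auto
  have gs: "(\<lambda>x. \<bar>g x\<bar> powr p) summable_on UNIV"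
    by (rule nonneg_bdd_above_summable_on) (use bound in \<open>auto intro!: bdd_aboveI2\<close>)
  have C: "0 \<le> pstar p - 1" using p by (simp add: pstar_def le_max_iff_disj)
  have "(\<Sum>\<^sub>\<infinity>x. \<bar>g x\<bar> powr p) \<le> (pstar p - 1) powr p * ?I"
    by (rule infsum_le_finite_sums[OF gs]) (use bound in auto)
  then have "(\<Sum>\<^sub>\<infinity>x. \<bar>g x\<bar> powr p) powr (1 / p) \<le> ((pstar p - 1) powr p * ?I) powr (1 / p)"
    using p by (intro powr_mono2) (auto intro!: infsum_nonneg)
  also have "\<dots> = (pstar p - 1) * ?I powr (1 / p)"
    using p C by (simp add: powr_mult powr_powr)
  finally show ?thesis using gs by (simp add: lp_def lp_norm_def)
qed

section \<open>Decay of the Riesz kernels through gradient bounds for a random walk\<close>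

section \<open>Bounds in the absolutely summable norm\<close>

text \<open>Stated through finite partial sums, so that the estimates below carry no summability
  side conditions.\<close>

definition l1_le :: "('x \<Rightarrow> real) \<Rightarrow> real \<Rightarrow> bool" where
  "l1_le f a \<longleftrightarrow> (\<forall>F. finite F \<longrightarrow> (\<Sum>x\<in>F. \<bar>f x\<bar>) \<le> a)"

lemma l1_leD: "l1_le f a \<Longrightarrow> finite F \<Longrightarrow> (\<Sum>x\<in>F. \<bar>f x\<bar>) \<le> a"
  by (auto simp: l1_le_def)

lemma l1_le_shift:
  fixes f :: "int ^ 'n::finite \<Rightarrow> real"
  assumes "l1_le f a"
  shows "l1_le (\<lambda>x. f (x + v)) a"
  unfolding l1_le_def
proof (intro allI impI)
  fix F :: "(int ^ 'n) set" assume "finite F"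
  have "(\<Sum>x\<in>F. \<bar>f (x + v)\<bar>) = (\<Sum>x\<in>(\<lambda>x. x + v) ` F. \<bar>f x\<bar>)"
    by (subst sum.reindex) (auto simp: inj_on_def)
  also have "\<dots> \<le> a" using \<open>finite F\<close> by (intro l1_leD[OF assms]) auto
  finally show "(\<Sum>x\<in>F. \<bar>f (x + v)\<bar>) \<le> a" .
qed

lemma l1_le_add:
  assumes "l1_le f a" "l1_le g b"
  shows "l1_le (\<lambda>x. f x + g x) (a + b)"
  unfolding l1_le_def
proof (intro allI impI)
  fix F :: "'a set" assume F: "finite F"
  have "(\<Sum>x\<in>F. \<bar>f x + g x\<bar>) \<le> (\<Sum>x\<in>F. \<bar>f x\<bar>) + (\<Sum>x\<in>F. \<bar>g x\<bar>)"
    by (simp add: sum.distrib[symmetric] sum_mono abs_triangle_ineq)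
  also have "\<dots> \<le> a + b" using assms F by (intro add_mono l1_leD)
  finally show "(\<Sum>x\<in>F. \<bar>f x + g x\<bar>) \<le> a + b" .
qed

lemma l1_le_cmult:
  assumes "l1_le f a"
  shows "l1_le (\<lambda>x. c * f x) (\<bar>c\<bar> * a)"
  unfolding l1_le_def using assms
  by (auto simp: abs_mult sum_distrib_left[symmetric] intro!: mult_left_mono l1_leD)

lemma l1_le_mono: "l1_le f a \<Longrightarrow> a \<le> b \<Longrightarrow> l1_le f b"
  by (force simp: l1_le_def)

lemma l1_le_sum:
  assumes "finite J" "\<And>j. j \<in> J \<Longrightarrow> l1_le (f j) (a j)"
  shows "l1_le (\<lambda>x. \<Sum>j\<in>J. f j x) (\<Sum>j\<in>J. a j)"
  using assms
proof (induction J rule: finite_induct)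
  case empty
  then show ?case by (simp add: l1_le_def)
next
  case (insert j J)
  then show ?case using l1_le_add[of "f j" "a j"] by simp
qed

section \<open>The lazy random walk\<close>

definition forward :: "'n::finite \<Rightarrow> (int ^ 'n \<Rightarrow> real) \<Rightarrow> int ^ 'n \<Rightarrow> real" where
  "forward i f x = f (x + unit_vec i) - f x"

definition half_step :: "'n::finite \<Rightarrow> (int ^ 'n \<Rightarrow> real) \<Rightarrow> int ^ 'n \<Rightarrow> real" where
  "half_step i f x = 1 / 2 * (f x + f (x + unit_vec i))"

definition walk :: "(int ^ 'n::finite \<Rightarrow> real) \<Rightarrow> int ^ 'n \<Rightarrow> real" where
  "walk f x = 1 / 2 * f x +
     1 / (4 * real CARD('n)) * (\<Sum>k\<in>UNIV. f (x + unit_vec k) + f (x + - unit_vec k))"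

definition walk_rest :: "'n::finite \<Rightarrow> (int ^ 'n \<Rightarrow> real) \<Rightarrow> int ^ 'n \<Rightarrow> real" where
  "walk_rest i f x = (1 / 2 - 1 / (4 * real CARD('n))) * f x +
     1 / (4 * real CARD('n)) *
       ((\<Sum>k\<in>UNIV - {i}. f (x + unit_vec k)) + (\<Sum>k\<in>UNIV. f (x + - unit_vec k)))"

text \<open>With probability 1 / (2 N) the walk makes a fair choice between staying and moving by
  \<open>e_i\<close>; thanks to the laziness the remainder keeps nonnegative weights. Only the fair
  choices are used to smooth in direction \<open>i\<close>; since all operators commute they can be
  collected.\<close>

lemma walk_split:
  "walk f x = 1 / (2 * real CARD('n)) * half_step i f x + walk_rest i f (x :: int ^ 'n::finite)"
proof -
  have "(\<Sum>k\<in>UNIV. f (x + unit_vec k)) = f (x + unit_vec i) + (\<Sum>k\<in>UNIV - {i}. f (x + unit_vec k))"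
    by (rule sum.remove) auto
  then show ?thesis
    unfolding walk_def half_step_def walk_rest_def by (simp add: sum.distrib field_simps)
qed

lemma l1_le_walk_rest:
  fixes f :: "int ^ 'n::finite \<Rightarrow> real"
  assumes "l1_le f b"
  shows "l1_le (walk_rest i f) ((1 - 1 / (2 * real CARD('n))) * b)"
proof -
  define N where "N = real CARD('n)"
  have N: "1 \<le> N" by (simp add: N_def Suc_leI)
  have "l1_le (walk_rest i f) (\<bar>1 / 2 - 1 / (4 * N)\<bar> * b + \<bar>1 / (4 * N)\<bar> *
      ((\<Sum>k\<in>UNIV - {i}. b) + (\<Sum>k\<in>(UNIV :: 'n set). b)))"
    unfolding walk_rest_def[abs_def] N_def
    by (intro l1_le_add l1_le_cmult l1_le_sum l1_le_shift assms) auto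
  moreover have "1 / (4 * N) \<le> 1 / 4" using N by (simp add: field_simps)
  then have "\<bar>1 / 2 - 1 / (4 * N)\<bar> = 1 / 2 - 1 / (4 * N)" by simp
  moreover have "\<bar>1 / (4 * N)\<bar> = 1 / (4 * N)" using N by simp
  moreover have "(\<Sum>k\<in>UNIV - {i}. b) + (\<Sum>k\<in>(UNIV :: 'n set). b) = (2 * N - 1) * b"
    by (simp add: N_def card_Diff_singleton of_nat_diff Suc_leI algebra_simps)
  moreover have "(1 / 2 - 1 / (4 * N)) * b + 1 / (4 * N) * ((2 * N - 1) * b) = (1 - 1 / (2 * N)) * b"
    using N by (simp add: field_simps)
  ultimately show ?thesis by (simp add: N_def)
qed

lemma forward_linear: "forward i (\<lambda>x. a * f x + g x) = (\<lambda>x. a * forward i f x + forward i g x)"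
  by (rule ext) (simp add: forward_def algebra_simps)

lemma half_step_linear: "half_step i (\<lambda>x. a * f x + g x) = (\<lambda>x. a * half_step i f x + half_step i g x)"
  by (rule ext) (simp add: half_step_def algebra_simps)

lemma walk_linear: "walk (\<lambda>x. a * f x + g x) = (\<lambda>x. a * walk f x + walk g x)"
  by (rule ext) (simp add: walk_def sum.distrib sum_distrib_left sum_divide_distrib algebra_simps)

lemma half_step_pow_linear:
  "(half_step i ^^ l) (\<lambda>x. a * f x + g x) = (\<lambda>x. a * (half_step i ^^ l) f x + (half_step i ^^ l) g x)"
  by (induction l) (simp_all add: half_step_linear)

lemma walk_pow_linear:
  "(walk ^^ k) (\<lambda>x. a * f x + g x) = (\<lambda>x. a * (walk ^^ k) f x + (walk ^^ k) g x)"
  by (induction k) (simp_all add: walk_linear)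

lemma walk_half_step: "walk (half_step i f) = half_step i (walk f)"
proof
  fix x
  have "(\<Sum>k\<in>UNIV. f (x + unit_vec k + unit_vec i) + f (x + - unit_vec k + unit_vec i))
      = (\<Sum>k\<in>UNIV. f (x + unit_vec i + unit_vec k) + f (x + unit_vec i + - unit_vec k))"
    by (intro sum.cong refl) (simp add: algebra_simps)
  then show "walk (half_step i f) x = half_step i (walk f) x"
    unfolding walk_def half_step_def by (simp add: sum.distrib sum_distrib_left sum_divide_distrib algebra_simps)
qed

lemma walk_pow_half_step: "(walk ^^ k) (half_step i f) = half_step i ((walk ^^ k) f)"
  by (induction k) (simp_all add: walk_half_step)

lemma walk_forward: "walk (forward i f) = forward i (walk f)"
proof
  fix x
  have "(\<Sum>k\<in>UNIV. f (x + unit_vec k + unit_vec i) + f (x + - unit_vec k + unit_vec i))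
      = (\<Sum>k\<in>UNIV. f (x + unit_vec i + unit_vec k) + f (x + unit_vec i + - unit_vec k))"
    by (intro sum.cong refl) (simp add: algebra_simps)
  then show "walk (forward i f) x = forward i (walk f) x"
    unfolding walk_def forward_def
    by (simp add: sum.distrib sum_subtractf sum_distrib_left sum_divide_distrib algebra_simps)
qed

lemma walk_pow_forward: "(walk ^^ k) (forward i f) = forward i ((walk ^^ k) f)"
  by (induction k) (simp_all add: walk_forward)

lemma axis_0_int: "axis i (0 :: int) = 0"
  by (simp add: vec_eq_iff axis_def)

lemma axis_of_nat_Suc: "axis i (int (Suc j)) = axis i (int j) + unit_vec i"
  "axis i (1 + int j) = axis i (int j) + unit_vec i"
  by (simp_all add: vec_eq_iff axis_def)

lemma half_step_pow:
  "(half_step i ^^ l) f x = (\<Sum>j\<le>l. real (l choose j) / 2 ^ l * f (x + axis i (int j)))"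
proof (induction l arbitrary: x)
  case 0
  show ?case by (simp add: axis_0_int)
next
  case (Suc l)
  let ?g = "\<lambda>j. f (x + axis i (int j))"
  have "(half_step i ^^ Suc l) f x = 1 / 2 * ((half_step i ^^ l) f x + (half_step i ^^ l) f (x + unit_vec i))"
    by (simp add: half_step_def)
  also have "\<dots> = 1 / 2 * ((\<Sum>j\<le>l. real (l choose j) / 2 ^ l * ?g j) + (\<Sum>j\<le>l. real (l choose j) / 2 ^ l * ?g (Suc j)))"
    unfolding Suc by (simp add: axis_of_nat_Suc ac_simps)
  also have "(\<Sum>j\<le>l. real (l choose j) / 2 ^ l * ?g j) = (\<Sum>j\<le>Suc l. real (l choose j) / 2 ^ l * ?g j)"
    by simp
  also have "\<dots> = 1 / 2 ^ l * ?g 0 + (\<Sum>j\<le>l. real (l choose Suc j) / 2 ^ l * ?g (Suc j))"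
    by (subst sum.atMost_Suc_shift) simp
  also have "1 / 2 * (1 / 2 ^ l * ?g 0 + (\<Sum>j\<le>l. real (l choose Suc j) / 2 ^ l * ?g (Suc j)) +
        (\<Sum>j\<le>l. real (l choose j) / 2 ^ l * ?g (Suc j)))
      = 1 / 2 ^ Suc l * ?g 0 + (\<Sum>j\<le>l. real (Suc l choose Suc j) / 2 ^ Suc l * ?g (Suc j))"
    by (simp add: sum.distrib[symmetric] sum_distrib_left add_divide_distrib algebra_simps)
  also have "\<dots> = (\<Sum>j\<le>Suc l. real (Suc l choose j) / 2 ^ Suc l * ?g j)"
    by (subst sum.atMost_Suc_shift) simp
  finally show ?case .
qed

text \<open>The l^1 distance between a binomial distribution and its translate by one. With n = l +
  1 the difference of neighbouring coefficients is (2 j - n) / n times C(n, j), so the sum is 2 / n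
  times the mean of |2 X - n|, where X is binomial with parameters n and 1/2. This mean is at most
  the standard deviation sqrt n; the variance comes from the moments of Bernstein polynomials at
  1/2.\<close>

lemma binomial_difference_l1:
  "(\<Sum>j\<le>Suc l. \<bar>(if j = 0 then 0 else real (l choose (j - 1))) - real (l choose j)\<bar> / 2 ^ l)
     \<le> 2 / sqrt (real l + 1)"
proof -
  define n where "n = Suc l"
  define B where "B j = Bernstein n j (1 / 2)" for j
  have B: "B j = real (n choose j) / 2 ^ n" if "j \<le> n" for j
  proof -
    have "(1 / 2) ^ j * (1 / 2) ^ (n - j) = (1 / 2 :: real) ^ n"
      using that by (simp add: power_add[symmetric] del: power_one_over)
    then show ?thesis by (simp add: B_def Bernstein_def mult.assoc power_one_over)
  qed
  have B0: "0 \<le> B j" for j unfolding B_def by (rule Bernstein_nonneg) auto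
  have c: "\<bar>(if j = 0 then 0 else real (l choose (j - 1))) - real (l choose j)\<bar> / 2 ^ l
      = 2 / real n * (B j * \<bar>2 * real j - real n\<bar>)" if j: "j \<le> n" for j
  proof -
    have 1: "real n * real (l choose j) = (real n - real j) * real (n choose j)"
    proof -
      have "(n - j) * (n choose j) = n * (l choose j)"
        using binomial_absorb_comp[of n j] by (simp add: n_def)
      then have "real (n - j) * real (n choose j) = real n * real (l choose j)"
        by (metis of_nat_mult)
      then show ?thesis using j by (simp add: of_nat_diff)
    qed
    have 2: "real n * (if j = 0 then 0 else real (l choose (j - 1))) = real j * real (n choose j)"
    proof (cases j)
      case (Suc i)
      then have "Suc i * (Suc l choose Suc i) = Suc l * (l choose i)"
        by (metis Suc_times_binomial_eq mult.commute)
      then have "real (Suc i) * real (n choose j) = real n * real (l choose i)"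
        unfolding n_def Suc by (metis of_nat_mult)
      then show ?thesis by (simp add: Suc)
    qed simp
    have "real n * ((if j = 0 then 0 else real (l choose (j - 1))) - real (l choose j))
        = (2 * real j - real n) * real (n choose j)"
      using 1 2 by (simp add: algebra_simps)
    then have "(if j = 0 then 0 else real (l choose (j - 1))) - real (l choose j)
        = (2 * real j - real n) * real (n choose j) / real n"
      by (simp add: n_def field_simps)
    then have "\<bar>(if j = 0 then 0 else real (l choose (j - 1))) - real (l choose j)\<bar>
        = \<bar>2 * real j - real n\<bar> * real (n choose j) / real n"
      by (simp add: abs_mult)
    then show ?thesis using j by (simp add: B) (simp add: n_def)
  qed
  have S: "(\<Sum>j\<le>n. B j * (2 * real j - real n)\<^sup>2) = real n"
  proof -
    have "(\<Sum>j\<le>n. B j * (2 * real j - real n)\<^sup>2)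
        = (\<Sum>j\<le>n. 4 * (real j * (real j - 1) * B j) + (4 - 4 * real n) * (real j * B j) + (real n)\<^sup>2 * B j)"
      by (intro sum.cong refl) (simp add: power2_eq_square algebra_simps)
    also have "\<dots> = 4 * (\<Sum>j\<le>n. real j * (real j - 1) * B j) + (4 - 4 * real n) * (\<Sum>j\<le>n. real j * B j)
        + (real n)\<^sup>2 * (\<Sum>j\<le>n. B j)"
      by (simp only: sum.distrib sum_distrib_left)
    also have "\<dots> = real n" unfolding B_def sum_Bernstein sum_k_Bernstein sum_kk_Bernstein
      by (simp add: power2_eq_square algebra_simps)
    finally show ?thesis .
  qed
  define s where "s = sqrt (real n)"
  have s: "0 < s" "s * s = real n" by (auto simp: s_def n_def)
  have "(\<Sum>j\<le>n. B j * \<bar>2 * real j - real n\<bar>) \<le> (\<Sum>j\<le>n. B j * (((2 * real j - real n)\<^sup>2 / s + s) / 2))"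
  proof (intro sum_mono mult_left_mono B0)
    fix j
    define z where "z = \<bar>2 * real j - real n\<bar>"
    have "2 * z * s \<le> z\<^sup>2 + s * s" using sum_squares_bound[of z s] by (simp add: power2_eq_square)
    then have "z \<le> (z\<^sup>2 / s + s) / 2" using s by (simp add: field_simps power2_eq_square)
    then show "\<bar>2 * real j - real n\<bar> \<le> ((2 * real j - real n)\<^sup>2 / s + s) / 2" by (simp add: z_def)
  qed
  also have "\<dots> = ((\<Sum>j\<le>n. B j * (2 * real j - real n)\<^sup>2) / s + s * (\<Sum>j\<le>n. B j)) / 2"
    by (simp add: sum_divide_distrib sum_distrib_left sum.distrib[symmetric] add_divide_distrib distrib_left mult_ac)
  also have "\<dots> = s"
  proof -
    have "real n / s = s" using s by (simp add: field_simps)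
    then show ?thesis unfolding S by (simp add: B_def)
  qed
  finally have le: "(\<Sum>j\<le>n. B j * \<bar>2 * real j - real n\<bar>) \<le> s" .
  have "(\<Sum>j\<le>n. \<bar>(if j = 0 then 0 else real (l choose (j - 1))) - real (l choose j)\<bar> / 2 ^ l)
      = 2 / real n * (\<Sum>j\<le>n. B j * \<bar>2 * real j - real n\<bar>)"
    unfolding sum_distrib_left by (intro sum.cong refl c) auto
  also have "\<dots> \<le> 2 / real n * s" using le by (intro mult_left_mono) auto
  also have "\<dots> = 2 / s"
  proof -
    have "2 / real n * s = 2 / (s * s) * s" unfolding s(2) ..
    then show ?thesis using s(1) by simp
  qed
  finally show ?thesis by (simp add: s_def n_def add.commute)
qed

lemma l1_le_forward_half_step:
  assumes "l1_le f b"
  shows "l1_le (forward i ((half_step i ^^ l) f)) (2 / sqrt (real l + 1) * b)"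
proof -
  define c where "c j = ((if j = 0 then 0 else real (l choose (j - 1))) - real (l choose j)) / 2 ^ l" for j
  have b: "0 \<le> b" using l1_leD[OF assms, of "{}"] by simp
  have eq: "forward i ((half_step i ^^ l) f) = (\<lambda>x. \<Sum>j\<le>Suc l. c j * f (x + axis i (int j)))"
  proof
    fix x
    let ?g = "\<lambda>j. f (x + axis i (int j))"
    have "(\<Sum>j\<le>Suc l. c j * ?g j) =
        (\<Sum>j\<le>Suc l. (if j = 0 then 0 else real (l choose (j - 1))) / 2 ^ l * ?g j)
        - (\<Sum>j\<le>Suc l. real (l choose j) / 2 ^ l * ?g j)"
      by (simp only: sum_subtractf[symmetric] c_def diff_divide_distrib left_diff_distrib)
    also have "(\<Sum>j\<le>Suc l. (if j = 0 then 0 else real (l choose (j - 1))) / 2 ^ l * ?g j)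
        = (\<Sum>j\<le>l. real (l choose j) / 2 ^ l * ?g (Suc j))"
      by (subst sum.atMost_Suc_shift) simp
    also have "(\<Sum>j\<le>Suc l. real (l choose j) / 2 ^ l * ?g j) = (\<Sum>j\<le>l. real (l choose j) / 2 ^ l * ?g j)"
      by simp
    finally show "forward i ((half_step i ^^ l) f) x = (\<Sum>j\<le>Suc l. c j * ?g j)"
      by (simp add: forward_def half_step_pow axis_of_nat_Suc ac_simps)
  qed
  have "l1_le (\<lambda>x. \<Sum>j\<le>Suc l. c j * f (x + axis i (int j))) (\<Sum>j\<le>Suc l. \<bar>c j\<bar> * b)"
    by (intro l1_le_sum l1_le_cmult l1_le_shift assms) auto
  moreover have "(\<Sum>j\<le>Suc l. \<bar>c j\<bar> * b) \<le> 2 / sqrt (real l + 1) * b"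
    unfolding sum_distrib_right[symmetric] using binomial_difference_l1[of l] b
    by (intro mult_right_mono) (auto simp: c_def)
  ultimately show ?thesis unfolding eq by (rule l1_le_mono)
qed

text \<open>Induction step for the gradient of the walk: a fair choice of probability
  \<open>a\<close> advances the time inside the square root by one. Since the inverse square root is
  convex, averaging loses something, and only \<open>a / 3\<close> of the mean advance
  \<open>a\<close> is claimed. The final comparison is 1/6 \<le> 4/15.\<close>

lemma inverse_sqrt_supersolution:
  fixes a z :: real
  assumes z: "1 \<le> z" and a: "0 \<le> a"
  shows "a * (2 / sqrt (z + 1)) + (1 - a) * (2 / sqrt z) \<le> 2 / sqrt (z + a / 3)"
proof -
  define s r t where "s = sqrt z" "r = sqrt (z + 1)" "t = sqrt (z + a / 3)"
  have s: "1 \<le> s" and st: "s \<le> t" and sr: "s \<le> r" using z a by (auto simp: s_r_t_def)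
  have sq: "s * s = z" "r * r = z + 1" "t * t = z + a / 3" using z a by (auto simp: s_r_t_def)
  \<comment> \<open>This is where \<open>1 \<le> z\<close> enters: z + 1 \<le> 9/4 z.\<close>
  have r: "r \<le> 3 / 2 * s"
  proof (rule power2_le_imp_le)
    have "r\<^sup>2 = z + 1" "(3 / 2 * s)\<^sup>2 = 9 / 4 * z" using sq by (simp_all add: power2_eq_square)
    then show "r\<^sup>2 \<le> (3 / 2 * s)\<^sup>2" using z by simp
  qed (use s in simp)
  have "1 / s - 1 / t = (a / 3) / (s * t * (s + t))"
  proof -
    have e: "(t - s) * (s + t) = a / 3" using sq by (simp add: algebra_simps)
    have "a / 3 / (s * t * (s + t)) = (t - s) * (s + t) / (s * t * (s + t))" unfolding e ..
    also have "\<dots> = (t - s) / (s * t)" using s st by simp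
    also have "\<dots> = 1 / s - 1 / t" using s st by (simp add: field_simps)
    finally show ?thesis by simp
  qed
  also have "\<dots> \<le> (a / 3) / (s * s * (s + s))"
    using s st a by (intro divide_left_mono mult_mono mult_pos_pos add_mono) auto
  finally have 1: "1 / s - 1 / t \<le> a / 6 / (s * s * s)" by (simp add: field_simps)
  have "1 / (s * (3 / 2 * s) * (s + 3 / 2 * s)) \<le> 1 / (s * r * (s + r))"
    using s sr r by (intro divide_left_mono mult_mono mult_pos_pos add_mono) auto
  also have "\<dots> = 1 / s - 1 / r"
  proof -
    have "(r - s) * (s + r) = 1" using sq by (simp add: algebra_simps)
    then have "1 / (s * r * (s + r)) = (r - s) * (s + r) / (s * r * (s + r))" by simp
    also have "\<dots> = (r - s) / (s * r)" using s sr by simp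
    also have "\<dots> = 1 / s - 1 / r" using s sr by (simp add: field_simps)
    finally show ?thesis .
  qed
  finally have "4 / 15 / (s * s * s) \<le> 1 / s - 1 / r" by (simp add: field_simps)
  then have "a * (4 / 15 / (s * s * s)) \<le> a * (1 / s - 1 / r)" using a by (rule mult_left_mono)
  moreover have "a / 6 / (s * s * s) \<le> a * (4 / 15 / (s * s * s))" using a s by (simp add: field_simps)
  ultimately have "1 / s - 1 / t \<le> a * (1 / s - 1 / r)" using 1 by linarith
  then have le: "a * (1 / r) + (1 - a) * (1 / s) \<le> 1 / t" by (simp add: algebra_simps diff_divide_distrib)
  have A: "a * (2 / r) = 2 * (a * (1 / r))" "(1 - a) * (2 / s) = 2 * ((1 - a) * (1 / s))"
    by simp_all
  have "a * (2 / r) + (1 - a) * (2 / s) = 2 * (a * (1 / r)) + 2 * ((1 - a) * (1 / s))" unfolding A ..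
  also have "\<dots> = 2 * (a * (1 / r) + (1 - a) * (1 / s))" by (rule distrib_left[symmetric])
  also have "\<dots> \<le> 2 * (1 / t)" using le by (rule mult_left_mono) simp
  also have "\<dots> = 2 / t" by simp
  finally have "a * (2 / r) + (1 - a) * (2 / s) \<le> 2 / t" .
  then show ?thesis unfolding s_r_t_def .
qed

text \<open>Here \<open>l\<close> counts the fair choices already collected and \<open>k\<close> the
  steps still to be split, so both \<open>l\<close> and \<open>f\<close> must vary in the induction.
  With a = 1 / (2 N) each step advances the effective time by a / 3 = 1 / (6 N). The other branch
  applies \<open>walk_rest\<close> to \<open>f\<close> and multiplies the norm of \<open>f\<close>
  by 1 - a.\<close>

lemma l1_le_forward_walk_aux:
  fixes f :: "int ^ 'n::finite \<Rightarrow> real"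
  assumes "l1_le f b"
  shows "l1_le (forward i ((half_step i ^^ l) ((walk ^^ k) f)))
     (2 / sqrt (real l + 1 + 1 / (6 * real CARD('n)) * real k) * b)"
  using assms
proof (induction k arbitrary: l f b)
  case 0
  then show ?case using l1_le_forward_half_step by simp
next
  case (Suc k)
  define N where "N = real CARD('n)"
  define a where "a = 1 / (2 * N)"
  define F where "F l k = 2 / sqrt (real l + 1 + 1 / (6 * real CARD('n)) * real k)" for l k :: nat
  have N: "1 \<le> N" by (simp add: N_def Suc_leI)
  have a: "0 \<le> a" "a \<le> 1" using N by (auto simp: a_def field_simps)
  have b: "0 \<le> b" using l1_leD[OF Suc.prems, of "{}"] by simp
  have "walk f = (\<lambda>x. a * half_step i f x + walk_rest i f x)"
    by (rule ext) (simp add: a_def N_def walk_split[of f _ i])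
  then have "(walk ^^ Suc k) f = (walk ^^ k) (\<lambda>x. a * half_step i f x + walk_rest i f x)"
    by (simp add: funpow_swap1)
  then have "forward i ((half_step i ^^ l) ((walk ^^ Suc k) f)) =
      (\<lambda>x. a * forward i ((half_step i ^^ Suc l) ((walk ^^ k) f)) x
         + forward i ((half_step i ^^ l) ((walk ^^ k) (walk_rest i f))) x)"
    by (simp add: walk_pow_linear half_step_pow_linear forward_linear walk_pow_half_step funpow_swap1)
  moreover have "l1_le (\<lambda>x. a * forward i ((half_step i ^^ Suc l) ((walk ^^ k) f)) x
         + forward i ((half_step i ^^ l) ((walk ^^ k) (walk_rest i f))) x)
      (\<bar>a\<bar> * (F (Suc l) k * b) + F l k * ((1 - a) * b))"
    unfolding F_def a_def N_def by (intro l1_le_add l1_le_cmult Suc.IH l1_le_walk_rest Suc.prems)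
  moreover have "\<bar>a\<bar> * (F (Suc l) k * b) + F l k * ((1 - a) * b) \<le> F l (Suc k) * b"
  proof -
    define z where "z = real l + 1 + 1 / (6 * real CARD('n)) * real k"
    have z: "1 \<le> z" by (simp add: z_def)
    have "F (Suc l) k = 2 / sqrt (z + 1)" "F l k = 2 / sqrt z" "F l (Suc k) = 2 / sqrt (z + a / 3)"
      by (simp_all add: F_def z_def a_def N_def add_divide_distrib algebra_simps)
    then have "a * F (Suc l) k + (1 - a) * F l k \<le> F l (Suc k)"
      using inverse_sqrt_supersolution[OF z a(1)] by simp
    then have "(a * F (Suc l) k + (1 - a) * F l k) * b \<le> F l (Suc k) * b" using b by (rule mult_right_mono)
    then show ?thesis using a by (simp add: algebra_simps)
  qed
  ultimately show ?case unfolding F_def by (simp add: l1_le_mono)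
qed

lemma l1_le_forward_walk:
  fixes f :: "int ^ 'n::finite \<Rightarrow> real"
  assumes "l1_le f b"
  shows "l1_le (forward i ((walk ^^ k) f)) (2 * sqrt (6 * real CARD('n)) / sqrt (real k + 1) * b)"
proof -
  define N where "N = real CARD('n)"
  have N: "1 \<le> N" by (simp add: N_def Suc_leI)
  have b: "0 \<le> b" using l1_leD[OF assms, of "{}"] by simp
  have "2 / sqrt (real 0 + 1 + 1 / (6 * N) * real k) \<le> 2 / sqrt ((real k + 1) / (6 * N))"
    using N
    by (intro divide_left_mono mult_pos_pos real_sqrt_le_mono) (auto simp: field_simps intro: add_pos_pos)
  also have "\<dots> = 2 * sqrt (6 * N) / sqrt (real k + 1)"
    by (simp add: real_sqrt_divide)
  finally have "2 / sqrt (real 0 + 1 + 1 / (6 * N) * real k) * b \<le> 2 * sqrt (6 * N) / sqrt (real k + 1) * b"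
    using b by (rule mult_right_mono)
  then show ?thesis using l1_le_forward_walk_aux[OF assms, of i 0 k] by (auto simp: N_def intro: l1_le_mono)
qed

lemma fin_supp_forward: "fin_supp f \<Longrightarrow> fin_supp (forward i f)"
  unfolding forward_def[abs_def] by (intro fin_supp_intros)

text \<open>Telescoping along the ray from \<open>x\<close> in direction \<open>i\<close>, which
  leaves the finite support.\<close>

lemma sup_le_l1_forward:
  assumes h: "fin_supp h" and a: "l1_le (forward i h) a"
  shows "\<bar>h x\<bar> \<le> a"
proof -
  have inj: "inj (\<lambda>m. x + axis i (int m))"
    by (rule injI) (auto simp: vec_eq_iff axis_def split: if_splits)
  have "\<exists>m. h (x + axis i (int m)) = 0"
  proof (rule ccontr)
    assume "\<not> ?thesis"
    then have "range (\<lambda>m. x + axis i (int m)) \<subseteq> {x. h x \<noteq> 0}" by auto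
    then have "finite (range (\<lambda>m. x + axis i (int m)))" using h finite_subset by blast
    then show False using inj finite_imageD by blast
  qed
  then obtain m where m: "h (x + axis i (int m)) = 0" by blast
  have ax0: "axis i (0 :: int) = 0" by (simp add: vec_eq_iff axis_def)
  have "(\<Sum>j<m. forward i h (x + axis i (int j))) = h (x + axis i (int m)) - h (x + axis i (int 0))"
    by (subst sum_lessThan_telescope[symmetric]) (simp add: forward_def axis_of_nat_Suc ac_simps)
  then have "\<bar>h x\<bar> = \<bar>\<Sum>j<m. forward i h (x + axis i (int j))\<bar>" using m by (simp add: ax0)
  also have "\<dots> \<le> (\<Sum>j<m. \<bar>forward i h (x + axis i (int j))\<bar>)" by (rule sum_abs)
  also have "\<dots> = (\<Sum>y\<in>(\<lambda>m. x + axis i (int m)) ` {..<m}. \<bar>forward i h y\<bar>)"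
    using inj by (subst sum.reindex) (auto intro: inj_on_subset)
  also have "\<dots> \<le> a" by (rule l1_leD[OF a]) simp
  finally show ?thesis .
qed

definition delta0 :: "int ^ 'n::finite \<Rightarrow> real" where
  "delta0 x = (if x = 0 then 1 else 0)"

lemma l1_le_delta0: "l1_le delta0 1"
  unfolding l1_le_def delta0_def by (auto simp: if_distrib sum.delta cong: if_cong)

lemma fin_supp_walk: "fin_supp f \<Longrightarrow> fin_supp (walk f)"
proof -
  assume f: "fin_supp f"
  have "finite A \<Longrightarrow> fin_supp (\<lambda>x. \<Sum>k\<in>A. f (x + unit_vec k) + f (x + - unit_vec k))" for A
    by (induction A rule: finite_induct) (auto intro!: fin_supp_add fin_supp_shift[OF f] simp del: add_uminus_conv_diff)
  then show ?thesis unfolding walk_def[abs_def] using f by (intro fin_supp_add fin_supp_cmult) auto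
qed

lemma fin_supp_walk_pow: "fin_supp f \<Longrightarrow> fin_supp ((walk ^^ k) f)"
  by (induction k) (auto intro: fin_supp_walk)

definition walk_grad :: "'n::finite \<Rightarrow> nat \<Rightarrow> int ^ 'n \<Rightarrow> real" where
  "walk_grad i k = forward i ((walk ^^ k) delta0)"

text \<open>For the pointwise bound the walk is cut into two halves, each of which absorbs one
  difference at the price of order k^(-1/2). The second difference is then of order 1/k in l^1, and
  one difference is traded for the supremum by \<open>sup_le_l1_forward\<close>.\<close>

lemma walk_grad_bounds:
  defines "C \<equiv> 2 * sqrt (6 * real CARD('n::finite))"
  shows "l1_le (walk_grad i k) (C / sqrt (real k + 1))"
    "\<bar>walk_grad (i :: 'n) k x\<bar> \<le> 2 * C\<^sup>2 / (real k + 1)"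
proof -
  show "l1_le (walk_grad i k) (C / sqrt (real k + 1))"
    using l1_le_forward_walk[OF l1_le_delta0, of i k] by (simp add: walk_grad_def C_def)
  define k1 k2 where "k1 = k div 2" "k2 = k - k div 2"
  have k: "k = k1 + k2" by (simp add: k1_k2_def)
  have C0: "0 \<le> C" by (simp add: C_def)
  have fs: "fin_supp (delta0 :: int ^ 'n \<Rightarrow> real)" by (simp add: delta0_def)
  have "l1_le (forward i ((walk ^^ k2) delta0)) (C / sqrt (real k2 + 1))"
    using l1_le_forward_walk[OF l1_le_delta0, of i k2] by (simp add: C_def)
  then have "l1_le (forward i ((walk ^^ k1) (forward i ((walk ^^ k2) delta0))))
      (C / sqrt (real k1 + 1) * (C / sqrt (real k2 + 1)))"
    unfolding C_def by (rule l1_le_forward_walk)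
  moreover have "(walk ^^ k1) (forward i ((walk ^^ k2) delta0)) = walk_grad i k"
    by (simp add: walk_pow_forward walk_grad_def k funpow_add)
  ultimately have "\<bar>walk_grad i k x\<bar> \<le> C / sqrt (real k1 + 1) * (C / sqrt (real k2 + 1))"
    using fs by (intro sup_le_l1_forward[where i = i])
      (auto simp: walk_grad_def intro!: fin_supp_forward fin_supp_walk_pow)
  also have "\<dots> \<le> C / sqrt ((real k + 1) / 2) * (C / sqrt ((real k + 1) / 2))"
  proof -
    have "k + 1 \<le> 2 * (k1 + 1)" "k + 1 \<le> 2 * (k2 + 1)" unfolding k1_k2_def by presburger+
    then have "real (k + 1) \<le> real (2 * (k1 + 1))" "real (k + 1) \<le> real (2 * (k2 + 1))"
      by (simp_all only: of_nat_le_iff)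
    then have "(real k + 1) / 2 \<le> real k1 + 1" "(real k + 1) / 2 \<le> real k2 + 1" by simp_all
    then show ?thesis using C0 by (intro mult_mono divide_left_mono mult_pos_pos) auto
  qed
  also have "\<dots> = C * C / (sqrt ((real k + 1) / 2) * sqrt ((real k + 1) / 2))" by simp
  also have "\<dots> = 2 * C\<^sup>2 / (real k + 1)" by (simp add: power2_eq_square del: real_sqrt_divide)
  finally show "\<bar>walk_grad i k x\<bar> \<le> 2 * C\<^sup>2 / (real k + 1)" .
qed

section \<open>Summability of the Riesz kernels\<close>

text \<open>Jensen's inequality for the power \<open>q\<close> with unnormalised weights, obtained
  by summing the tangent inequality at the weighted mean.\<close>

lemma sum_powr_le_weighted:
  fixes w z :: "'a \<Rightarrow> real"
  assumes q: "1 < q" and J: "finite J" "\<And>j. j \<in> J \<Longrightarrow> 0 < w j" "\<And>j. j \<in> J \<Longrightarrow> 0 \<le> z j"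
  shows "(\<Sum>j\<in>J. w j * z j) powr q \<le> (\<Sum>j\<in>J. w j) powr (q - 1) * (\<Sum>j\<in>J. w j * z j powr q)"
proof (cases "J = {}")
  case False
  define W where "W = (\<Sum>j\<in>J. w j)"
  have W: "0 < W" unfolding W_def using J False by (intro sum_pos) auto
  define Z where "Z = (\<Sum>j\<in>J. w j * z j)"
  have Z: "0 \<le> Z" unfolding Z_def by (intro sum_nonneg mult_nonneg_nonneg) (use J in \<open>auto intro: less_imp_le\<close>)
  define t where "t = Z / W"
  have t: "0 \<le> t" using W Z by (simp add: t_def)
  have tt: "t powr (q - 1) * t = t powr q" using t powr_add[of t "q - 1" 1] by (cases "t = 0") auto
  have "W * t powr q = (\<Sum>j\<in>J. w j * ((1 - q) * t powr q + q * t powr (q - 1) * z j))"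
  proof -
    have "(\<Sum>j\<in>J. w j * ((1 - q) * t powr q + q * t powr (q - 1) * z j))
        = (\<Sum>j\<in>J. (1 - q) * t powr q * w j + q * t powr (q - 1) * (w j * z j))"
      by (intro sum.cong refl) (simp add: algebra_simps)
    also have "\<dots> = (1 - q) * t powr q * W + q * t powr (q - 1) * Z"
      by (simp only: sum.distrib sum_distrib_left W_def Z_def)
    also have "Z = W * t" using W by (simp add: t_def)
    also have "(1 - q) * t powr q * W + q * t powr (q - 1) * (W * t)
        = (1 - q) * t powr q * W + q * W * (t powr (q - 1) * t)" by simp
    also have "\<dots> = W * t powr q" unfolding tt by (simp add: algebra_simps)
    finally show ?thesis by simp
  qed
  also have "\<dots> \<le> (\<Sum>j\<in>J. w j * z j powr q)"
  proof (intro sum_mono mult_left_mono)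
    fix j assume j: "j \<in> J"
    have "(1 - q) * \<bar>t\<bar> powr q + q * (sgn t * \<bar>t\<bar> powr (q - 1)) * z j \<le> \<bar>z j\<bar> powr q"
      by (rule powr_tangent[OF q])
    then show "(1 - q) * t powr q + q * t powr (q - 1) * z j \<le> z j powr q"
      using t J(3)[OF j] by (cases "t = 0") auto
    show "0 \<le> w j" using J(2)[OF j] by simp
  qed
  finally have "W powr (q - 1) * (W * t powr q) \<le> W powr (q - 1) * (\<Sum>j\<in>J. w j * z j powr q)"
    by (intro mult_left_mono) auto
  moreover have "W powr (q - 1) * (W * t powr q) = Z powr q"
  proof -
    have "W powr (q - 1) * W = W powr q" using W powr_add[of W "q - 1" 1] by simp
    then have "W powr (q - 1) * (W * t powr q) = W powr q * t powr q" by (metis mult.assoc)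
    also have "\<dots> = (W * t) powr q" by (simp add: powr_mult)
    also have "W * t = Z" using W by (simp add: t_def)
    finally show ?thesis .
  qed
  ultimately show ?thesis by (simp add: W_def Z_def)
qed simp

lemma summable_Suc_powr: "s < -1 \<Longrightarrow> summable (\<lambda>k. (real k + 1) powr s)"
  using summable_Suc_iff[of "\<lambda>k. real k powr s"] summable_real_powr_iff[of s]
  by (simp add: add.commute)

text \<open>The weights (k + 1)^(-1/2) dominate the binomial coefficients of (1 - \<lambda>)^(-1/2),
  so this is one envelope for all partial sums of the series of R_i^+.\<close>

definition riesz_majorant :: "'n::finite \<Rightarrow> int ^ 'n \<Rightarrow> real" where
  "riesz_majorant i x = (\<Sum>k. (real k + 1) powr (- 1 / 2) * \<bar>walk_grad i k x\<bar>)"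

lemma riesz_majorant_summable:
  "summable (\<lambda>k. (real k + 1) powr (- 1 / 2) * \<bar>walk_grad (i :: 'n::finite) k x\<bar>)"
proof (rule summable_comparison_test)
  let ?C = "2 * sqrt (6 * real CARD('n))"
  show "summable (\<lambda>k. 2 * ?C\<^sup>2 * (real k + 1) powr (- 3 / 2))"
    by (intro summable_mult summable_Suc_powr) simp
  show "\<exists>N. \<forall>k\<ge>N. norm ((real k + 1) powr (- 1 / 2) * \<bar>walk_grad i k x\<bar>)
      \<le> 2 * ?C\<^sup>2 * (real k + 1) powr (- 3 / 2)"
  proof (intro exI allI impI)
    fix k :: nat
    have "(real k + 1) powr (- 1 / 2) * \<bar>walk_grad i k x\<bar>
        \<le> (real k + 1) powr (- 1 / 2) * (2 * ?C\<^sup>2 / (real k + 1))"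
      using walk_grad_bounds(2) by (intro mult_left_mono) auto
    also have "\<dots> = 2 * ?C\<^sup>2 * ((real k + 1) powr (- 1 / 2) * (real k + 1) powr (- 1))"
      by (simp add: powr_minus_divide)
    also have "(real k + 1) powr (- 1 / 2) * (real k + 1) powr (- 1) = (real k + 1) powr (- 3 / 2)"
      by (simp only: powr_add[symmetric]) simp
    finally show "norm ((real k + 1) powr (- 1 / 2) * \<bar>walk_grad i k x\<bar>)
      \<le> 2 * ?C\<^sup>2 * (real k + 1) powr (- 3 / 2)" by (simp add: abs_mult)
  qed
qed

lemma riesz_majorant_nonneg: "0 \<le> riesz_majorant i x"
  unfolding riesz_majorant_def by (intro suminf_nonneg riesz_majorant_summable) auto

lemma riesz_majorant_lp:
  assumes q: "1 < q"
  shows "riesz_majorant (i :: 'n::finite) \<in> lp q"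
proof -
  define C where "C = 2 * sqrt (6 * real CARD('n))"
  have C: "0 < C" by (simp add: C_def)
  define u where "u k x = \<bar>walk_grad i k x\<bar>" for k x
  \<comment> \<open>The weight k^(-1/2) is split into a summable \<open>w\<close> and a growing
    factor k^(3/4), so that Jensen's inequality applies with total weight \<open>W\<close>.
    Interpolating the l^1 and supremum bounds gives k^(-(q - 1) - 1/2) for the q-th powers, and the
    exponents add up to -q/4 - 3/4. This is below -1 precisely for q > 1.\<close>
  define w where "w k = (real k + 1) powr (- 5 / 4)" for k :: nat
  define z where "z k x = (real k + 1) powr (3 / 4) * u k x" for k x
  have w0: "0 < w k" for k by (simp add: w_def)
  have wz: "w k * z k x = (real k + 1) powr (- 1 / 2) * u k x" for k x
    by (simp add: w_def z_def mult.assoc[symmetric] powr_add[symmetric])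
  define W where "W = (\<Sum>k. w k)"
  have sw: "summable w" unfolding w_def by (intro summable_Suc_powr) simp
  define D where "D = (2 * C\<^sup>2) powr (q - 1) * C"
  have D: "0 \<le> D" using C by (simp add: D_def)
  define v where "v k = D * (real k + 1) powr (- q / 4 - 3 / 4)" for k :: nat
  have sv: "summable v" unfolding v_def using q by (intro summable_mult summable_Suc_powr) simp
  have uq: "(\<Sum>x\<in>F. w k * z k x powr q) \<le> v k" if F: "finite F" for F k
  proof -
    let ?k = "real k + 1"
    have "u k x powr q \<le> (2 * C\<^sup>2 / ?k) powr (q - 1) * u k x" for x
    proof -
      have "u k x powr q = u k x powr (q - 1) * u k x"
        using powr_add[of "u k x" "q - 1" 1] by (cases "u k x = 0") (auto simp: u_def)
      also have "\<dots> \<le> (2 * C\<^sup>2 / ?k) powr (q - 1) * u k x"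
        using q walk_grad_bounds(2)[of i k x]
        by (intro mult_right_mono powr_mono2) (auto simp: u_def C_def)
      finally show ?thesis .
    qed
    then have "(\<Sum>x\<in>F. u k x powr q) \<le> (\<Sum>x\<in>F. (2 * C\<^sup>2 / ?k) powr (q - 1) * u k x)"
      by (intro sum_mono)
    also have "\<dots> \<le> (2 * C\<^sup>2 / ?k) powr (q - 1) * (C / sqrt ?k)"
      unfolding sum_distrib_left[symmetric] u_def C_def
      by (intro mult_left_mono l1_leD[OF walk_grad_bounds(1)] F) auto
    also have "\<dots> = D * (?k powr (- (q - 1)) * ?k powr (- 1 / 2))"
    proof -
      have 1: "(2 * C\<^sup>2 / ?k) powr (q - 1) = (2 * C\<^sup>2) powr (q - 1) * ?k powr (- (q - 1))"
        unfolding powr_minus_divide by (simp add: powr_divide)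
      have 2: "C / sqrt ?k = C * ?k powr (- 1 / 2)"
        by (simp add: powr_half_sqrt[symmetric] powr_minus_divide)
      show ?thesis unfolding 1 2 by (simp add: D_def)
    qed
    finally have 3: "(\<Sum>x\<in>F. u k x powr q) \<le> D * (?k powr (- (q - 1)) * ?k powr (- 1 / 2))" .
    have "(\<Sum>x\<in>F. w k * z k x powr q) = w k * ?k powr (3 / 4 * q) * (\<Sum>x\<in>F. u k x powr q)"
      by (simp add: z_def powr_mult powr_powr sum_distrib_left sum_distrib_right mult_ac)
    also have "\<dots> \<le> w k * ?k powr (3 / 4 * q) * (D * (?k powr (- (q - 1)) * ?k powr (- 1 / 2)))"
      using 3 w0[of k] by (intro mult_left_mono) auto
    also have "\<dots> = D * (?k powr (- 5 / 4) * ?k powr (3 / 4 * q) * (?k powr (- (q - 1)) * ?k powr (- 1 / 2)))"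
      by (simp add: w_def mult_ac)
    also have "?k powr (- 5 / 4) * ?k powr (3 / 4 * q) * (?k powr (- (q - 1)) * ?k powr (- 1 / 2))
        = ?k powr (- q / 4 - 3 / 4)"
    proof -
      have e: "- 5 / 4 + 3 / 4 * q + (- (q - 1) + - 1 / 2) = - q / 4 - 3 / 4" by (simp add: field_simps)
      show ?thesis unfolding powr_add[symmetric] e ..
    qed
    finally show ?thesis by (simp add: v_def)
  qed
  define b where "b = W powr (q - 1) * (\<Sum>k. v k)"
  have partial: "(\<Sum>x\<in>F. (\<Sum>k<n. w k * z k x) powr q) \<le> b" if F: "finite F" for F n
  proof -
    have "(\<Sum>x\<in>F. (\<Sum>k<n. w k * z k x) powr q)
        \<le> (\<Sum>x\<in>F. (\<Sum>k<n. w k) powr (q - 1) * (\<Sum>k<n. w k * z k x powr q))"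
      by (intro sum_mono sum_powr_le_weighted q) (auto simp: w0 z_def u_def)
    also have "\<dots> = (\<Sum>k<n. w k) powr (q - 1) * (\<Sum>x\<in>F. \<Sum>k<n. w k * z k x powr q)"
      by (rule sum_distrib_left[symmetric])
    also have "(\<Sum>x\<in>F. \<Sum>k<n. w k * z k x powr q) = (\<Sum>k<n. \<Sum>x\<in>F. w k * z k x powr q)"
      by (rule sum.swap)
    also have "(\<Sum>k<n. w k) powr (q - 1) * (\<Sum>k<n. \<Sum>x\<in>F. w k * z k x powr q) \<le> W powr (q - 1) * (\<Sum>k. v k)"
    proof (intro mult_mono powr_mono2)
      show "(\<Sum>k<n. w k) \<le> W" unfolding W_def using w0 by (intro sum_le_suminf sw) (auto intro: less_imp_le)
      have "(\<Sum>k<n. \<Sum>x\<in>F. w k * z k x powr q) \<le> (\<Sum>k<n. v k)" using F by (intro sum_mono uq)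
      also have "\<dots> \<le> (\<Sum>k. v k)" using D by (intro sum_le_suminf sv) (auto simp: v_def)
      finally show "(\<Sum>k<n. \<Sum>x\<in>F. w k * z k x powr q) \<le> (\<Sum>k. v k)" .
      show "0 \<le> (\<Sum>k<n. w k)" using w0 by (intro sum_nonneg) (auto intro: less_imp_le)
      show "0 \<le> (\<Sum>k<n. \<Sum>x\<in>F. w k * z k x powr q)" using w0 by (intro sum_nonneg mult_nonneg_nonneg) (auto intro: less_imp_le)
    qed (use q in auto)
    finally show ?thesis by (simp add: b_def)
  qed
  have "(\<Sum>x\<in>F. \<bar>riesz_majorant i x\<bar> powr q) \<le> b" if F: "finite F" for F
  proof (rule tendsto_upperbound)
    have "(\<lambda>n. \<Sum>k<n. w k * z k x) \<longlonglongrightarrow> riesz_majorant i x" for x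
      unfolding riesz_majorant_def wz u_def by (intro summable_LIMSEQ riesz_majorant_summable)
    then show "(\<lambda>n. \<Sum>x\<in>F. (\<Sum>k<n. w k * z k x) powr q) \<longlonglongrightarrow> (\<Sum>x\<in>F. \<bar>riesz_majorant i x\<bar> powr q)"
      unfolding abs_of_nonneg[OF riesz_majorant_nonneg] using q w0
      by (intro tendsto_sum tendsto_powr2 tendsto_const)
         (auto intro!: always_eventually sum_nonneg simp: z_def u_def less_imp_le)
    show "\<forall>\<^sub>F n in sequentially. (\<Sum>x\<in>F. (\<Sum>k<n. w k * z k x) powr q) \<le> b"
      using partial[OF F] by (intro always_eventually) auto
  qed simp
  then show ?thesis
    unfolding lp_def by (auto intro!: nonneg_bdd_above_summable_on bdd_aboveI2)
qed

section \<open>Symbols with summable kernels\<close>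

text \<open>Symbols that are bounded pointwise limits of trigonometric polynomials whose
  coefficients share an envelope lying in every l^q with q > 1. The Riesz symbols are discontinuous
  at the origin, so an envelope in l^1 is out of reach.\<close>

definition good_symbol :: "(real ^ 'n::finite \<Rightarrow> complex) \<Rightarrow> bool" where
  "good_symbol m \<longleftrightarrow> (\<exists>k K B.
     (\<forall>n. fin_supp (k n)) \<and> (\<forall>n x. \<bar>k n x\<bar> \<le> K x) \<and> (\<forall>q>1. K \<in> lp q) \<and>
     (\<forall>\<theta>. (\<lambda>n. fourier (k n) \<theta>) \<longlonglongrightarrow> m \<theta>) \<and> (\<forall>n \<theta>. norm (fourier (k n) \<theta>) \<le> B))"

definition inv_sqrt_coeff :: "nat \<Rightarrow> real" where
  "inv_sqrt_coeff k = ((- 1 / 2) gchoose k) * (- 1) ^ k"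

lemma inv_sqrt_coeff_Suc:
  "inv_sqrt_coeff (Suc k) = inv_sqrt_coeff k * ((2 * real k + 1) / (2 * real k + 2))"
proof -
  have "real (Suc k) * ((- 1 / 2 :: real) gchoose Suc k) = (- 1 / 2 - real k) * ((- 1 / 2) gchoose k)"
    using gbinomial_absorb_comp[of "- 1 / 2 :: real" k] gbinomial_absorption'[of "Suc k" "- 1 / 2 :: real"]
      gbinomial_mult_1[of "- 1 / 2 :: real" k] by (simp add: algebra_simps)
  then have G: "((- 1 / 2 :: real) gchoose Suc k) = (- 1 / 2 - real k) * ((- 1 / 2) gchoose k) / real (Suc k)"
    by (simp add: field_simps)
  show ?thesis unfolding inv_sqrt_coeff_def G by (simp add: field_simps)
qed

lemma inv_sqrt_coeff_bounds: "0 < inv_sqrt_coeff k" "inv_sqrt_coeff k \<le> (real k + 1) powr (- 1 / 2)"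
proof -
  \<comment> \<open>The coefficients are C(2k, k) / 4^k. The invariant is b_k^2 (2 k + 1) \<le> 1,
    preserved because s (s + 2) \<le> (s + 1)^2.\<close>
  have *: "0 < inv_sqrt_coeff k \<and> (inv_sqrt_coeff k)\<^sup>2 * (2 * real k + 1) \<le> 1"
  proof (induction k)
    case 0
    then show ?case by (simp add: inv_sqrt_coeff_def)
  next
    case (Suc k)
    let ?b = "inv_sqrt_coeff k"
    define s where "s = 2 * real k + 1"
    have s: "1 \<le> s" by (simp add: s_def)
    have e: "2 * real (Suc k) + 1 = s + 2" "2 * real k + 1 = s" "2 * real k + 2 = s + 1"
      by (simp_all add: s_def)
    have "(inv_sqrt_coeff (Suc k))\<^sup>2 * (2 * real (Suc k) + 1) = (?b\<^sup>2 * s) * (s * (s + 2) / (s + 1)\<^sup>2)"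
      unfolding inv_sqrt_coeff_Suc e by (simp add: power_mult_distrib power_divide power2_eq_square)
    also have "\<dots> \<le> 1 * 1"
    proof (rule mult_mono)
      have "s * (s + 2) \<le> (s + 1)\<^sup>2" by (simp add: power2_eq_square algebra_simps)
      then show "s * (s + 2) / (s + 1)\<^sup>2 \<le> 1" using s by (intro divide_le_eq_1_pos[THEN iffD2]) auto
      show "?b\<^sup>2 * s \<le> 1" using Suc by (simp add: s_def)
    qed (use s in auto)
    finally show ?case using Suc by (simp add: inv_sqrt_coeff_Suc)
  qed
  then show "0 < inv_sqrt_coeff k" by simp
  have "(inv_sqrt_coeff k)\<^sup>2 * (real k + 1) \<le> (inv_sqrt_coeff k)\<^sup>2 * (2 * real k + 1)"
    by (intro mult_left_mono) auto
  then have "(inv_sqrt_coeff k)\<^sup>2 * (real k + 1) \<le> 1" using * by linarith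
  then have "(inv_sqrt_coeff k)\<^sup>2 \<le> 1 / (real k + 1)" by (simp add: field_simps)
  also have "\<dots> = ((real k + 1) powr (- 1 / 2))\<^sup>2"
    by (simp add: power2_eq_square powr_add[symmetric] powr_minus_divide)
  finally show "inv_sqrt_coeff k \<le> (real k + 1) powr (- 1 / 2)" by (rule power2_le_imp_le) simp
qed

lemma inv_sqrt_coeff_sums:
  assumes "0 \<le> l" "l < 1"
  shows "(\<lambda>k. inv_sqrt_coeff k * l ^ k) sums (1 / sqrt (1 - l))"
proof -
  have "(\<lambda>k. ((- 1 / 2) gchoose k) * (- l) ^ k) sums (1 + - l) powr (- 1 / 2)"
    by (rule gen_binomial_real) (use assms in simp)
  moreover have "(- l) ^ k = (- 1) ^ k * l ^ k" for k by (simp add: power_mult_distrib[symmetric])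
  moreover have "(1 - l) powr (- 1 / 2) = 1 / sqrt (1 - l)"
    using assms by (simp add: powr_half_sqrt[symmetric] powr_minus_divide)
  ultimately show ?thesis by (simp add: inv_sqrt_coeff_def mult.assoc)
qed

definition sym_walk :: "real ^ 'n::finite \<Rightarrow> real" where
  "sym_walk \<theta> = 1 - sym_neg_lap \<theta> / (4 * real CARD('n))"

lemma sym_neg_lap_cos: "sym_neg_lap \<theta> = (\<Sum>k\<in>UNIV. 2 - 2 * cos (\<theta> $ k))"
proof -
  have "4 * (sin (t / 2))\<^sup>2 = 2 - 2 * cos t" for t :: real using cos_double_sin[of "t / 2"] by simp
  then show ?thesis by (simp add: sym_neg_lap_def sum_distrib_left)
qed

lemma sym_neg_lap_bounds: "0 \<le> sym_neg_lap \<theta>" "sym_neg_lap \<theta> \<le> 4 * real CARD('n)"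
  for \<theta> :: "real ^ 'n::finite"
proof -
  show "0 \<le> sym_neg_lap \<theta>" by (simp add: sym_neg_lap_def sum_nonneg)
  have "(\<Sum>k\<in>(UNIV :: 'n set). (sin (\<theta> $ k / 2))\<^sup>2) \<le> (\<Sum>k\<in>(UNIV :: 'n set). 1)"
    by (intro sum_mono) (simp add: abs_square_le_1)
  then show "sym_neg_lap \<theta> \<le> 4 * real CARD('n)" by (simp add: sym_neg_lap_def)
qed

lemma has_symbol_walk: "has_symbol walk (\<lambda>\<theta> :: real ^ 'n::finite. of_real (sym_walk \<theta>))"
proof (rule has_symbol_cong)
  show "has_symbol (\<lambda>f x. 1 / 2 * f x +
     1 / (4 * real CARD('n)) * (\<Sum>k\<in>UNIV. f (x + unit_vec k) + f (x + - unit_vec k)))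
    (\<lambda>\<theta> :: real ^ 'n. of_real (1 / 2) * 1 + of_real (1 / (4 * real CARD('n))) *
       (\<Sum>k\<in>UNIV. char_at \<theta> (unit_vec k) + char_at \<theta> (- unit_vec k)))"
    by (intro has_symbol_add has_symbol_cmult has_symbol_sum has_symbol_shift has_symbol_id) auto
  fix \<theta> :: "real ^ 'n"
  define N where "N = real CARD('n)"
  have N: "0 < N" by (simp add: N_def)
  have "(\<Sum>k\<in>UNIV. char_at \<theta> (unit_vec k) + char_at \<theta> (- unit_vec k)) = of_real (\<Sum>k\<in>UNIV. 2 * cos (\<theta> $ k))"
    by (simp add: char_at_axis cis_add_cis_minus)
  moreover have "1 / 2 + 1 / (4 * N) * (\<Sum>k\<in>UNIV. 2 * cos (\<theta> $ k)) = sym_walk \<theta>"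
  proof -
    have "sym_neg_lap \<theta> = 2 * N - (\<Sum>k\<in>UNIV. 2 * cos (\<theta> $ k))"
      by (simp add: sym_neg_lap_cos sum_subtractf N_def)
    then show ?thesis using N by (simp add: sym_walk_def N_def[symmetric] field_simps)
  qed
  ultimately show "of_real (1 / 2) * 1 + of_real (1 / (4 * real CARD('n))) *
       (\<Sum>k\<in>UNIV. char_at \<theta> (unit_vec k) + char_at \<theta> (- unit_vec k)) = complex_of_real (sym_walk \<theta>)"
    by (simp only: of_real_mult[symmetric] of_real_add[symmetric] mult_1_right N_def)
qed (simp add: walk_def)

lemma has_symbol_walk_pow: "has_symbol (walk ^^ k) (\<lambda>\<theta>. of_real (sym_walk \<theta> ^ k))"
proof (induction k)
  case 0
  then show ?case using has_symbol_id by (simp add: id_def)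
next
  case (Suc k)
  show ?case by (rule has_symbol_cong[OF has_symbol_comp[OF has_symbol_walk Suc]]) simp_all
qed

lemma has_symbol_forward: "has_symbol (forward i) (sym_plus i)"
  by (rule has_symbol_cong[OF has_symbol_diff[OF has_symbol_shift[of "unit_vec i"] has_symbol_id]])
     (simp_all add: forward_def sym_plus_def char_at_axis)

lemma fourier_delta0: "fourier delta0 \<theta> = 1"
proof -
  have "fourier delta0 \<theta> = (\<Sum>y\<in>{0}. of_real (delta0 y) * cnj (char_at \<theta> y))"
    by (rule fourier_superset) (auto simp: delta0_def split: if_splits)
  then show ?thesis by (simp add: delta0_def)
qed

lemma norm_sym_plus_le: "norm (sym_plus i \<theta>) \<le> sqrt (sym_neg_lap \<theta>)"
proof (rule real_le_rsqrt)
  have "(norm (sym_plus i \<theta>))\<^sup>2 = (cos (\<theta> $ i) - 1)\<^sup>2 + (sin (\<theta> $ i))\<^sup>2"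
    by (simp add: sym_plus_def cmod_power2)
  also have "\<dots> = 2 - 2 * cos (\<theta> $ i)"
    using sin_cos_squared_add[of "\<theta> $ i"] by (simp add: power2_eq_square algebra_simps)
  also have "\<dots> \<le> sym_neg_lap \<theta>"
    unfolding sym_neg_lap_cos by (rule member_le_sum[where f = "\<lambda>k. 2 - 2 * cos (\<theta> $ k)"]) auto
  finally show "(norm (sym_plus i \<theta>))\<^sup>2 \<le> sym_neg_lap \<theta>" .
qed

text \<open>The walk satisfies -\<Delta> = 4 N (1 - walk), so R_i^+ is the forward difference
  composed with the binomial series in the walk. Laziness makes the symbol of the walk nonnegative;
  the partial sums therefore increase to their limit, and the Fourier transforms of the partial
  kernels stay bounded by 1.\<close>

lemma good_riesz_plus:
  "good_symbol (\<lambda>\<theta> :: real ^ 'n::finite. sym_plus i \<theta> / of_real (sqrt (sym_neg_lap \<theta>)))"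
proof -
  define c where "c = 1 / (4 * real CARD('n))"
  have c: "0 < c" "c \<le> 1" by (auto simp: c_def Suc_leI field_simps intro: order_trans[of 1 "real CARD('n)"])
  define k where "k n x = (\<Sum>j<n. (sqrt c * inv_sqrt_coeff j) * walk_grad i j x)" for n x
  define T where "T n f x = (\<Sum>j<n. (sqrt c * inv_sqrt_coeff j) * forward i ((walk ^^ j) f) x)" for n f x
  have T: "has_symbol (T n) (\<lambda>\<theta>. \<Sum>j<n. of_real (sqrt c * inv_sqrt_coeff j) * (sym_plus i \<theta> * of_real (sym_walk \<theta> ^ j)))" for n
    unfolding T_def[abs_def]
    by (intro has_symbol_sum has_symbol_cmult has_symbol_comp[OF has_symbol_forward has_symbol_walk_pow]) auto
  have kT: "k n = T n delta0" for n by (simp add: k_def[abs_def] T_def[abs_def] walk_grad_def)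
  have fs: "fin_supp (delta0 :: int ^ 'n \<Rightarrow> real)" by (simp add: delta0_def)
  have F: "fourier (k n) \<theta> = sym_plus i \<theta> * of_real (sqrt c * (\<Sum>j<n. inv_sqrt_coeff j * sym_walk \<theta> ^ j))" for n \<theta>
    unfolding kT using has_symbolD(2)[OF T fs, of n \<theta>]
    by (simp add: fourier_delta0 sum_distrib_left mult_ac)
  have rel: "1 - sym_walk \<theta> = c * sym_neg_lap \<theta>" for \<theta> :: "real ^ 'n" by (simp add: sym_walk_def c_def)
  have lim: "(\<lambda>n. fourier (k n) \<theta>) \<longlonglongrightarrow> sym_plus i \<theta> / of_real (sqrt (sym_neg_lap \<theta>)) \<and>
      norm (fourier (k n) \<theta>) \<le> 1" for \<theta> n
  proof (cases "sym_neg_lap \<theta> = 0")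
    case True
    then have "sym_plus i \<theta> = 0" using norm_sym_plus_le[of i \<theta>] by simp
    then show ?thesis by (simp add: F)
  next
    case False
    then have pos: "0 < sym_neg_lap \<theta>" using sym_neg_lap_bounds(1)[of \<theta>] by simp
    have l: "0 \<le> sym_walk \<theta>" "sym_walk \<theta> < 1"
      using sym_neg_lap_bounds(2)[of \<theta>] pos by (auto simp: sym_walk_def field_simps)
    have S: "(\<lambda>j. inv_sqrt_coeff j * sym_walk \<theta> ^ j) sums (1 / sqrt (c * sym_neg_lap \<theta>))"
      using inv_sqrt_coeff_sums[OF l] by (simp only: rel)
    then have "(\<lambda>n. sym_plus i \<theta> * of_real (sqrt c * (\<Sum>j<n. inv_sqrt_coeff j * sym_walk \<theta> ^ j)))
        \<longlonglongrightarrow> sym_plus i \<theta> * of_real (sqrt c * (1 / sqrt (c * sym_neg_lap \<theta>)))"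
      unfolding sums_def by (intro tendsto_intros)
    moreover have e: "sqrt c * (1 / sqrt (c * sym_neg_lap \<theta>)) = 1 / sqrt (sym_neg_lap \<theta>)"
      using c by (simp add: real_sqrt_mult)
    ultimately have L: "(\<lambda>n. fourier (k n) \<theta>) \<longlonglongrightarrow> sym_plus i \<theta> / of_real (sqrt (sym_neg_lap \<theta>))"
      unfolding F e by (simp add: field_simps)
    have "(\<Sum>j<n. inv_sqrt_coeff j * sym_walk \<theta> ^ j) \<le> 1 / sqrt (c * sym_neg_lap \<theta>)"
      using S l inv_sqrt_coeff_bounds(1)
      by (metis (no_types, lifting) less_imp_le mult_nonneg_nonneg sum_le_suminf sums_summable sums_unique zero_le_power finite_lessThan)
    then have "sqrt c * (\<Sum>j<n. inv_sqrt_coeff j * sym_walk \<theta> ^ j) \<le> sqrt c * (1 / sqrt (c * sym_neg_lap \<theta>))"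
      using c by (intro mult_left_mono) auto
    then have "sqrt c * (\<Sum>j<n. inv_sqrt_coeff j * sym_walk \<theta> ^ j) \<le> 1 / sqrt (sym_neg_lap \<theta>)"
      unfolding e .
    moreover have "0 \<le> sqrt c * (\<Sum>j<n. inv_sqrt_coeff j * sym_walk \<theta> ^ j)"
      using c l inv_sqrt_coeff_bounds(1) by (intro mult_nonneg_nonneg sum_nonneg) (auto simp: less_imp_le)
    ultimately have "norm (fourier (k n) \<theta>) \<le> sqrt (sym_neg_lap \<theta>) * (1 / sqrt (sym_neg_lap \<theta>))"
      unfolding F norm_mult norm_of_real
      using norm_sym_plus_le[of i \<theta>] sym_neg_lap_bounds(1)[of \<theta>] by (intro mult_mono) auto
    then show ?thesis using L pos by simp
  qed
  have "\<bar>k n x\<bar> \<le> riesz_majorant i x" for n x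
  proof -
    have "\<bar>k n x\<bar> \<le> (\<Sum>j<n. \<bar>(sqrt c * inv_sqrt_coeff j) * walk_grad i j x\<bar>)"
      unfolding k_def by (rule sum_abs)
    also have "\<dots> \<le> (\<Sum>j<n. (real j + 1) powr (- 1 / 2) * \<bar>walk_grad i j x\<bar>)"
    proof (rule sum_mono)
      fix j
      have "sqrt c * inv_sqrt_coeff j \<le> 1 * (real j + 1) powr (- 1 / 2)"
        using c inv_sqrt_coeff_bounds[of j] by (intro mult_mono) auto
      then show "\<bar>(sqrt c * inv_sqrt_coeff j) * walk_grad i j x\<bar> \<le> (real j + 1) powr (- 1 / 2) * \<bar>walk_grad i j x\<bar>"
        using c inv_sqrt_coeff_bounds(1)[of j] by (simp add: abs_mult mult_right_mono)
    qed
    also have "\<dots> \<le> riesz_majorant i x"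
      unfolding riesz_majorant_def by (intro sum_le_suminf riesz_majorant_summable) auto
    finally show ?thesis .
  qed
  moreover have "fin_supp (k n)" for n unfolding kT by (rule has_symbolD(1)[OF T fs])
  ultimately show ?thesis
    unfolding good_symbol_def using lim riesz_majorant_lp
    by (intro exI[of _ k] exI[of _ "riesz_majorant i"] exI[of _ 1]) auto
qed

section \<open>Iterated multipliers as convolutions on the whole of l^p\<close>

section \<open>Multipliers on the whole sequence space\<close>

lemma summable_on_dominated:
  fixes f g :: "'a \<Rightarrow> real"
  assumes "g summable_on A" "\<And>x. x \<in> A \<Longrightarrow> \<bar>f x\<bar> \<le> g x"
  shows "f summable_on A"
proof (rule abs_summable_summable)
  show "(\<lambda>x. norm (f x)) summable_on A"
    by (rule Infinite_Sum.abs_summable_on_comparison_test'[OF assms(1)]) (use assms(2) in simp)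
qed

lemma infsum_dominated_convergence:
  fixes f :: "nat \<Rightarrow> 'a \<Rightarrow> real"
  assumes h: "h summable_on UNIV" and bound: "\<And>n x. \<bar>f n x\<bar> \<le> h x"
    and lim: "\<And>x. (\<lambda>n. f n x) \<longlonglongrightarrow> g x"
  shows "(\<lambda>n. infsum (f n) UNIV) \<longlonglongrightarrow> infsum g UNIV"
proof (rule LIMSEQ_I)
  fix e :: real assume e: "0 < e"
  have gb: "\<bar>g x\<bar> \<le> h x" for x
    by (rule tendsto_upperbound[OF tendsto_rabs[OF lim]]) (use bound in auto)
  obtain F where F: "finite F" "\<bar>sum h F - infsum h UNIV\<bar> \<le> e / 4"
    using infsum_finite_approximation[OF h, of "e / 4"] e by (auto simp: dist_real_def)
  have tail: "\<bar>infsum u UNIV - sum u F\<bar> \<le> e / 4" if u: "\<And>x. \<bar>u x\<bar> \<le> h x" for u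
  proof -
    have us: "u summable_on UNIV" using h u by (rule summable_on_dominated)
    have "infsum u UNIV - sum u F = infsum u (UNIV - F)"
      using infsum_Diff[OF us, of F] F by simp
    also have "\<bar>\<dots>\<bar> \<le> infsum h (UNIV - F)"
    proof -
      have s: "h summable_on (UNIV - F)" "u summable_on (UNIV - F)"
        using h us by (auto intro: summable_on_subset_banach)
      have "infsum u (UNIV - F) \<le> infsum h (UNIV - F)" using s u by (intro infsum_mono) (auto simp: abs_le_iff)
      moreover have "(\<lambda>x. - 1 * h x) summable_on (UNIV - F)" by (rule summable_on_cmult_right[OF s(1)])
      then have "infsum (\<lambda>x. - h x) (UNIV - F) \<le> infsum u (UNIV - F)"
        using s u by (intro infsum_mono) (auto simp: abs_le_iff minus_le_iff)
      ultimately show ?thesis by (simp add: infsum_uminus abs_le_iff)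
    qed
    also have "\<dots> = infsum h UNIV - sum h F" using infsum_Diff[OF h, of F] F by simp
    also have "\<dots> \<le> e / 4" using F by linarith
    finally show ?thesis .
  qed
  have "(\<lambda>n. sum (f n) F) \<longlonglongrightarrow> sum g F" by (intro tendsto_sum lim)
  then obtain N where N: "\<And>n. N \<le> n \<Longrightarrow> \<bar>sum (f n) F - sum g F\<bar> < e / 4"
    using LIMSEQ_D[of "\<lambda>n. sum (f n) F" "sum g F" "e / 4"] e by auto
  show "\<exists>N. \<forall>n\<ge>N. norm (infsum (f n) UNIV - infsum g UNIV) < e"
  proof (intro exI allI impI)
    fix n assume "N \<le> n"
    then have "\<bar>sum (f n) F - sum g F\<bar> < e / 4" by (rule N)
    moreover have "\<bar>infsum (f n) UNIV - sum (f n) F\<bar> \<le> e / 4" by (rule tail[OF bound])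
    moreover have "\<bar>infsum g UNIV - sum g F\<bar> \<le> e / 4" by (rule tail[OF gb])
    ultimately show "norm (infsum (f n) UNIV - infsum g UNIV) < e"
      unfolding real_norm_def by linarith
  qed
qed

lemma summable_on_reflect:
  fixes f :: "int ^ 'n::finite \<Rightarrow> real"
  shows "(\<lambda>y. f (x - y)) summable_on UNIV \<longleftrightarrow> f summable_on UNIV"
  by (rule summable_on_reindex_bij_betw) (rule bij_betwI[where g = "\<lambda>y. x - y"], auto)

lemma infsum_reflect:
  fixes f :: "int ^ 'n::finite \<Rightarrow> real"
  shows "(\<Sum>\<^sub>\<infinity>y. f (x - y)) = infsum f UNIV"
  by (rule infsum_reindex_bij_betw) (rule bij_betwI[where g = "\<lambda>y. x - y"], auto)

lemma summable_on_translate: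
  fixes f :: "int ^ 'n::finite \<Rightarrow> real"
  shows "(\<lambda>y. f (y - x)) summable_on UNIV \<longleftrightarrow> f summable_on UNIV"
  by (rule summable_on_reindex_bij_betw) (rule bij_betwI[where g = "\<lambda>y. y + x"], auto)

lemma infsum_translate:
  fixes f :: "int ^ 'n::finite \<Rightarrow> real"
  shows "(\<Sum>\<^sub>\<infinity>y. f (y - x)) = infsum f UNIV"
  by (rule infsum_reindex_bij_betw) (rule bij_betwI[where g = "\<lambda>y. y + x"], auto)

lemma good_symbolE:
  assumes "good_symbol m"
  obtains k K B where "\<And>n. fin_supp (k n)" "\<And>n x. \<bar>k n x\<bar> \<le> K x" "\<And>q. 1 < q \<Longrightarrow> K \<in> lp q"
    "\<And>\<theta>. (\<lambda>n. fourier (k n) \<theta>) \<longlonglongrightarrow> m \<theta>" "\<And>n \<theta>. norm (fourier (k n) \<theta>) \<le> B"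
    "set_integrable lborel torus m" "\<And>x. (\<lambda>n. k n x) \<longlonglongrightarrow> multiplier_kernel m x" "\<And>x. \<bar>multiplier_kernel m x\<bar> \<le> K x"
proof -
  obtain k K B where k: "\<And>n. fin_supp (k n)" "\<And>n x. \<bar>k n x\<bar> \<le> K x" "\<And>q. 1 < q \<Longrightarrow> K \<in> lp q"
    "\<And>\<theta>. (\<lambda>n. fourier (k n) \<theta>) \<longlonglongrightarrow> m \<theta>" "\<And>n \<theta>. norm (fourier (k n) \<theta>) \<le> B"
    using assms unfolding good_symbol_def by blast
  note dct = kernel_dominated_convergence[where \<mu> = "\<lambda>n. fourier (k n)" and B = B, OF continuous_on_fourier k(5) k(4)]
  have lim: "(\<lambda>n. k n x) \<longlonglongrightarrow> multiplier_kernel m x" for x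
    using dct(2)[of x] by (simp add: kernel_fourier[OF k(1)])
  moreover have "\<bar>multiplier_kernel m x\<bar> \<le> K x" for x
    by (rule tendsto_upperbound[OF tendsto_rabs[OF lim]]) (use k(2) in auto)
  ultimately show ?thesis using that[OF k] dct(1) by blast
qed

lemma good_symbol_shift:
  assumes "good_symbol m"
  shows "good_symbol (\<lambda>\<theta>. char_at \<theta> v * m \<theta>)"
proof -
  obtain k K B where k: "\<And>n. fin_supp (k n)" "\<And>n x. \<bar>k n x\<bar> \<le> K x" "\<And>q. 1 < q \<Longrightarrow> K \<in> lp q"
    "\<And>\<theta>. (\<lambda>n. fourier (k n) \<theta>) \<longlonglongrightarrow> m \<theta>" "\<And>n \<theta>. norm (fourier (k n) \<theta>) \<le> B"
    using assms unfolding good_symbol_def by blast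
  have F: "fourier (\<lambda>x. k n (x + v)) \<theta> = char_at \<theta> v * fourier (k n) \<theta>" for n \<theta>
    by (rule has_symbolD(2)[OF has_symbol_shift k(1)])
  have "(\<lambda>x. K (x + v)) \<in> lp q" if "1 < q" for q
    using k(3)[OF that] summable_on_translate[of "\<lambda>x. \<bar>K x\<bar> powr q" "- v"] by (simp add: lp_def)
  then show ?thesis
    unfolding good_symbol_def
    by (intro exI[of _ "\<lambda>n x. k n (x + v)"] exI[of _ "\<lambda>x. K (x + v)"] exI[of _ B])
       (auto simp: F norm_mult k intro!: fin_supp_shift tendsto_intros)
qed

text \<open>On a truncation to \<open>F\<close> the multiplier is the finite sum over
  \<open>F\<close>, so the limit over finite sets in the definition of \<open>multiplier\<close> is
  unconditional summation.\<close>

lemma multiplier_has_sum: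
  assumes m: "set_integrable lborel torus m"
    and s: "(\<lambda>y. f y * multiplier_kernel m (x - y)) summable_on UNIV"
  shows "((\<lambda>y. f y * multiplier_kernel m (x - y)) has_sum multiplier m f x) UNIV"
proof -
  have "((\<lambda>F. multiplier_fin m (restrict0 F f) x) \<longlongrightarrow> (\<Sum>\<^sub>\<infinity>y. f y * multiplier_kernel m (x - y)))
      (finite_subsets_at_top UNIV)"
  proof (rule Lim_transform_eventually)
    show "((\<lambda>F. \<Sum>y\<in>F. f y * multiplier_kernel m (x - y)) \<longlongrightarrow> (\<Sum>\<^sub>\<infinity>y. f y * multiplier_kernel m (x - y)))
      (finite_subsets_at_top UNIV)" by (rule infsum_tendsto[OF s])
    show "\<forall>\<^sub>F F in finite_subsets_at_top UNIV.
        (\<Sum>y\<in>F. f y * multiplier_kernel m (x - y)) = multiplier_fin m (restrict0 F f) x"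
    proof (rule eventually_finite_subsets_at_top_weakI)
      fix F :: "(int ^ 'a) set" assume F: "finite F"
      have "multiplier_fin m (restrict0 F f) x = (\<Sum>y\<in>F. restrict0 F f y * multiplier_kernel m (x - y))"
        by (rule multiplier_fin_kernel[OF m F]) (auto simp: restrict0_def split: if_splits)
      also have "\<dots> = (\<Sum>y\<in>F. f y * multiplier_kernel m (x - y))"
        by (intro sum.cong) (auto simp: restrict0_def)
      finally show "(\<Sum>y\<in>F. f y * multiplier_kernel m (x - y)) = multiplier_fin m (restrict0 F f) x" by simp
    qed
  qed
  then have "multiplier m f x = (\<Sum>\<^sub>\<infinity>y. f y * multiplier_kernel m (x - y))"
    unfolding multiplier_def by (intro tendsto_Lim) auto
  then show ?thesis using s by simp
qed

lemma mult_le_powr_conjugate: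
  fixes a b p :: real
  assumes "1 < p"
  shows "\<bar>a\<bar> * \<bar>b\<bar> \<le> \<bar>a\<bar> powr p + \<bar>b\<bar> powr (p / (p - 1))"
proof -
  have q: "1 < p / (p - 1)" "1 / p + 1 / (p / (p - 1)) = 1" using assms by (auto simp: field_simps)
  have "\<bar>a\<bar> * \<bar>b\<bar> \<le> \<bar>a\<bar> powr p / p + \<bar>b\<bar> powr (p / (p - 1)) / (p / (p - 1))"
    by (rule Youngs_inequality) (use assms q in auto)
  also have "\<dots> \<le> \<bar>a\<bar> powr p / 1 + \<bar>b\<bar> powr (p / (p - 1)) / 1"
    using assms q by (intro add_mono divide_left_mono) auto
  finally show ?thesis by simp
qed

text \<open>
  The exponents \<open>1 - 1/p\<close>, \<open>1/(2p)\<close>, \<open>1/(2p)\<close> turn the product of the three terms on the right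
  into \<open>u v w\<close>; this replaces Young's convolution inequality.
\<close>

lemma triple_product_le:
  fixes u v w p :: real
  assumes p: "1 < p" and nonneg: "0 \<le> u" "0 \<le> v" "0 \<le> w"
  defines "q \<equiv> 2 * p / (2 * p - 1)"
  shows "u * v * w \<le> u powr q * v powr q + u powr q * w powr p + v powr q * w powr p"
proof (cases "u = 0 \<or> v = 0 \<or> w = 0")
  case True
  then show ?thesis by auto
next
  case False
  then have pos: "0 < u" "0 < v" "0 < w" using nonneg by auto
  define a b c where "a = u powr q * v powr q" "b = u powr q * w powr p" "c = v powr q * w powr p"
  define S where "S = a + b + c"
  have abc: "0 < a" "0 < b" "0 < c" using pos by (auto simp: a_b_c_def)
  define e where "e = 1 / (2 * p)"
  have e: "0 < e" "e \<le> 1" "0 < 1 - 2 * e" using p by (auto simp: e_def field_simps)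
  have qe: "q * (1 - e) = 1" "p * (e + e) = 1" using p by (auto simp: q_def e_def field_simps)
  have "u * v * w = a powr (1 - 2 * e) * b powr e * c powr e"
  proof -
    have "a powr (1 - 2 * e) * b powr e * c powr e
        = (u powr (q * (1 - 2 * e)) * u powr (q * e)) * (v powr (q * (1 - 2 * e)) * v powr (q * e))
          * (w powr (p * e) * w powr (p * e))"
      by (simp add: a_b_c_def powr_mult powr_powr mult_ac)
    also have "\<dots> = u powr (q * (1 - e)) * v powr (q * (1 - e)) * w powr (p * (e + e))"
      unfolding powr_add[symmetric] by (simp add: algebra_simps)
    also have "\<dots> = u * v * w" unfolding qe using pos by simp
    finally show ?thesis by simp
  qed
  also have "\<dots> \<le> S powr (1 - 2 * e) * S powr e * S powr e"
    using abc e by (intro mult_mono powr_mono2) (auto simp: S_def)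
  also have "\<dots> = S" using abc by (simp add: powr_add[symmetric] S_def)
  finally show ?thesis by (simp add: S_def a_b_c_def)
qed

lemma kernel_sum_summable:
  assumes m: "good_symbol m" and p: "1 < p" and f: "f \<in> lp p"
  shows "(\<lambda>y. f y * multiplier_kernel m (x - y)) summable_on UNIV"
proof -
  obtain K where K: "\<And>q. 1 < q \<Longrightarrow> K \<in> lp q" "\<And>x. \<bar>multiplier_kernel m x\<bar> \<le> K x"
    using good_symbolE[OF m] by metis
  have "(\<lambda>y. \<bar>K (x - y)\<bar> powr (p / (p - 1))) summable_on UNIV"
    using K(1)[of "p / (p - 1)"] p summable_on_reflect[of "\<lambda>y. \<bar>K y\<bar> powr (p / (p - 1))" x]
    by (simp add: lp_def)
  then have "(\<lambda>y. \<bar>f y\<bar> powr p + \<bar>K (x - y)\<bar> powr (p / (p - 1))) summable_on UNIV"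
    using f by (intro summable_on_add) (simp_all add: lp_def)
  then show ?thesis
  proof (rule summable_on_dominated)
    fix y
    have "\<bar>f y * multiplier_kernel m (x - y)\<bar> \<le> \<bar>f y\<bar> * \<bar>K (x - y)\<bar>"
      unfolding abs_mult using K(2)[of "x - y"] by (intro mult_left_mono) auto
    then show "\<bar>f y * multiplier_kernel m (x - y)\<bar> \<le> \<bar>f y\<bar> powr p + \<bar>K (x - y)\<bar> powr (p / (p - 1))"
      using mult_le_powr_conjugate[OF p, of "f y" "K (x - y)"] by linarith
  qed
qed

text \<open>Both sides are limits of the finite convolutions \<open>c n\<close>: on the torus by
  dominated convergence of the product symbols, on the lattice by dominated convergence with the l^2
  envelopes of the two kernels.\<close>

lemma kernel_convolution:
  assumes m1: "good_symbol m1" and m2: "good_symbol m2"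
  shows "set_integrable lborel torus (\<lambda>\<theta>. m1 \<theta> * m2 \<theta>)"
    "(\<Sum>\<^sub>\<infinity>y. multiplier_kernel m1 (w - y) * multiplier_kernel m2 y) = multiplier_kernel (\<lambda>\<theta>. m1 \<theta> * m2 \<theta>) w"
proof -
  obtain k1 K1 B1 where k1: "\<And>n. fin_supp (k1 n)" "\<And>n x. \<bar>k1 n x\<bar> \<le> K1 x" "\<And>q. 1 < q \<Longrightarrow> K1 \<in> lp q"
    "\<And>\<theta>. (\<lambda>n. fourier (k1 n) \<theta>) \<longlonglongrightarrow> m1 \<theta>" "\<And>n \<theta>. norm (fourier (k1 n) \<theta>) \<le> B1"
    "\<And>x. (\<lambda>n. k1 n x) \<longlonglongrightarrow> multiplier_kernel m1 x"
    using good_symbolE[OF m1] by metis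
  obtain k2 K2 B2 where k2: "\<And>n. fin_supp (k2 n)" "\<And>n x. \<bar>k2 n x\<bar> \<le> K2 x" "\<And>q. 1 < q \<Longrightarrow> K2 \<in> lp q"
    "\<And>\<theta>. (\<lambda>n. fourier (k2 n) \<theta>) \<longlonglongrightarrow> m2 \<theta>" "\<And>n \<theta>. norm (fourier (k2 n) \<theta>) \<le> B2"
    "\<And>x. (\<lambda>n. k2 n x) \<longlonglongrightarrow> multiplier_kernel m2 x"
    using good_symbolE[OF m2] by metis
  define c where "c n w = (\<Sum>y | k2 n y \<noteq> 0. k2 n y * k1 n (w + - y))" for n w
  have sc: "has_symbol (\<lambda>f w. \<Sum>y | k2 n y \<noteq> 0. k2 n y * f (w + - y))
      (\<lambda>\<theta>. \<Sum>y | k2 n y \<noteq> 0. of_real (k2 n y) * char_at \<theta> (- y))" for n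
    by (intro has_symbol_sum has_symbol_cmult has_symbol_shift k2)
  have fc: "fin_supp (c n)" for n
    unfolding c_def by (rule has_symbolD(1)[OF sc k1(1)])
  have Fc: "fourier (c n) \<theta> = fourier (k1 n) \<theta> * fourier (k2 n) \<theta>" for n \<theta>
    unfolding c_def using has_symbolD(2)[OF sc[of n] k1(1)[of n], of \<theta>]
    by (simp add: char_at_uminus fourier_def[of "k2 n"] mult.commute)
  have l: "(\<lambda>n. fourier (c n) \<theta>) \<longlonglongrightarrow> m1 \<theta> * m2 \<theta>" for \<theta>
    unfolding Fc by (intro tendsto_mult k1 k2)
  have b: "norm (fourier (c n) \<theta>) \<le> B1 * B2" for n \<theta>
    unfolding Fc norm_mult using k1(5) k2(5) norm_ge_zero order_trans by (intro mult_mono) blast+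
  note dct = kernel_dominated_convergence[where \<mu> = "\<lambda>n. fourier (c n)" and B = "B1 * B2", OF continuous_on_fourier b l]
  show "set_integrable lborel torus (\<lambda>\<theta>. m1 \<theta> * m2 \<theta>)" by (rule dct(1))
  have 1: "(\<lambda>n. c n w) \<longlonglongrightarrow> multiplier_kernel (\<lambda>\<theta>. m1 \<theta> * m2 \<theta>) w"
    using dct(2)[of w] by (simp add: kernel_fourier[OF fc])
  have cs: "c n w = (\<Sum>\<^sub>\<infinity>y. k1 n (w - y) * k2 n y)" for n
  proof -
    have "(\<Sum>\<^sub>\<infinity>y. k1 n (w - y) * k2 n y) = (\<Sum>\<^sub>\<infinity>y\<in>{y. k2 n y \<noteq> 0}. k1 n (w - y) * k2 n y)"
      by (rule infsum_cong_neutral) auto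
    then show ?thesis using k2(1)[of n] by (simp add: c_def mult.commute)
  qed
  have "(\<lambda>n. \<Sum>\<^sub>\<infinity>y. k1 n (w - y) * k2 n y) \<longlonglongrightarrow> (\<Sum>\<^sub>\<infinity>y. multiplier_kernel m1 (w - y) * multiplier_kernel m2 y)"
  proof (rule infsum_dominated_convergence)
    have "(\<lambda>y. \<bar>K1 (w - y)\<bar> powr 2) summable_on UNIV"
      using k1(3)[of 2] summable_on_reflect[of "\<lambda>y. \<bar>K1 y\<bar> powr 2" w] by (simp add: lp_def)
    then show "(\<lambda>y. \<bar>K1 (w - y)\<bar> powr 2 + \<bar>K2 y\<bar> powr 2) summable_on UNIV"
      using k2(3)[of 2] by (intro summable_on_add) (simp_all add: lp_def)
    fix n y
    have "\<bar>k1 n (w - y) * k2 n y\<bar> \<le> \<bar>K1 (w - y)\<bar> * \<bar>K2 y\<bar>"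
      unfolding abs_mult using k1(2)[of n "w - y"] k2(2)[of n y] by (intro mult_mono) auto
    then show "\<bar>k1 n (w - y) * k2 n y\<bar> \<le> \<bar>K1 (w - y)\<bar> powr 2 + \<bar>K2 y\<bar> powr 2"
      using mult_le_powr_conjugate[of 2 "K1 (w - y)" "K2 y"] by simp
  qed (intro tendsto_mult k1 k2)
  then have "(\<lambda>n. c n w) \<longlonglongrightarrow> (\<Sum>\<^sub>\<infinity>y. multiplier_kernel m1 (w - y) * multiplier_kernel m2 y)" by (simp only: cs)
  then show "(\<Sum>\<^sub>\<infinity>y. multiplier_kernel m1 (w - y) * multiplier_kernel m2 y) = multiplier_kernel (\<lambda>\<theta>. m1 \<theta> * m2 \<theta>) w"
    using 1 LIMSEQ_unique by blast
qed

text \<open>The inner transform \<open>multiplier m2 f\<close> is never shown to lie in l^p. Instead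
  the terms f(z) K2(y - z) K1(x - y) are absolutely summable over the pairs (y, z), by comparison
  with three double series that each factorise after a translation. Fubini then yields the
  convolution with the kernel of the product symbol.\<close>

lemma multiplier_comp_has_sum:
  fixes f :: "int ^ 'n::finite \<Rightarrow> real"
  assumes m1: "good_symbol m1" and m2: "good_symbol m2" and p: "1 < p" and f: "f \<in> lp p"
  shows "((\<lambda>z. f z * multiplier_kernel (\<lambda>\<theta>. m1 \<theta> * m2 \<theta>) (x - z)) has_sum multiplier m1 (multiplier m2 f) x) UNIV"
proof -
  obtain K1 where K1: "\<And>q. 1 < q \<Longrightarrow> K1 \<in> lp q" "set_integrable lborel torus m1" "\<And>x. \<bar>multiplier_kernel m1 x\<bar> \<le> K1 x"
    using good_symbolE[OF m1] by metis
  obtain K2 where K2: "\<And>q. 1 < q \<Longrightarrow> K2 \<in> lp q" "set_integrable lborel torus m2" "\<And>x. \<bar>multiplier_kernel m2 x\<bar> \<le> K2 x"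
    using good_symbolE[OF m2] by metis
  \<comment> \<open>The exponent of \<open>triple_product_le\<close>. It exceeds 1, as the
    integrability of the kernels requires.\<close>
  define q where "q = 2 * p / (2 * p - 1)"
  have q: "1 < q" using p by (simp add: q_def field_simps)
  define u where "u y = \<bar>K1 (x - y)\<bar> powr q" for y
  define v where "v y = \<bar>K2 y\<bar> powr q" for y
  define w where "w z = \<bar>f z\<bar> powr p" for z
  have us: "u summable_on UNIV"
    unfolding u_def using K1(1)[OF q] summable_on_reflect[of "\<lambda>y. \<bar>K1 y\<bar> powr q" x] by (simp add: lp_def)
  have vs: "v summable_on UNIV" unfolding v_def using K2(1)[OF q] by (simp add: lp_def)
  have ws: "w summable_on UNIV" unfolding w_def using f by (simp add: lp_def)
  have vr: "(\<lambda>z. v (y - z)) summable_on UNIV" "(\<Sum>\<^sub>\<infinity>z. v (y - z)) = infsum v UNIV" for y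
    using vs summable_on_reflect[of v y] infsum_reflect[of v y] by auto
  have vt: "(\<lambda>y. v (y - z)) summable_on UNIV" "(\<Sum>\<^sub>\<infinity>y. v (y - z)) = infsum v UNIV" for z
    using vs summable_on_translate[of v z] infsum_translate[of v z] by auto
  have nn: "0 \<le> u y" "0 \<le> v y" "0 \<le> w y" for y by (auto simp: u_def v_def w_def)
  have s1: "(\<lambda>(y, z). u y * v (y - z)) summable_on UNIV \<times> UNIV"
    by (rule summable_on_SigmaI[where g = "\<lambda>y. u y * infsum v UNIV"])
       (use us vr nn in \<open>auto simp: has_sum_iff infsum_cmult_right' intro!: summable_on_cmult_right summable_on_cmult_left\<close>)
  have s2: "(\<lambda>(y, z). u y * w z) summable_on UNIV \<times> UNIV"
    by (rule summable_on_SigmaI[where g = "\<lambda>y. u y * infsum w UNIV"])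
       (use us ws nn in \<open>auto simp: has_sum_iff infsum_cmult_right' intro!: summable_on_cmult_right summable_on_cmult_left\<close>)
  have "(\<lambda>(z, y). w z * v (y - z)) summable_on UNIV \<times> UNIV"
    by (rule summable_on_SigmaI[where g = "\<lambda>z. w z * infsum v UNIV"])
       (use ws vt nn in \<open>auto simp: has_sum_iff infsum_cmult_right' intro!: summable_on_cmult_right summable_on_cmult_left\<close>)
  moreover have "(\<lambda>(y, z). v (y - z) * w z) summable_on UNIV \<times> UNIV
      \<longleftrightarrow> (\<lambda>(z, y). w z * v (y - z)) summable_on UNIV \<times> UNIV"
    by (rule summable_on_reindex_bij_witness[where i = prod.swap and j = prod.swap]) (auto simp: mult.commute)
  ultimately have s3: "(\<lambda>(y, z). v (y - z) * w z) summable_on UNIV \<times> UNIV" by simp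
  define \<Phi> where "\<Phi> y z = f z * multiplier_kernel m2 (y - z) * multiplier_kernel m1 (x - y)" for y z
  have "(\<lambda>(y, z). (u y * v (y - z) + u y * w z) + v (y - z) * w z) summable_on UNIV \<times> UNIV"
    using summable_on_add[OF summable_on_add[OF s1 s2] s3] by (simp add: case_prod_unfold)
  then have \<Phi>s: "(\<lambda>(y, z). \<Phi> y z) summable_on UNIV \<times> UNIV"
  proof (rule summable_on_dominated)
    fix yz :: "(int ^ 'n) \<times> (int ^ 'n)"
    obtain y z where yz: "yz = (y, z)" by (cases yz)
    have "\<bar>\<Phi> y z\<bar> \<le> \<bar>f z\<bar> * \<bar>K2 (y - z)\<bar> * \<bar>K1 (x - y)\<bar>"
      unfolding \<Phi>_def abs_mult using K1(3)[of "x - y"] K2(3)[of "y - z"] by (intro mult_mono) auto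
    also have "\<dots> = \<bar>K1 (x - y)\<bar> * \<bar>K2 (y - z)\<bar> * \<bar>f z\<bar>" by simp
    also have "\<dots> \<le> u y * v (y - z) + u y * w z + v (y - z) * w z"
      unfolding u_def v_def w_def q_def by (rule triple_product_le[OF p]) auto
    finally show "\<bar>case yz of (y, z) \<Rightarrow> \<Phi> y z\<bar> \<le> (case yz of (y, z) \<Rightarrow> u y * v (y - z) + u y * w z + v (y - z) * w z)"
      by (simp add: yz)
  qed
  define g where "g = multiplier m2 f"
  have g: "((\<lambda>z. f z * multiplier_kernel m2 (y - z)) has_sum g y) UNIV" for y
    unfolding g_def by (rule multiplier_has_sum[OF K2(2) kernel_sum_summable[OF m2 p f]])
  have row: "(\<Sum>\<^sub>\<infinity>z. \<Phi> y z) = g y * multiplier_kernel m1 (x - y)" for y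
    unfolding \<Phi>_def using has_sum_cmult_left[OF g, of _ "multiplier_kernel m1 (x - y)"] by (simp add: infsumI)
  have "(\<lambda>y. \<Sum>\<^sub>\<infinity>z. \<Phi> y z) summable_on UNIV"
    using summable_on_Sigma_banach[OF \<Phi>s] by simp
  then have "((\<lambda>y. g y * multiplier_kernel m1 (x - y)) has_sum multiplier m1 g x) UNIV"
    unfolding row by (intro multiplier_has_sum K1(2))
  then have "multiplier m1 g x = (\<Sum>\<^sub>\<infinity>y. \<Sum>\<^sub>\<infinity>z. \<Phi> y z)" unfolding row by (simp add: infsumI)
  also have "\<dots> = (\<Sum>\<^sub>\<infinity>z. \<Sum>\<^sub>\<infinity>y. \<Phi> y z)" by (rule infsum_swap_banach[OF \<Phi>s])
  also have col: "(\<lambda>z. \<Sum>\<^sub>\<infinity>y. \<Phi> y z) = (\<lambda>z. f z * multiplier_kernel (\<lambda>\<theta>. m1 \<theta> * m2 \<theta>) (x - z))"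
  proof
    fix z
    have "(\<Sum>\<^sub>\<infinity>y. \<Phi> y z) = (\<Sum>\<^sub>\<infinity>y. f z * (multiplier_kernel m1 ((x - z) - (y - z)) * multiplier_kernel m2 (y - z)))"
      unfolding \<Phi>_def by (intro infsum_cong) simp
    also have "\<dots> = f z * (\<Sum>\<^sub>\<infinity>y. multiplier_kernel m1 ((x - z) - (y - z)) * multiplier_kernel m2 (y - z))"
      by (rule infsum_cmult_right')
    also have "(\<Sum>\<^sub>\<infinity>y. multiplier_kernel m1 ((x - z) - (y - z)) * multiplier_kernel m2 (y - z))
        = (\<Sum>\<^sub>\<infinity>y. multiplier_kernel m1 ((x - z) - y) * multiplier_kernel m2 y)"
      by (rule infsum_translate)
    also have "\<dots> = multiplier_kernel (\<lambda>\<theta>. m1 \<theta> * m2 \<theta>) (x - z)" by (rule kernel_convolution(2)[OF m1 m2])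
    finally show "(\<Sum>\<^sub>\<infinity>y. \<Phi> y z) = f z * multiplier_kernel (\<lambda>\<theta>. m1 \<theta> * m2 \<theta>) (x - z)" .
  qed
  finally have eq: "multiplier m1 g x = (\<Sum>\<^sub>\<infinity>z. f z * multiplier_kernel (\<lambda>\<theta>. m1 \<theta> * m2 \<theta>) (x - z))" .
  have "(\<lambda>(z, y). \<Phi> y z) summable_on UNIV \<times> UNIV \<longleftrightarrow> (\<lambda>(y, z). \<Phi> y z) summable_on UNIV \<times> UNIV"
    by (rule summable_on_reindex_bij_witness[where i = prod.swap and j = prod.swap]) auto
  then have "(\<lambda>z. \<Sum>\<^sub>\<infinity>y. \<Phi> y z) summable_on UNIV"
    using summable_on_Sigma_banach[of "\<lambda>z y. \<Phi> y z" UNIV "\<lambda>_. UNIV"] \<Phi>s by simp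
  then show ?thesis unfolding g_def[symmetric] eq col by simp
qed

section \<open>The upper bound\<close>

lemma good_riesz_minus:
  "good_symbol (\<lambda>\<theta> :: real ^ 'n::finite. sym_minus i \<theta> / of_real (sqrt (sym_neg_lap \<theta>)))"
proof -
  have "sym_minus i \<theta> = char_at \<theta> (- unit_vec i) * sym_plus i \<theta>" for \<theta> :: "real ^ 'n"
    by (simp add: sym_minus_def sym_plus_def char_at_axis algebra_simps cis_mult)
  then show ?thesis using good_symbol_shift[OF good_riesz_plus[of i], of "- unit_vec i"] by simp
qed

lemma kernel_add:
  assumes "set_integrable lborel torus m" "set_integrable lborel torus n"
  shows "multiplier_kernel (\<lambda>\<theta>. m \<theta> + n \<theta>) x = multiplier_kernel m x + multiplier_kernel n x"
proof -
  have "set_integrable lborel torus (\<lambda>\<theta>. m \<theta> * char_at \<theta> x)" "set_integrable lborel torus (\<lambda>\<theta>. n \<theta> * char_at \<theta> x)"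
    by (rule set_integrable_torus_mult[where B = 1]; use assms in \<open>auto intro: continuous_intros\<close>)+
  then show ?thesis by (simp add: multiplier_kernel_def distrib_right set_integral_add(2) add_divide_distrib)
qed

lemma kernel_cmult: "multiplier_kernel (\<lambda>\<theta>. of_real c * m \<theta>) x = c * multiplier_kernel m x"
proof -
  have "(LINT \<theta>:torus|lborel. of_real c * m \<theta> * char_at \<theta> x) = of_real c * (LINT \<theta>:torus|lborel. m \<theta> * char_at \<theta> x)"
    by (simp add: mult.assoc)
  then show ?thesis by (simp add: multiplier_kernel_def)
qed

text \<open>A relation for one fixed \<open>f\<close>: linear combinations of such operators can be
  formed by adding unconditional sums, before any bound on them is known.\<close>

definition kernel_op :: "(real ^ 'n::finite \<Rightarrow> complex) \<Rightarrow> (int ^ 'n \<Rightarrow> real) \<Rightarrow> (int ^ 'n \<Rightarrow> real) \<Rightarrow> bool" where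
  "kernel_op m f g \<longleftrightarrow> set_integrable lborel torus m \<and> (\<forall>x. ((\<lambda>z. f z * multiplier_kernel m (x - z)) has_sum g x) UNIV)"

lemma kernel_op_add:
  assumes "kernel_op m f g" "kernel_op n f h"
  shows "kernel_op (\<lambda>\<theta>. m \<theta> + n \<theta>) f (\<lambda>x. g x + h x)"
  using assms unfolding kernel_op_def
  by (auto simp: kernel_add distrib_left intro!: has_sum_add set_integral_add(1))

lemma kernel_op_cmult:
  assumes "kernel_op m f g"
  shows "kernel_op (\<lambda>\<theta>. of_real c * m \<theta>) f (\<lambda>x. c * g x)"
proof -
  have "((\<lambda>z. f z * multiplier_kernel (\<lambda>\<theta>. of_real c * m \<theta>) (x - z)) has_sum c * g x) UNIV" for x
    using has_sum_cmult_right[of "\<lambda>z. f z * multiplier_kernel m (x - z)" UNIV "g x" c] assms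
    by (simp add: kernel_cmult kernel_op_def mult.left_commute)
  then show ?thesis using assms by (simp add: kernel_op_def set_integrable_mult_right)
qed

lemma kernel_op_sum_list:
  assumes "\<And>b. b \<in> set bs \<Longrightarrow> kernel_op (m b) f (g b)"
  shows "kernel_op (\<lambda>\<theta>. \<Sum>b\<leftarrow>bs. m b \<theta>) f (\<lambda>x. \<Sum>b\<leftarrow>bs. g b x)"
  using assms
proof (induction bs)
  case Nil
  show ?case by (simp add: kernel_op_def set_integrable_def multiplier_kernel_def)
next
  case (Cons b bs)
  then show ?case using kernel_op_add[of "m b" f "g b"] by simp
qed

lemma kernel_op_cong:
  assumes "kernel_op m f g" "\<And>\<theta>. m \<theta> = m' \<theta>" "\<And>x. g x = g' x"
  shows "kernel_op m' f g'"
proof -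
  have "m = m'" "g = g'" using assms by auto
  then show ?thesis using assms(1) by simp
qed

text \<open>With a, b the two angles, half the sum of (e^(ia) - 1)(1 - e^(-ib)) and the same with a,
  b exchanged, divided by the symbol of -\<Delta>; the imaginary parts cancel. For
  \<open>i = j\<close> the numerator is 2 cos a - 2, the symbol of a pure second difference.\<close>

definition sym_riesz_sq :: "'n::finite \<Rightarrow> 'n \<Rightarrow> real ^ 'n \<Rightarrow> complex" where
  "sym_riesz_sq i j \<theta> =
     of_real ((cos (\<theta> $ i) + cos (\<theta> $ j) - cos (\<theta> $ i - \<theta> $ j) - 1) / sym_neg_lap \<theta>)"

lemma riesz_sq_kernel_op:
  fixes f :: "int ^ 'n::finite \<Rightarrow> real"
  assumes p: "1 < p" and f: "f \<in> lp p"
  shows "kernel_op (sym_riesz_sq i j) f (riesz_sq i j f)"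
proof -
  let ?p = "\<lambda>i \<theta>. sym_plus i \<theta> / of_real (sqrt (sym_neg_lap \<theta>))"
  let ?m = "\<lambda>i \<theta>. sym_minus i \<theta> / of_real (sqrt (sym_neg_lap \<theta>))"
  have pm: "kernel_op (\<lambda>\<theta>. ?p i \<theta> * ?m j \<theta>) f (riesz_plus i (riesz_minus j f))" for i j
    unfolding kernel_op_def riesz_plus_def riesz_minus_def
    using kernel_convolution(1)[OF good_riesz_plus good_riesz_minus]
      multiplier_comp_has_sum[OF good_riesz_plus good_riesz_minus p f] by blast
  have mp: "kernel_op (\<lambda>\<theta>. ?m i \<theta> * ?p j \<theta>) f (riesz_minus i (riesz_plus j f))" for i j
    unfolding kernel_op_def riesz_plus_def riesz_minus_def
    using kernel_convolution(1)[OF good_riesz_minus good_riesz_plus]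
      multiplier_comp_has_sum[OF good_riesz_minus good_riesz_plus p f] by blast
  have 1: "kernel_op (\<lambda>\<theta>. of_real (1 / 4) * (?p i \<theta> * ?m j \<theta> + ?p j \<theta> * ?m i \<theta> + ?m i \<theta> * ?p j \<theta> + ?m j \<theta> * ?p i \<theta>)) f
      (\<lambda>x. 1 / 4 * (riesz_plus i (riesz_minus j f) x + riesz_plus j (riesz_minus i f) x
            + riesz_minus i (riesz_plus j f) x + riesz_minus j (riesz_plus i f) x))"
    by (intro kernel_op_cmult kernel_op_add pm mp)
  have 2: "of_real (1 / 4) * (?p i \<theta> * ?m j \<theta> + ?p j \<theta> * ?m i \<theta> + ?m i \<theta> * ?p j \<theta> + ?m j \<theta> * ?p i \<theta>)
      = sym_riesz_sq i j \<theta>" for \<theta>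
  proof -
    define s where "s = complex_of_real (sqrt (sym_neg_lap \<theta>))"
    have ss: "s * s = of_real (sym_neg_lap \<theta>)"
      using sym_neg_lap_bounds(1)[of \<theta>] by (simp add: s_def of_real_mult[symmetric] del: of_real_mult)
    have num: "sym_plus i \<theta> * sym_minus j \<theta> + sym_plus j \<theta> * sym_minus i \<theta>
        = of_real (2 * (cos (\<theta> $ i) + cos (\<theta> $ j) - cos (\<theta> $ i - \<theta> $ j) - 1))"
      by (simp add: sym_plus_def sym_minus_def complex_eq_iff cos_diff algebra_simps)
    have "of_real (1 / 4) * (?p i \<theta> * ?m j \<theta> + ?p j \<theta> * ?m i \<theta> + ?m i \<theta> * ?p j \<theta> + ?m j \<theta> * ?p i \<theta>)
        = 1 / 2 * (sym_plus i \<theta> * sym_minus j \<theta> + sym_plus j \<theta> * sym_minus i \<theta>) / (s * s)"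
    proof -
      have "of_real (1 / 4) * (X / s * (Y / s) + Z / s * (V / s) + V / s * (Z / s) + Y / s * (X / s))
          = 1 / 2 * (X * Y + Z * V) / (s * s)" for X Y Z V :: complex
      proof -
        define r where "r = inverse s"
        show ?thesis unfolding divide_inverse[of _ s] divide_inverse[of _ "s * s"] inverse_mult_distrib r_def[symmetric]
          by (simp add: algebra_simps)
      qed
      then show ?thesis unfolding s_def[symmetric] .
    qed
    also have "\<dots> = sym_riesz_sq i j \<theta>"
    proof -
      have "1 / 2 * complex_of_real (2 * X) / complex_of_real Y = of_real (X / Y)" for X Y by simp
      then show ?thesis unfolding ss num sym_riesz_sq_def .
    qed
    finally show ?thesis .
  qed
  show ?thesis by (rule kernel_op_cong[OF 1 2]) (simp add: riesz_sq_def)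
qed

definition pair_set :: "('n::linorder \<times> 'n) set \<Rightarrow> ('n \<times> 'n) set" where
  "pair_set A = (\<lambda>i. (i, i)) ` unpaired A \<union> {(i, j). (i, j) \<in> A \<and> i < j}"

text \<open>The structural conditions on \<open>A\<close> say that each coordinate is either
  unpaired or the smaller or the larger member of exactly one pair. The blocks therefore cover every
  coordinate once, and the denominator in the limit symbol is the symbol of the full
  -\<Delta>.\<close>

lemma pair_set_sum:
  fixes A :: "('n::{finite,linorder} \<times> 'n) set" and h :: "'n \<Rightarrow> real"
  assumes A: "pairing A"
  shows "(\<Sum>(i, j)\<in>pair_set A. pair_weight i j / 2 * (h i + h j)) = (\<Sum>i\<in>UNIV. h i)"
proof -
  define lo where "lo = {i. \<exists>j. (i, j) \<in> A \<and> i < j}"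
  define hi where "hi = {j. \<exists>i. (i, j) \<in> A \<and> i < j}"
  define partner where "partner i = (THE j. (i, j) \<in> A)" for i
  have sym: "(j, i) \<in> A" if "(i, j) \<in> A" for i j using A that unfolding pairing_def by blast
  have irr: "i \<noteq> j" if "(i, j) \<in> A" for i j using A that unfolding pairing_def by blast
  have uniq: "j = j'" if "(i, j) \<in> A" "(i, j') \<in> A" for i j j' using A that unfolding pairing_def by metis
  have pairs: "{(i, j). (i, j) \<in> A \<and> i < j} = (\<lambda>i. (i, partner i)) ` lo"
  proof -
    have "partner i = j" if "(i, j) \<in> A" for i j
      unfolding partner_def using that uniq by (intro the_equality) auto
    then show ?thesis by (force simp: lo_def image_iff)
  qed
  have hi: "hi = partner ` lo"
  proof -
    have "partner i = j" if "(i, j) \<in> A" for i j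
      unfolding partner_def using that uniq by (intro the_equality) auto
    then show ?thesis by (force simp: lo_def hi_def image_iff)
  qed
  have inj: "inj_on partner lo"
  proof (rule inj_onI)
    fix i i' assume i: "i \<in> lo" "i' \<in> lo" "partner i = partner i'"
    have P: "(i, partner i) \<in> A" if il: "i \<in> lo" for i
    proof -
      obtain j where j: "(i, j) \<in> A" using il by (auto simp: lo_def)
      have "partner i = j" unfolding partner_def using j uniq by (intro the_equality) auto
      then show ?thesis using j by simp
    qed
    show "i = i'" using P[OF i(1)] P[OF i(2)] i(3) sym uniq by metis
  qed
  have cover: "unpaired A \<union> (lo \<union> hi) = UNIV"
  proof -
    have "i \<in> lo \<union> hi" if iu: "i \<notin> unpaired A" for i
    proof -
      obtain j where j: "(i, j) \<in> A" using iu by (auto simp: unpaired_def)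
      then show ?thesis using irr[OF j] sym[OF j] by (auto simp: lo_def hi_def neq_iff)
    qed
    then show ?thesis by auto
  qed
  have disj: "unpaired A \<inter> (lo \<union> hi) = {}" "lo \<inter> hi = {}"
  proof -
    show "unpaired A \<inter> (lo \<union> hi) = {}" using sym unfolding unpaired_def lo_def hi_def by blast
    show "lo \<inter> hi = {}"
    proof (rule ccontr)
      assume "lo \<inter> hi \<noteq> {}"
      then obtain i j k where "(i, j) \<in> A" "i < j" "(k, i) \<in> A" "k < i" by (auto simp: lo_def hi_def)
      then show False using uniq[of i j k] sym[of k i] by auto
    qed
  qed
  have "(\<Sum>(i, j)\<in>pair_set A. pair_weight i j / 2 * (h i + h j))
      = (\<Sum>(i, j)\<in>(\<lambda>i. (i, i)) ` unpaired A. pair_weight i j / 2 * (h i + h j))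
        + (\<Sum>(i, j)\<in>(\<lambda>i. (i, partner i)) ` lo. pair_weight i j / 2 * (h i + h j))"
    unfolding pair_set_def pairs[symmetric] by (rule sum.union_disjoint) auto
  also have "(\<Sum>(i, j)\<in>(\<lambda>i. (i, i)) ` unpaired A. pair_weight i j / 2 * (h i + h j)) = sum h (unpaired A)"
    by (subst sum.reindex) (auto simp: inj_on_def pair_weight_def)
  also have "(\<Sum>(i, j)\<in>(\<lambda>i. (i, partner i)) ` lo. pair_weight i j / 2 * (h i + h j))
      = (\<Sum>(i, j)\<in>(\<lambda>i. (i, partner i)) ` lo. h i + h j)"
    unfolding pairs[symmetric] by (intro sum.cong) (auto simp: pair_weight_def)
  also have "\<dots> = sum h lo + sum h hi"
    unfolding hi by (subst sum.reindex, simp add: inj_on_def, subst sum.reindex[OF inj], simp add: sum.distrib)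
  also have "sum h (unpaired A) + (sum h lo + sum h hi) = sum h (unpaired A \<union> (lo \<union> hi))"
    using disj by (simp add: sum.union_disjoint)
  finally show ?thesis unfolding cover .
qed

lemma riesz_sq_comb_kernel_op:
  fixes A :: "('n::{finite,linorder} \<times> 'n) set"
  assumes p: "1 < p" and f: "f \<in> lp p" and A: "pairing A" and L: "distinct L" "set L = pair_set A"
  shows "kernel_op (limit_symbol \<alpha> L) f (\<lambda>x. - riesz_sq_comb \<alpha> A f x)"
proof -
  let ?c = "\<lambda>b. - (pair_weight (fst b) (snd b) * \<alpha> (fst b))"
  have K: "kernel_op (\<lambda>\<theta>. \<Sum>b\<leftarrow>L. of_real (?c b) * sym_riesz_sq (fst b) (snd b) \<theta>) f
      (\<lambda>x. \<Sum>b\<leftarrow>L. ?c b * riesz_sq (fst b) (snd b) f x)"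
    by (intro kernel_op_sum_list kernel_op_cmult riesz_sq_kernel_op[OF p f])
  have lap: "(\<Sum>b\<leftarrow>L. lap_part b \<theta>) = sym_neg_lap \<theta>" for \<theta>
  proof -
    have "(\<Sum>b\<leftarrow>L. lap_part b \<theta>) = (\<Sum>b\<in>pair_set A. lap_part b \<theta>)"
      using L by (simp add: sum_list_distinct_conv_sum_set)
    also have "\<dots> = (\<Sum>(i, j)\<in>pair_set A. pair_weight i j / 2 * ((2 - 2 * cos (\<theta> $ i)) + (2 - 2 * cos (\<theta> $ j))))"
      by (intro sum.cong refl) (auto simp: lap_part_def algebra_simps)
    also have "\<dots> = sym_neg_lap \<theta>" unfolding sym_neg_lap_cos by (rule pair_set_sum[OF A])
    finally show ?thesis .
  qed
  have sym: "(\<Sum>b\<leftarrow>L. of_real (?c b) * sym_riesz_sq (fst b) (snd b) \<theta>) = limit_symbol \<alpha> L \<theta>" for \<theta>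
  proof -
    have "of_real (?c b) * sym_riesz_sq (fst b) (snd b) \<theta>
        = of_real (- (\<alpha> (fst b) * riesz_part b \<theta>) / sym_neg_lap \<theta>)" for b
      by (cases b) (simp add: sym_riesz_sq_def riesz_part_def mult_ac)
    then have "(\<Sum>b\<leftarrow>L. of_real (?c b) * sym_riesz_sq (fst b) (snd b) \<theta>)
        = (\<Sum>b\<in>pair_set A. of_real (- (\<alpha> (fst b) * riesz_part b \<theta>) / sym_neg_lap \<theta>))"
      using L by (simp add: sum_list_distinct_conv_sum_set)
    also have "\<dots> = of_real (- (\<Sum>b\<in>pair_set A. \<alpha> (fst b) * riesz_part b \<theta>) / sym_neg_lap \<theta>)"
      by (simp add: sum_divide_distrib sum_negf)
    also have "\<dots> = limit_symbol \<alpha> L \<theta>"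
      using L by (simp add: limit_symbol_def lap sum_list_distinct_conv_sum_set)
    finally show ?thesis .
  qed
  have op: "(\<Sum>b\<leftarrow>L. ?c b * riesz_sq (fst b) (snd b) f x) = - riesz_sq_comb \<alpha> A f x" for x
  proof -
    have "(\<Sum>b\<leftarrow>L. ?c b * riesz_sq (fst b) (snd b) f x) = (\<Sum>b\<in>pair_set A. ?c b * riesz_sq (fst b) (snd b) f x)"
      using L by (simp add: sum_list_distinct_conv_sum_set)
    also have "\<dots> = (\<Sum>b\<in>(\<lambda>i. (i, i)) ` unpaired A. ?c b * riesz_sq (fst b) (snd b) f x)
        + (\<Sum>b\<in>{(i, j). (i, j) \<in> A \<and> i < j}. ?c b * riesz_sq (fst b) (snd b) f x)"
      unfolding pair_set_def by (rule sum.union_disjoint) auto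
    also have "(\<Sum>b\<in>(\<lambda>i. (i, i)) ` unpaired A. ?c b * riesz_sq (fst b) (snd b) f x)
        = - (\<Sum>i\<in>unpaired A. \<alpha> i * riesz_sq i i f x)"
      by (subst sum.reindex) (auto simp: inj_on_def pair_weight_def sum_negf)
    also have "(\<Sum>b\<in>{(i, j). (i, j) \<in> A \<and> i < j}. ?c b * riesz_sq (fst b) (snd b) f x)
        = - (\<Sum>(i, j)\<in>{(i, j). (i, j) \<in> A \<and> i < j}. 2 * \<alpha> i * riesz_sq i j f x)"
      unfolding sum_negf[symmetric] by (intro sum.cong refl) (auto simp: pair_weight_def)
    finally show ?thesis by (simp add: riesz_sq_comb_def)
  qed
  show ?thesis using K unfolding sym op .
qed

lemma riesz_sq_comb_bound:
  fixes A :: "('n::{finite,linorder} \<times> 'n) set"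
  assumes p: "1 < p" and f: "f \<in> lp p" and A: "pairing A" and \<alpha>: "admissible_weights A \<alpha>"
  shows "riesz_sq_comb \<alpha> A f \<in> lp p \<and> lp_norm p (riesz_sq_comb \<alpha> A f) \<le> (pstar p - 1) * lp_norm p f"
proof -
  obtain L where L: "set L = pair_set A" "distinct L"
    using finite_distinct_list[of "pair_set A"] by auto
  have \<alpha>1: "\<bar>\<alpha> i\<bar> \<le> 1" for i using \<alpha> by (simp add: admissible_weights_def)
  have "kernel_op (limit_symbol \<alpha> L) f (\<lambda>x. - riesz_sq_comb \<alpha> A f x)"
    by (rule riesz_sq_comb_kernel_op[OF p f A L(2,1)])
  then have "((\<lambda>y. f y * multiplier_kernel (limit_symbol \<alpha> L) (x - y)) has_sum - riesz_sq_comb \<alpha> A f x) UNIV" for x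
    by (simp add: kernel_op_def)
  from limit_kernel_lp_bound[where \<alpha> = \<alpha>, OF p \<alpha>1 f this]
  show ?thesis by (simp add: lp_def lp_norm_def)
qed

lemma riesz_sq_comb_opnorm:
  fixes A :: "('n::{finite,linorder} \<times> 'n) set"
  assumes p: "1 < p" and A: "pairing A" and \<alpha>: "admissible_weights A \<alpha>"
  shows "lp_opnorm p (riesz_sq_comb \<alpha> A) \<le> ennreal (pstar p - 1)"
  unfolding lp_opnorm_def
proof (rule SUP_least)
  fix f :: "(int, 'n) vec \<Rightarrow> real" assume "f \<in> {f. lp_enorm p f \<le> 1}"
  then have f: "f \<in> lp p" "lp_norm p f \<le> 1"
    by (auto simp: lp_enorm_def top_unique split: if_splits)
  have C: "0 \<le> pstar p - 1" using p by (simp add: pstar_def le_max_iff_disj)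
  have "(pstar p - 1) * lp_norm p f \<le> (pstar p - 1) * 1" using f C by (intro mult_left_mono)
  then show "lp_enorm p (riesz_sq_comb \<alpha> A f) \<le> ennreal (pstar p - 1)"
    using riesz_sq_comb_bound[OF p f(1) A \<alpha>] by (auto simp: lp_enorm_def intro!: ennreal_leI)
qed

section \<open>Sharpness: laminates of planar second differences and the extremal zigzag\<close>

section \<open>Averages over oscillating second differences\<close>

definition dxx :: "(int \<Rightarrow> int \<Rightarrow> real) \<Rightarrow> int \<Rightarrow> int \<Rightarrow> real" where
  "dxx u x y = u (x + 1) y - 2 * u x y + u (x - 1) y"

definition dyy :: "(int \<Rightarrow> int \<Rightarrow> real) \<Rightarrow> int \<Rightarrow> int \<Rightarrow> real" where
  "dyy u x y = u x (y + 1) - 2 * u x y + u x (y - 1)"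

text \<open>The outermost layer on each side of the box is kept free, so adjacent copies are
  separated by two zero layers and second differences inside one copy do not see the next.\<close>

definition box_supp :: "int \<Rightarrow> int \<Rightarrow> (int \<Rightarrow> int \<Rightarrow> real) \<Rightarrow> bool" where
  "box_supp L H u \<longleftrightarrow> (\<forall>x y. u x y \<noteq> 0 \<longrightarrow> 1 \<le> x \<and> x \<le> L - 2 \<and> 1 \<le> y \<and> y \<le> H - 2)"

definition box_sum :: "(real \<Rightarrow> real \<Rightarrow> real) \<Rightarrow> real \<Rightarrow> real \<Rightarrow> (int \<Rightarrow> int \<Rightarrow> real) \<Rightarrow> int \<Rightarrow> int \<Rightarrow> real" where
  "box_sum Q a b u L H = (\<Sum>x\<in>{0..<L}. \<Sum>y\<in>{0..<H}. Q (a + dxx u x y) (b + dyy u x y))"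

text \<open>
  \<open>achieves Q a b v\<close>: functions vanishing near the boundary of a box, added to a quadratic with
  second derivatives \<open>a\<close> and \<open>b\<close>, can raise the average of \<open>Q\<close> to almost \<open>v\<close>.
\<close>

definition achieves :: "(real \<Rightarrow> real \<Rightarrow> real) \<Rightarrow> real \<Rightarrow> real \<Rightarrow> real \<Rightarrow> bool" where
  "achieves Q a b v \<longleftrightarrow> (\<forall>\<epsilon>>0. \<exists>L>0. \<exists>H>0. \<exists>u. box_supp L H u \<and>
     (v - \<epsilon>) * (of_int L * of_int H) \<le> box_sum Q a b u L H)"

lemma achieves_self: "achieves Q a b (Q a b)"
  unfolding achieves_def
proof (intro allI impI exI conjI)
  fix \<epsilon> :: real assume "0 < \<epsilon>"
  show "box_supp 1 1 (\<lambda>_ _. 0)" by (simp add: box_supp_def)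
  show "(Q a b - \<epsilon>) * (of_int 1 * of_int 1) \<le> box_sum Q a b (\<lambda>_ _. 0) 1 1"
  proof -
    have "{0..<1 :: int} = {0}" by auto
    then show ?thesis using \<open>0 < \<epsilon>\<close> by (simp add: box_sum_def dxx_def dyy_def)
  qed
qed auto

lemma achieves_transpose:
  assumes "achieves Q a b v"
  shows "achieves (\<lambda>s t. Q t s) b a v"
  unfolding achieves_def
proof (intro allI impI)
  fix \<epsilon> :: real assume "0 < \<epsilon>"
  then obtain L H u where *: "0 < L" "0 < H" "box_supp L H u"
    "(v - \<epsilon>) * (of_int L * of_int H) \<le> box_sum Q a b u L H"
    using assms unfolding achieves_def by meson
  have "box_sum (\<lambda>s t. Q t s) b a (\<lambda>x y. u y x) H L = box_sum Q a b u L H"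
    unfolding box_sum_def by (subst sum.swap) (simp add: dxx_def dyy_def)
  moreover have "box_supp H L (\<lambda>x y. u y x)" using *(3) by (auto simp: box_supp_def)
  ultimately show "\<exists>L>0. \<exists>H>0. \<exists>w. box_supp L H w \<and>
     (v - \<epsilon>) * (of_int L * of_int H) \<le> box_sum (\<lambda>s t. Q t s) b a w L H"
    using * by (intro exI[of _ H] conjI exI[of _ L] exI[of _ "\<lambda>x y. u y x"]) (auto simp: mult.commute)
qed

lemma achieves_scale:
  assumes Q: "\<And>s t. Q (c * s) (c * t) = k * Q s t" and k: "0 < k" and "achieves Q a b v"
  shows "achieves Q (c * a) (c * b) (k * v)"
  unfolding achieves_def
proof (intro allI impI)
  fix \<epsilon> :: real assume \<epsilon>: "0 < \<epsilon>"
  then have "0 < \<epsilon> / k" using k by simp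
  then obtain L H u where *: "0 < L" "0 < H" "box_supp L H u"
    "(v - \<epsilon> / k) * (of_int L * of_int H) \<le> box_sum Q a b u L H"
    using assms(3) unfolding achieves_def by meson
  have "Q (c * a + dxx (\<lambda>x y. c * u x y) x y) (c * b + dyy (\<lambda>x y. c * u x y) x y)
      = k * Q (a + dxx u x y) (b + dyy u x y)" for x y
    unfolding Q[symmetric] by (simp add: dxx_def dyy_def algebra_simps)
  then have "box_sum Q (c * a) (c * b) (\<lambda>x y. c * u x y) L H = k * box_sum Q a b u L H"
    by (simp add: box_sum_def sum_distrib_left)
  moreover have "k * ((v - \<epsilon> / k) * (of_int L * of_int H)) \<le> k * box_sum Q a b u L H"
    using *(4) k by (intro mult_left_mono) auto
  moreover have "k * ((v - \<epsilon> / k) * (of_int L * of_int H)) = (k * v - \<epsilon>) * (of_int L * of_int H)"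
    using k by (simp add: field_simps)
  moreover have "box_supp L H (\<lambda>x y. c * u x y)" using *(3) by (auto simp: box_supp_def)
  ultimately show "\<exists>L>0. \<exists>H>0. \<exists>w. box_supp L H w \<and>
     (k * v - \<epsilon>) * (of_int L * of_int H) \<le> box_sum Q (c * a) (c * b) w L H"
    using * by (intro exI[of _ L] conjI exI[of _ H] exI[of _ "\<lambda>x y. c * u x y"]) auto
qed

lemma box_supp_bounded:
  assumes "box_supp L H u"
  obtains B where "0 \<le> B" "\<And>x y. \<bar>u x y\<bar> \<le> B"
proof
  let ?S = "(\<lambda>(x, y). \<bar>u x y\<bar>) ` ({0..L} \<times> {0..H})"
  show "0 \<le> Max (insert 0 ?S)" by (intro Max_ge) auto
  fix x y
  show "\<bar>u x y\<bar> \<le> Max (insert 0 ?S)"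
  proof (cases "u x y = 0")
    case False
    then have "1 \<le> x \<and> x \<le> L - 2 \<and> 1 \<le> y \<and> y \<le> H - 2"
      using assms unfolding box_supp_def by blast
    then have "(x, y) \<in> {0..L} \<times> {0..H}" by auto
    then show ?thesis by (intro Max_ge) auto
  qed (auto intro!: Max_ge)
qed

lemma dxx_dyy_bound:
  assumes "\<And>x y. \<bar>u x y\<bar> \<le> B"
  shows "\<bar>dxx u x y\<bar> \<le> 4 * B" "\<bar>dyy u x y\<bar> \<le> 4 * B"
proof -
  note b = assms[of "x + 1" y] assms[of x y] assms[of "x - 1" y] assms[of x "y + 1"] assms[of x "y - 1"]
  show "\<bar>dxx u x y\<bar> \<le> 4 * B" unfolding dxx_def using b by linarith
  show "\<bar>dyy u x y\<bar> \<le> 4 * B" unfolding dyy_def using b by linarith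
qed

definition periodize :: "int \<Rightarrow> int \<Rightarrow> (int \<Rightarrow> int \<Rightarrow> real) \<Rightarrow> int \<Rightarrow> int \<Rightarrow> real" where
  "periodize L H u x y = u (x mod L) (y mod H)"

lemma mod_neighbours:
  fixes L x :: int
  assumes L: "0 < L" and z: "g 0 = (0 :: real)" "g L = 0" "g (L - 1) = 0" "g (-1) = 0"
  shows "g ((x + 1) mod L) = g (x mod L + 1)" "g ((x - 1) mod L) = g (x mod L - 1)"
proof -
  have b: "0 \<le> x mod L" "x mod L < L" using L by auto
  show "g ((x + 1) mod L) = g (x mod L + 1)"
  proof (cases "x mod L + 1 = L")
    case True
    have "(x + 1) mod L = (x mod L + 1) mod L" by (simp add: mod_simps)
    then show ?thesis using True z by simp
  next
    case False
    have "(x + 1) mod L = (x mod L + 1) mod L" by (simp add: mod_simps)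
    then show ?thesis using False b by simp
  qed
  show "g ((x - 1) mod L) = g (x mod L - 1)"
  proof (cases "x mod L = 0")
    case True
    have "(x - 1) mod L = (x mod L - 1) mod L" by (simp add: mod_simps)
    also have "\<dots> = L - 1" using True L by (simp add: zmod_minus1)
    finally show ?thesis using True z by simp
  next
    case False
    have "(x - 1) mod L = (x mod L - 1) mod L" by (simp add: mod_simps)
    then show ?thesis using False b by simp
  qed
qed

lemma dxx_periodize:
  assumes u: "box_supp L H u" and L: "0 < L"
  shows "dxx (periodize L H u) x y = dxx u (x mod L) (y mod H)"
proof -
  have z: "u 0 t = 0" "u L t = 0" "u (L - 1) t = 0" "u (-1) t = 0" for t
    using u by (force simp: box_supp_def)+
  show ?thesis
    unfolding dxx_def periodize_def
    using mod_neighbours[of L "\<lambda>x. u x (y mod H)" x, OF L z] by simp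
qed

lemma dyy_periodize:
  assumes u: "box_supp L H u" and H: "0 < H"
  shows "dyy (periodize L H u) x y = dyy u (x mod L) (y mod H)"
proof -
  have z: "u t 0 = 0" "u t H = 0" "u t (H - 1) = 0" "u t (-1) = 0" for t
    using u by (force simp: box_supp_def)+
  show ?thesis
    unfolding dyy_def periodize_def
    using mod_neighbours[of H "\<lambda>y. u (x mod L) y" y, OF H z] by simp
qed

lemma periodize_zero:
  assumes u: "box_supp L H u" and pos: "0 < L" "0 < H"
  shows "L dvd x \<or> L dvd x + 1 \<or> H dvd y \<or> H dvd y + 1 \<Longrightarrow> periodize L H u x y = 0"
proof -
  have z: "u 0 t = 0" "u t 0 = 0" "u (L - 1) t = 0" "u t (H - 1) = 0" for t
    using u by (force simp: box_supp_def)+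
  have m: "x mod P = P - 1" if "P dvd x + 1" "0 < P" for x P :: int
  proof -
    have "x mod P = ((x + 1) mod P - 1) mod P" by (simp add: mod_simps)
    also have "\<dots> = (- 1) mod P" using that by simp
    finally show ?thesis using that by (simp add: zmod_minus1)
  qed
  assume "L dvd x \<or> L dvd x + 1 \<or> H dvd y \<or> H dvd y + 1"
  then consider "x mod L = 0" | "x mod L = L - 1" | "y mod H = 0" | "y mod H = H - 1"
    using m pos by fastforce
  then show ?thesis by cases (simp_all add: periodize_def z)
qed

lemma sum_periodic:
  fixes G :: "int \<Rightarrow> real"
  assumes P: "0 < P"
  shows "(\<Sum>x\<in>{c * P..<(c + int k) * P}. G (x mod P)) = of_nat k * (\<Sum>x\<in>{0..<P}. G x)"
proof (induction k)
  case (Suc k)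
  have "{c * P..<(c + int (Suc k)) * P} = {c * P..<(c + int k) * P} \<union> {(c + int k) * P..<(c + int k) * P + P}"
    using P by (subst ivl_disj_un_two(3)) (auto simp: algebra_simps)
  moreover have "(\<Sum>x\<in>{(c + int k) * P..<(c + int k) * P + P}. G (x mod P)) = (\<Sum>x\<in>{0..<P}. G x)"
  proof -
    have "x mod P = x - q * P" if "q * P \<le> x" "x < q * P + P" for x q
    proof -
      have "x mod P = (x - q * P + q * P) mod P" by simp
      also have "\<dots> = (x - q * P) mod P" by (rule mod_mult_self1)
      also have "\<dots> = x - q * P" using that by (intro mod_pos_pos_trivial) auto
      finally show ?thesis .
    qed
    then show ?thesis
      by (intro sum.reindex_bij_witness[where i = "\<lambda>x. x + (c + int k) * P" and j = "\<lambda>x. x - (c + int k) * P"])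
        auto
  qed
  ultimately show ?case
    using Suc by (simp add: sum.union_disjoint algebra_simps)
qed simp

lemma box_sum_periodize:
  assumes u: "box_supp L H u" and L: "0 < L" and H: "0 < H"
  shows "(\<Sum>x\<in>{c * L..<(c + int k) * L}. \<Sum>y\<in>{0..<int r * H}.
      Q (a + dxx (periodize L H u) x y) (b + dyy (periodize L H u) x y))
    = of_nat k * (of_nat r * box_sum Q a b u L H)"
proof -
  let ?G = "\<lambda>x y. Q (a + dxx u x y) (b + dyy u x y)"
  have "(\<Sum>y\<in>{0..<int r * H}. ?G (x mod L) (y mod H)) = of_nat r * (\<Sum>y\<in>{0..<H}. ?G (x mod L) y)" for x
    using sum_periodic[OF H, where c = 0 and k = r and G = "?G (x mod L)"] by simp
  then have "(\<Sum>x\<in>{c * L..<(c + int k) * L}. \<Sum>y\<in>{0..<int r * H}. ?G (x mod L) (y mod H))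
      = of_nat r * (\<Sum>x\<in>{c * L..<(c + int k) * L}. (\<Sum>y\<in>{0..<H}. ?G (x mod L) y))"
    by (simp add: sum_distrib_left)
  also have "\<dots> = of_nat r * (of_nat k * (\<Sum>x\<in>{0..<L}. \<Sum>y\<in>{0..<H}. ?G x y))"
    using sum_periodic[OF L, where c = c and k = k and G = "\<lambda>x. \<Sum>y\<in>{0..<H}. ?G x y"] by simp
  finally show ?thesis
    by (simp add: dxx_periodize[OF u L] dyy_periodize[OF u H] box_sum_def)
qed

text \<open>
  A compactly supported function on the line with prescribed second difference exists as soon as
  the prescribed values have vanishing sum and, by reflection symmetry, vanishing first moment.
\<close>

lemma second_antidifference:
  fixes d :: "int \<Rightarrow> real" and M :: int
  assumes sum0: "(\<Sum>z\<in>{0..<M}. d z) = 0" and sym: "\<And>z. d (M - 1 - z) = d z"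
  obtains w where "\<And>x. w (x + 1) - 2 * w x + w (x - 1) = (if x \<in> {0..<M} then d x else 0)"
    "\<And>x. x \<le> 0 \<Longrightarrow> w x = 0" "\<And>x. M - 1 \<le> x \<Longrightarrow> w x = 0"
proof
  \<comment> \<open>Convolution of \<open>d\<close> with the fundamental solution max 0 x of the
    second difference. From \<open>M - 1\<close> on every maximum equals \<open>x - z\<close>, so
    \<open>w\<close> is affine there, with the sum and the first moment of \<open>d\<close> as
    coefficients.\<close>
  define w where "w x = (\<Sum>z\<in>{0..<M}. d z * of_int (max 0 (x - z)))" for x
  show "w x = 0" if "x \<le> 0" for x unfolding w_def using that by (intro sum.neutral) auto
  have mom: "(\<Sum>z\<in>{0..<M}. d z * of_int z) = 0"
  proof -
    have "(\<Sum>z\<in>{0..<M}. d z * of_int z) = (\<Sum>z\<in>{0..<M}. d (M - 1 - z) * of_int (M - 1 - z))"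
      by (rule sum.reindex_bij_witness[where i = "\<lambda>z. M - 1 - z" and j = "\<lambda>z. M - 1 - z"]) auto
    also have "\<dots> = (\<Sum>z\<in>{0..<M}. of_int (M - 1) * d z - d z * of_int z)"
      unfolding sym by (intro sum.cong refl) (simp add: algebra_simps)
    also have "\<dots> = - (\<Sum>z\<in>{0..<M}. d z * of_int z)"
      by (simp add: sum_subtractf sum_distrib_left[symmetric] sum0)
    finally show ?thesis by simp
  qed
  show "w x = 0" if "M - 1 \<le> x" for x
  proof -
    have "w x = (\<Sum>z\<in>{0..<M}. of_int x * d z - d z * of_int z)"
      unfolding w_def using that by (intro sum.cong refl) (auto simp: algebra_simps)
    also have "\<dots> = 0" by (simp add: sum_subtractf sum_distrib_left[symmetric] sum0 mom)
    finally show ?thesis .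
  qed
  show "w (x + 1) - 2 * w x + w (x - 1) = (if x \<in> {0..<M} then d x else 0)" for x
  proof -
    have "w (x + 1) - 2 * w x + w (x - 1) = (\<Sum>z\<in>{0..<M}. d z *
        (of_int (max 0 (x + 1 - z)) - 2 * of_int (max 0 (x - z)) + of_int (max 0 (x - 1 - z))))"
      unfolding w_def by (simp only: sum_distrib_left sum_subtractf[symmetric] sum.distrib[symmetric])
        (intro sum.cong refl, simp add: algebra_simps)
    also have "\<dots> = (\<Sum>z\<in>{0..<M}. if z = x then d z else 0)"
      by (intro sum.cong refl) (auto simp: max_def)
    finally show ?thesis by simp
  qed
qed

text \<open>A lamination in the x direction. A profile \<open>w x\<close> with second difference
  \<open>a1 - a\<close> on the columns \<open>T\<close> and \<open>a2 - a\<close> elsewhere replaces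
  the mean \<open>a\<close> by \<open>a1\<close> or \<open>a2\<close>; on top of it periodic copies
  of \<open>u1\<close> oscillate over \<open>T\<close> and copies of \<open>u2\<close> over the
  rest. The columns \<open>T\<close> have density 1 / n. The only error comes from cutting off
  \<open>w\<close> in the y direction, and a tall box makes it negligible.\<close>

lemma achieves_combine_x:
  assumes Q: "\<And>B. \<exists>K. \<forall>s t. \<bar>s\<bar> \<le> B \<longrightarrow> \<bar>t\<bar> \<le> B \<longrightarrow> \<bar>Q s t\<bar> \<le> K"
    and n: "2 \<le> n"
    and A1: "achieves Q a1 b v1" and A2: "achieves Q a2 b v2"
  shows "achieves Q (1 / real n * a1 + (1 - 1 / real n) * a2) b (1 / real n * v1 + (1 - 1 / real n) * v2)"
  unfolding achieves_def
proof (intro allI impI)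
  fix \<epsilon> :: real assume \<epsilon>: "0 < \<epsilon>"
  define a where "a = 1 / real n * a1 + (1 - 1 / real n) * a2"
  define v where "v = 1 / real n * v1 + (1 - 1 / real n) * v2"
  obtain L1 H1 u1 where 1: "0 < L1" "0 < H1" "box_supp L1 H1 u1"
    "(v1 - \<epsilon> / 2) * (of_int L1 * of_int H1) \<le> box_sum Q a1 b u1 L1 H1"
    using A1 \<epsilon> unfolding achieves_def by (meson half_gt_zero)
  obtain L2 H2 u2 where 2: "0 < L2" "0 < H2" "box_supp L2 H2 u2"
    "(v2 - \<epsilon> / 2) * (of_int L2 * of_int H2) \<le> box_sum Q a2 b u2 L2 H2"
    using A2 \<epsilon> unfolding achieves_def by (meson half_gt_zero)
  \<comment> \<open>A common period: both patterns fit into a width of \<open>L\<close> a whole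
    number of times and vanish next to multiples of \<open>L\<close>.\<close>
  define L where "L = L1 * L2"
  define M where "M = 2 * int n * L"
  have L: "0 < L" using 1 2 by (simp add: L_def)
  have nL: "2 * L \<le> int n * L" using n L by (intro mult_right_mono) auto
  \<comment> \<open>Two end strips of width \<open>L\<close> in a total of \<open>2 * n * L\<close>
    instead of a single strip: by the symmetry the first moment of \<open>d\<close> vanishes, as
    \<open>second_antidifference\<close> requires.\<close>
  define T where "T x \<longleftrightarrow> x < L \<or> M - L \<le> x" for x
  have T_sym: "T (M - 1 - x) = T x" for x by (auto simp: T_def)
  have cardT: "(\<Sum>x\<in>{0..<M}. if T x then g x else h x) =
      (\<Sum>x\<in>{0..<L}. g x) + (\<Sum>x\<in>{L..<M - L}. h x) + (\<Sum>x\<in>{M - L..<M}. g x)" for g h :: "int \<Rightarrow> real"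
  proof -
    have "M = 2 * (int n * L)" by (simp add: M_def)
    then have M2: "L \<le> M - L" "M - L \<le> M" using nL L by linarith+
    then have "{0..<M} = ({0..<L} \<union> {L..<M - L}) \<union> {M - L..<M}" using L by auto
    moreover have "(\<Sum>x\<in>({0..<L} \<union> {L..<M - L}) \<union> {M - L..<M}. if T x then g x else h x)
      = (\<Sum>x\<in>{0..<L}. if T x then g x else h x) + (\<Sum>x\<in>{L..<M - L}. if T x then g x else h x)
        + (\<Sum>x\<in>{M - L..<M}. if T x then g x else h x)"
      using L M2 by (subst sum.union_disjoint, simp, simp, force, subst sum.union_disjoint, auto)
    moreover have "(\<Sum>x\<in>{0..<L}. if T x then g x else h x) = (\<Sum>x\<in>{0..<L}. g x)"
      "(\<Sum>x\<in>{L..<M - L}. if T x then g x else h x) = (\<Sum>x\<in>{L..<M - L}. h x)"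
      "(\<Sum>x\<in>{M - L..<M}. if T x then g x else h x) = (\<Sum>x\<in>{M - L..<M}. g x)"
      by (auto simp: T_def intro!: sum.cong)
    ultimately show ?thesis by simp
  qed
  define d where "d x = (if T x then a1 - a else a2 - a)" for x
  have sum_d: "(\<Sum>x\<in>{0..<M}. d x) = 0"
  proof -
    have "M = 2 * (int n * L)" by (simp add: M_def)
    then have M2: "0 \<le> M - L - L" using nL L by linarith
    have "(\<Sum>x\<in>{0..<M}. d x) = of_int L * (a1 - a) + of_int (M - L - L) * (a2 - a) + of_int L * (a1 - a)"
      unfolding d_def cardT using L M2 by simp
    also have "\<dots> = 2 * of_int L * ((a1 - a) + (real n - 1) * (a2 - a))"
      by (simp add: M_def algebra_simps)
    also have "(a1 - a) + (real n - 1) * (a2 - a) = 0"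
      using n by (simp add: a_def field_simps)
    finally show ?thesis by simp
  qed
  obtain w where w: "\<And>x. w (x + 1) - 2 * w x + w (x - 1) = (if x \<in> {0..<M} then d x else 0)"
    "\<And>x. x \<le> 0 \<Longrightarrow> w x = 0" "\<And>x. M - 1 \<le> x \<Longrightarrow> w x = 0"
    using second_antidifference[where M = M and d = d] sum_d T_sym by (auto simp: d_def)
  obtain Bw where Bw: "0 \<le> Bw" "\<And>x. \<bar>w x\<bar> \<le> Bw"
  proof
    show "0 \<le> Max (insert 0 ((\<lambda>x. \<bar>w x\<bar>) ` {0..M}))" by (intro Max_ge) auto
    fix x
    have "w x = 0 \<or> x \<in> {0..M}" using w(2)[of x] w(3)[of x] by fastforce
    then show "\<bar>w x\<bar> \<le> Max (insert 0 ((\<lambda>x. \<bar>w x\<bar>) ` {0..M}))" by (intro Max_ge) auto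
  qed
  obtain B1 where B1: "0 \<le> B1" "\<And>x y. \<bar>u1 x y\<bar> \<le> B1" using box_supp_bounded[OF 1(3)] by blast
  obtain B2 where B2: "0 \<le> B2" "\<And>x y. \<bar>u2 x y\<bar> \<le> B2" using box_supp_bounded[OF 2(3)] by blast
  define B where "B = \<bar>a\<bar> + \<bar>b\<bar> + \<bar>a1\<bar> + \<bar>a2\<bar> + 4 * (B1 + B2 + Bw)"
  obtain K where K: "\<And>s t. \<bar>s\<bar> \<le> B \<Longrightarrow> \<bar>t\<bar> \<le> B \<Longrightarrow> \<bar>Q s t\<bar> \<le> K" using Q[of B] by blast
  have K0: "0 \<le> K" using K[of 0 0] by (simp add: B_def B1 B2 Bw)
  \<comment> \<open>The cut-off costs at most 8 K per column, four rows with 2 K each. A height of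
    at least 16 K / \<epsilon> makes this at most \<epsilon> / 2 on average; the other half of
    \<epsilon> is spent on \<open>u1\<close> and \<open>u2\<close>.\<close>
  define r where "r = nat \<lceil>16 * K / \<epsilon>\<rceil> + 1"
  define R where "R = int r * (H1 * H2)"
  have HH: "1 \<le> H1 * H2" using mult_pos_pos[OF 1(2) 2(2)] by linarith
  have "int r * 1 \<le> R" unfolding R_def using HH by (intro mult_left_mono) auto
  then have Rr: "int r \<le> R" by simp
  have "1 \<le> int r" by (simp add: r_def)
  then have R: "0 < R" using Rr by linarith
  have R16: "16 * K / \<epsilon> \<le> of_int R"
  proof -
    have "16 * K / \<epsilon> \<le> real r" unfolding r_def by linarith
    also have "\<dots> \<le> of_int R" using Rr by (metis of_int_le_iff of_int_of_nat_eq)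
    finally show ?thesis .
  qed
  define U1 where "U1 = periodize L1 H1 u1"
  define U2 where "U2 = periodize L2 H2 u2"
  define U where "U s x y = (if s then U1 x y else U2 x y)" for s x y
  define V where "V x y = (if x \<in> {0..<M} \<and> y \<in> {0..<R} then U (T x) x y else 0)" for x y
  \<comment> \<open>The profile does not depend on \<open>y\<close> and must be cut off so that rows
    0 and R - 1 stay empty. This disturbs second differences only in the rows 0, 1, R - 2 and R -
    1.\<close>
  define u where "u x y = V x y + (if 1 \<le> y \<and> y \<le> R - 2 then w x else 0)" for x y
  have zx: "U s x y = 0" if "L dvd x \<or> L dvd x + 1" for s x y
  proof -
    have "L1 dvd L" "L2 dvd L" by (auto simp: L_def)
    then have "(L1 dvd x \<or> L1 dvd x + 1) \<and> (L2 dvd x \<or> L2 dvd x + 1)" using that dvd_trans by blast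
    then show ?thesis
      using periodize_zero[OF 1(3,1,2), of x y] periodize_zero[OF 2(3,1,2), of x y]
      by (auto simp: U_def U1_def U2_def)
  qed
  have zy: "U s x y = 0" if "R dvd y \<or> R dvd y + 1" for s x y
  proof -
    have "H1 dvd R" "H2 dvd R" by (auto simp: R_def)
    then have "(H1 dvd y \<or> H1 dvd y + 1) \<and> (H2 dvd y \<or> H2 dvd y + 1)" using that dvd_trans by blast
    then show ?thesis
      using periodize_zero[OF 1(3,1,2), of x y] periodize_zero[OF 2(3,1,2), of x y]
      by (auto simp: U_def U1_def U2_def)
  qed
  have Ldvd: "L dvd L" "L dvd M" "L dvd M - L" by (auto simp: M_def)
  \<comment> \<open>At a switch between the patterns or at the border of the box, the neighbouring
    point has a coordinate that is, or immediately precedes, a multiple of \<open>L\<close> or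
    \<open>R\<close>; both patterns vanish there. Second differences can thus be computed as if the
    pattern of column \<open>x\<close> continued.\<close>
  have VU: "V x' y' = U (T x) x' y'"
    if x: "0 \<le> x" "x < M" "x' = x \<or> x' = x + 1 \<or> x' = x - 1"
      and y: "0 \<le> y" "y < R" "y' = y \<or> y' = y + 1 \<or> y' = y - 1" for x y x' y'
  proof (cases "x' \<in> {0..<M} \<and> y' \<in> {0..<R} \<and> T x' = T x")
    case True
    then show ?thesis by (simp add: V_def)
  next
    case False
    consider "x' \<notin> {0..<M} \<or> T x' \<noteq> T x" | "y' \<notin> {0..<R}" using False by blast
    then have "U s x' y' = 0" for s
    proof cases
      case 1
      then have "x' = x + 1 \<or> x' = x - 1" using x by auto
      then show ?thesis
      proof
        assume e: "x' = x + 1"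
        then have "x' = M \<or> x' = L \<or> x' = M - L" using 1 x by (auto simp: T_def)
        then show ?thesis using Ldvd by (intro zx) auto
      next
        assume e: "x' = x - 1"
        then have "x' + 1 = 0 \<or> x' + 1 = L \<or> x' + 1 = M - L" using 1 x by (auto simp: T_def)
        then show ?thesis using Ldvd by (intro zx) auto
      qed
    next
      case 2
      then have "y' = R \<or> y' + 1 = 0" using y by auto
      then show ?thesis by (intro zy) auto
    qed
    then show ?thesis by (simp add: V_def)
  qed
  have supp: "box_supp M R u"
    unfolding box_supp_def
  proof (intro allI impI)
    fix x y assume nz: "u x y \<noteq> 0"
    have V0: "V x y = 0" if "\<not> (1 \<le> x \<and> x \<le> M - 2 \<and> 1 \<le> y \<and> y \<le> R - 2)"
    proof (rule ccontr)
      assume "V x y \<noteq> 0"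
      then have in_box: "0 \<le> x" "x < M" "0 \<le> y" "y < R" "U (T x) x y \<noteq> 0"
        by (auto simp: V_def split: if_splits)
      then have "x = 0 \<or> x + 1 = M \<or> y = 0 \<or> y + 1 = R" using that by auto
      then have "L dvd x \<or> L dvd x + 1 \<or> R dvd y \<or> R dvd y + 1" using Ldvd by auto
      then show False using in_box(5) zx zy by blast
    qed
    show "1 \<le> x \<and> x \<le> M - 2 \<and> 1 \<le> y \<and> y \<le> R - 2"
    proof (rule ccontr)
      assume out: "\<not> (1 \<le> x \<and> x \<le> M - 2 \<and> 1 \<le> y \<and> y \<le> R - 2)"
      then have "(if 1 \<le> y \<and> y \<le> R - 2 then w x else 0) = 0"
        using w(2)[of x] w(3)[of x] by auto
      then show False using nz V0[OF out] by (simp add: u_def)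
    qed
  qed
  define E where "E x y = Q ((if T x then a1 else a2) + dxx (U (T x)) x y) (b + dyy (U (T x)) x y)" for x y
  define F where "F x y = Q (a + dxx u x y) (b + dyy u x y)" for x y
  have dV: "dxx V x y = dxx (U (T x)) x y" "dyy V x y = dyy (U (T x)) x y"
    if "0 \<le> x" "x < M" "0 \<le> y" "y < R" for x y
    unfolding dxx_def dyy_def using VU[OF that(1,2) _ that(3,4)] by auto
  have exact: "F x y = E x y" if xy: "0 \<le> x" "x < M" "2 \<le> y" "y \<le> R - 3" for x y
  proof -
    have "dxx u x y = dxx V x y + d x" "dyy u x y = dyy V x y"
      using xy w(1)[of x] by (auto simp: dxx_def dyy_def u_def algebra_simps)
    then show ?thesis using xy dV[of x y] by (auto simp: F_def E_def d_def add.commute)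
  qed
  have UB: "\<bar>U s x y\<bar> \<le> B1 + B2" for s x y
    using B1 B2 B1(2)[of "x mod L1" "y mod H1"] B2(2)[of "x mod L2" "y mod H2"]
    by (auto simp: U_def U1_def U2_def periodize_def intro: add_increasing add_increasing2)
  have uB: "\<bar>u x y\<bar> \<le> B1 + B2 + Bw" for x y
  proof -
    have "\<bar>V x y\<bar> \<le> B1 + B2" using UB B1(1) B2(1) by (auto simp: V_def)
    moreover have "\<bar>if 1 \<le> y \<and> y \<le> R - 2 then w x else 0\<bar> \<le> Bw" using Bw by auto
    ultimately show ?thesis unfolding u_def by linarith
  qed
  have FK: "\<bar>F x y\<bar> \<le> K" for x y
    unfolding F_def using dxx_dyy_bound[where u = u and x = x and y = y, OF uB] by (intro K) (auto simp: B_def)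
  have EK: "\<bar>E x y\<bar> \<le> K" for x y
    unfolding E_def using dxx_dyy_bound[where u = "U (T x)" and x = x and y = y, OF UB] Bw by (intro K) (auto simp: B_def)
  have col: "(\<Sum>y\<in>{0..<R}. E x y) - 8 * K \<le> (\<Sum>y\<in>{0..<R}. F x y)" if x: "0 \<le> x" "x < M" for x
  proof -
    define Y where "Y = {0, 1, R - 2, R - 1}"
    have "(\<Sum>y\<in>{0..<R}. E x y - F x y) \<le> (\<Sum>y\<in>{0..<R}. if y \<in> Y then 2 * K else 0)"
    proof (rule sum_mono)
      fix y assume y: "y \<in> {0..<R}"
      show "E x y - F x y \<le> (if y \<in> Y then 2 * K else 0)"
      proof (cases "y \<in> Y")
        case True
        then show ?thesis using EK[of x y] FK[of x y] by (simp add: abs_le_iff)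
      next
        case False
        then have "2 \<le> y" "y \<le> R - 3" using y by (auto simp: Y_def)
        then show ?thesis using exact[OF x] False by simp
      qed
    qed
    also have "\<dots> = (\<Sum>y\<in>{0..<R} \<inter> Y. 2 * K)" by (subst sum.inter_restrict) auto
    also have "\<dots> \<le> (\<Sum>y\<in>Y. 2 * K)" using K0 by (intro sum_mono2) (auto simp: Y_def)
    also have "\<dots> = real (card Y) * (2 * K)" by simp
    also have "\<dots> \<le> 4 * (2 * K)"
    proof (rule mult_right_mono)
      have "Y = set [0, 1, R - 2, R - 1]" by (simp add: Y_def)
      then have "card Y \<le> 4" using card_length[of "[0, 1, R - 2, R - 1]"] by simp
      then show "real (card Y) \<le> 4" by simp
    qed (use K0 in simp)
    finally show ?thesis by (simp add: sum_subtractf)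
  qed
  have sumE: "(\<Sum>x\<in>{0..<M}. \<Sum>y\<in>{0..<R}. E x y)
      = 2 * of_int L2 * (of_nat r * of_int H2) * box_sum Q a1 b u1 L1 H1
        + 2 * (of_nat n - 1) * of_int L1 * (of_nat r * of_int H1) * box_sum Q a2 b u2 L2 H2"
  proof -
    let ?E1 = "\<lambda>x. \<Sum>y\<in>{0..<R}. Q (a1 + dxx U1 x y) (b + dyy U1 x y)"
    let ?E2 = "\<lambda>x. \<Sum>y\<in>{0..<R}. Q (a2 + dxx U2 x y) (b + dyy U2 x y)"
    have Ueta: "U True = U1" "U False = U2" by (auto simp: U_def fun_eq_iff)
    have "(\<Sum>x\<in>{0..<M}. \<Sum>y\<in>{0..<R}. E x y) = (\<Sum>x\<in>{0..<M}. if T x then ?E1 x else ?E2 x)"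
      by (intro sum.cong refl) (simp add: E_def Ueta)
    also have "\<dots> = (\<Sum>x\<in>{0..<L}. ?E1 x) + (\<Sum>x\<in>{L..<M - L}. ?E2 x) + (\<Sum>x\<in>{M - L..<M}. ?E1 x)"
      by (rule cardT)
    also have "(\<Sum>x\<in>{0..<L}. ?E1 x) = of_int L2 * (of_nat r * of_int H2 * box_sum Q a1 b u1 L1 H1)"
    proof -
      have e: "L = (0 + int (nat L2)) * L1" "R = int (r * nat H2) * H1" using 2 by (auto simp: L_def R_def)
      have "(\<Sum>x\<in>{0 * L1..<(0 + int (nat L2)) * L1}. \<Sum>y\<in>{0..<int (r * nat H2) * H1}.
          Q (a1 + dxx U1 x y) (b + dyy U1 x y)) = of_nat (nat L2) * (of_nat (r * nat H2) * box_sum Q a1 b u1 L1 H1)"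
        unfolding U1_def by (rule box_sum_periodize[OF 1(3,1,2)])
      then show ?thesis unfolding e[symmetric] using 2 by simp
    qed
    also have "(\<Sum>x\<in>{M - L..<M}. ?E1 x) = of_int L2 * (of_nat r * of_int H2 * box_sum Q a1 b u1 L1 H1)"
    proof -
      define c where "c = (2 * int n - 1) * L2"
      have e: "M - L = c * L1" "M = (c + int (nat L2)) * L1" "R = int (r * nat H2) * H1"
        using 2 by (auto simp: L_def R_def M_def c_def algebra_simps)
      have "(\<Sum>x\<in>{c * L1..<(c + int (nat L2)) * L1}. \<Sum>y\<in>{0..<int (r * nat H2) * H1}.
          Q (a1 + dxx U1 x y) (b + dyy U1 x y)) = of_nat (nat L2) * (of_nat (r * nat H2) * box_sum Q a1 b u1 L1 H1)"
        unfolding U1_def by (rule box_sum_periodize[OF 1(3,1,2)])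
      then show ?thesis unfolding e[symmetric] using 2 by simp
    qed
    also have "(\<Sum>x\<in>{L..<M - L}. ?E2 x) = 2 * (of_nat n - 1) * of_int L1 * (of_nat r * of_int H1 * box_sum Q a2 b u2 L2 H2)"
    proof -
      define k where "k = nat (2 * (int n - 1) * L1)"
      have k: "int k = 2 * (int n - 1) * L1" unfolding k_def using n 1 by simp
      have e: "L = L1 * L2" "M - L = (L1 + int k) * L2" "R = int (r * nat H1) * H2"
        using 1 by (auto simp: L_def R_def M_def k algebra_simps)
      have "(\<Sum>x\<in>{L1 * L2..<(L1 + int k) * L2}. \<Sum>y\<in>{0..<int (r * nat H1) * H2}.
          Q (a2 + dxx U2 x y) (b + dyy U2 x y)) = of_nat k * (of_nat (r * nat H1) * box_sum Q a2 b u2 L2 H2)"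
        unfolding U2_def by (rule box_sum_periodize[OF 2(3,1,2)])
      moreover have "real k = 2 * (of_nat n - 1) * of_int L1"
        using arg_cong[OF k, of real_of_int] by simp
      ultimately show ?thesis unfolding e[symmetric] using 1 by simp
    qed
    finally show ?thesis by (simp add: algebra_simps)
  qed
  have "of_int M * of_int R * (v - \<epsilon> / 2) \<le> (\<Sum>x\<in>{0..<M}. \<Sum>y\<in>{0..<R}. E x y)"
  proof -
    have "of_int M * of_int R * (v - \<epsilon> / 2)
      = 2 * of_int L2 * (of_nat r * of_int H2) * ((v1 - \<epsilon> / 2) * (of_int L1 * of_int H1))
        + 2 * (of_nat n - 1) * of_int L1 * (of_nat r * of_int H1) * ((v2 - \<epsilon> / 2) * (of_int L2 * of_int H2))"
    proof -
      define P where "P = (2 * of_int L1 * of_int L2 * of_nat r * of_int H1 * of_int H2 :: real)"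
      have "of_int M * of_int R = P * real n" by (simp add: M_def R_def L_def P_def)
      moreover have "real n * (v - \<epsilon> / 2) = (v1 - \<epsilon> / 2) + (real n - 1) * (v2 - \<epsilon> / 2)"
        using n by (simp add: v_def field_simps)
      ultimately have "of_int M * of_int R * (v - \<epsilon> / 2) = P * ((v1 - \<epsilon> / 2) + (real n - 1) * (v2 - \<epsilon> / 2))"
        by (metis mult.assoc)
      moreover have "P * (X + (real n - 1) * Z)
        = 2 * of_int L2 * (of_nat r * of_int H2) * (X * (of_int L1 * of_int H1))
          + 2 * (of_nat n - 1) * of_int L1 * (of_nat r * of_int H1) * (Z * (of_int L2 * of_int H2))" for X Z
        by (simp add: P_def algebra_simps)
      ultimately show ?thesis by (simp only:)
    qed
    also have "\<dots> \<le> 2 * of_int L2 * (of_nat r * of_int H2) * box_sum Q a1 b u1 L1 H1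
        + 2 * (of_nat n - 1) * of_int L1 * (of_nat r * of_int H1) * box_sum Q a2 b u2 L2 H2"
      using 1 2 n by (intro add_mono mult_left_mono) auto
    finally show ?thesis unfolding sumE .
  qed
  moreover have "(\<Sum>x\<in>{0..<M}. (\<Sum>y\<in>{0..<R}. E x y) - 8 * K) \<le> box_sum Q a b u M R"
    unfolding box_sum_def F_def[symmetric] by (intro sum_mono col) auto
  moreover have "(\<Sum>x\<in>{0..<M}. (\<Sum>y\<in>{0..<R}. E x y) - 8 * K) = (\<Sum>x\<in>{0..<M}. \<Sum>y\<in>{0..<R}. E x y) - of_int M * (8 * K)"
    using L by (simp add: sum_subtractf M_def)
  moreover have "of_int M * (8 * K) \<le> of_int M * (of_int R * (\<epsilon> / 2))"
  proof (rule mult_left_mono)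
    show "8 * K \<le> of_int R * (\<epsilon> / 2)" using R16 \<epsilon> by (simp add: field_simps)
  qed (use L in \<open>simp add: M_def\<close>)
  moreover have "of_int M * of_int R * (v - \<epsilon> / 2) - of_int M * (of_int R * (\<epsilon> / 2)) = (v - \<epsilon>) * (of_int M * of_int R)"
    by (simp add: algebra_simps)
  ultimately have "(v - \<epsilon>) * (of_int M * of_int R) \<le> box_sum Q a b u M R" by linarith
  moreover have "0 < M" using L n by (simp add: M_def)
  ultimately show "\<exists>L>0. \<exists>H>0. \<exists>u. box_supp L H u \<and>
     (1 / real n * v1 + (1 - 1 / real n) * v2 - \<epsilon>) * (of_int L * of_int H)
      \<le> box_sum Q (1 / real n * a1 + (1 - 1 / real n) * a2) b u L H"
    unfolding a_def[symmetric] v_def[symmetric] using R supp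
    by (intro exI[of _ M] conjI exI[of _ R] exI[of _ u]) auto
qed

lemma achieves_combine_y:
  assumes Q: "\<And>B. \<exists>K. \<forall>s t. \<bar>s\<bar> \<le> B \<longrightarrow> \<bar>t\<bar> \<le> B \<longrightarrow> \<bar>Q s t\<bar> \<le> K"
    and n: "2 \<le> n"
    and A1: "achieves Q a b1 v1" and A2: "achieves Q a b2 v2"
  shows "achieves Q a (1 / real n * b1 + (1 - 1 / real n) * b2) (1 / real n * v1 + (1 - 1 / real n) * v2)"
proof -
  have "\<exists>K. \<forall>s t. \<bar>s\<bar> \<le> B \<longrightarrow> \<bar>t\<bar> \<le> B \<longrightarrow> \<bar>Q t s\<bar> \<le> K" for B using Q[of B] by blast
  from achieves_combine_x[where Q = "\<lambda>s t. Q t s", OF this n achieves_transpose[OF A1] achieves_transpose[OF A2]]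
  show ?thesis using achieves_transpose[of "\<lambda>s t. Q t s"] by simp
qed

section \<open>The lower bound\<close>

text \<open>
  The extremal zigzag: from \<open>(0, 1)\<close> move along slope \<open>1\<close> to \<open>(\<delta>, 1 + \<delta>)\<close>, then along slope \<open>-1\<close>
  back to the axis at \<open>(0, 1 + 2\<delta>)\<close>, stopping both times with probability \<open>1 / n\<close> near
  \<open>(\<plusminus>1/p, 1 - 1/p)\<close>.  With \<open>\<delta> = 1 / (p (n - 1))\<close> homogeneity makes the first order terms cancel.
\<close>

lemma zigzag_extremal:
  fixes W :: "real \<Rightarrow> real \<Rightarrow> real \<Rightarrow> bool" and q :: "real \<Rightarrow> real \<Rightarrow> real"
  assumes p: "1 < p"
    and self: "\<And>x y. W x y (q x y)"
    and up: "\<And>x1 y1 x2 y2 v1 v2 n. 2 \<le> n \<Longrightarrow> x1 - y1 = x2 - y2 \<Longrightarrow> W x1 y1 v1 \<Longrightarrow> W x2 y2 v2 \<Longrightarrow>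
      W (1 / real n * x1 + (1 - 1 / real n) * x2) (1 / real n * y1 + (1 - 1 / real n) * y2)
        (1 / real n * v1 + (1 - 1 / real n) * v2)"
    and down: "\<And>x1 y1 x2 y2 v1 v2 n. 2 \<le> n \<Longrightarrow> x1 + y1 = x2 + y2 \<Longrightarrow> W x1 y1 v1 \<Longrightarrow> W x2 y2 v2 \<Longrightarrow>
      W (1 / real n * x1 + (1 - 1 / real n) * x2) (1 / real n * y1 + (1 - 1 / real n) * y2)
        (1 / real n * v1 + (1 - 1 / real n) * v2)"
    and scale: "\<And>x y v s. 0 < s \<Longrightarrow> W x y v \<Longrightarrow> W (s * x) (s * y) (s powr p * v)"
    and bound: "\<And>v. W 0 1 v \<Longrightarrow> v \<le> M"
    and cont': "(\<lambda>n. q (real (n + 2) / (p * (real n + 1))) (1 + 2 / (p * (real n + 1)) - real (n + 2) / (p * (real n + 1))))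
        \<longlonglongrightarrow> q (1 / p) (1 - 1 / p)"
  shows "q (- 1 / p) (1 - 1 / p) + q (1 / p) (1 - 1 / p) \<le> 0"
proof -
  \<comment> \<open>The best value attainable from (0, 1). By homogeneity every value
    \<open>v\<close> at (0, 1) gives \<open>(1 + 2 * \<delta> n) powr p * v\<close> at the top of
    the zigzag, and running the zigzag back to (0, 1) produces an inequality for \<open>A\<close>
    itself.\<close>
  define A where "A = Sup {v. W 0 1 v}"
  have bdd: "bdd_above {v. W 0 1 v}" using bound by (auto intro!: bdd_aboveI)
  have ne: "{v. W 0 1 v} \<noteq> {}" using self by blast
  define \<delta> where "\<delta> n = 1 / (p * (real n + 1))" for n :: nat
  define k0 where "k0 = q (- 1 / p) (1 - 1 / p)"
  define k where "k n = q (real (n + 2) * \<delta> n) (1 + 2 * \<delta> n - real (n + 2) * \<delta> n)" for n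
  define l where "l n = 1 / real (n + 2)" for n
  have step: "l n * k0 + (1 - l n) * (l n * k n + (1 - l n) * ((1 + 2 * \<delta> n) powr p * v)) \<le> A"
    if v: "W 0 1 v" for v n
  proof -
    have \<delta>: "0 < \<delta> n" using p by (simp add: \<delta>_def)
    have d1: "(real n + 1) * \<delta> n = 1 / p" using p by (simp add: \<delta>_def)
    have l0: "real (n + 2) \<noteq> 0" by simp
    have "W ((1 + 2 * \<delta> n) * 0) ((1 + 2 * \<delta> n) * 1) ((1 + 2 * \<delta> n) powr p * v)"
      using v \<delta> by (intro scale) auto
    then have top: "W 0 (1 + 2 * \<delta> n) ((1 + 2 * \<delta> n) powr p * v)" by simp
    have "W (l n * (real (n + 2) * \<delta> n) + (1 - l n) * 0)
        (l n * (1 + 2 * \<delta> n - real (n + 2) * \<delta> n) + (1 - l n) * (1 + 2 * \<delta> n))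
        (l n * k n + (1 - l n) * ((1 + 2 * \<delta> n) powr p * v))"
      unfolding l_def k_def by (rule down[OF _ _ self top]) auto
    moreover have "l n * (real (n + 2) * \<delta> n) + (1 - l n) * 0 = \<delta> n"
      using l0 by (simp add: l_def)
    moreover have "l n * (1 + 2 * \<delta> n - real (n + 2) * \<delta> n) + (1 - l n) * (1 + 2 * \<delta> n) = 1 + \<delta> n"
    proof -
      have "l n * (1 + 2 * \<delta> n - real (n + 2) * \<delta> n) + (1 - l n) * (1 + 2 * \<delta> n)
          = 1 + 2 * \<delta> n - (l n * real (n + 2)) * \<delta> n" by (simp add: algebra_simps)
      also have "l n * real (n + 2) = 1" using l0 by (simp add: l_def)
      finally show ?thesis by simp
    qed
    ultimately have mid: "W (\<delta> n) (1 + \<delta> n) (l n * k n + (1 - l n) * ((1 + 2 * \<delta> n) powr p * v))" by (simp only:)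
    have "W (l n * (- 1 / p) + (1 - l n) * \<delta> n) (l n * (1 - 1 / p) + (1 - l n) * (1 + \<delta> n))
        (l n * k0 + (1 - l n) * (l n * k n + (1 - l n) * ((1 + 2 * \<delta> n) powr p * v)))"
      unfolding l_def k0_def by (rule up[OF _ _ self mid[unfolded l_def]]) auto
    moreover have e: "(1 - l n) * \<delta> n = l n * (1 / p)"
    proof -
      have "1 - l n = l n * (real n + 1)" by (simp add: l_def field_simps)
      then have "(1 - l n) * \<delta> n = l n * ((real n + 1) * \<delta> n)" by (simp only: mult.assoc)
      then show ?thesis by (simp only: d1)
    qed
    then have "l n * (- 1 / p) + (1 - l n) * \<delta> n = 0"
      "l n * (1 - 1 / p) + (1 - l n) * (1 + \<delta> n) = 1" by (simp_all add: algebra_simps)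
    ultimately have "W 0 1 (l n * k0 + (1 - l n) * (l n * k n + (1 - l n) * ((1 + 2 * \<delta> n) powr p * v)))"
      by (simp only:)
    then show ?thesis unfolding A_def using bdd by (intro cSup_upper) auto
  qed
  have l1: "0 < l n" "l n < 1" for n by (auto simp: l_def)
  define C where "C n = (1 - l n)\<^sup>2 * (1 + 2 * \<delta> n) powr p" for n
  have pos: "0 < C n" for n
  proof -
    have "0 < 1 + 2 * \<delta> n" using p by (auto simp: \<delta>_def intro!: add_pos_nonneg)
    then show ?thesis using l1[of n] by (simp add: C_def)
  qed
  have stepA: "l n * k0 + (1 - l n) * (l n * k n) + C n * A \<le> A" for n
  proof -
    have "v \<le> (A - l n * k0 - (1 - l n) * (l n * k n)) / C n" if "W 0 1 v" for v
      using step[OF that, of n] pos[of n] by (simp add: C_def field_simps power2_eq_square)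
    then have "A \<le> (A - l n * k0 - (1 - l n) * (l n * k n)) / C n"
      unfolding A_def using ne by (intro cSup_least) auto
    then show ?thesis using pos[of n] by (simp add: field_simps)
  qed
  have ineq: "k0 + (1 - l n) * k n \<le> ((1 - C n) / l n) * A" for n
  proof -
    have "l n * (k0 + (1 - l n) * k n) \<le> (1 - C n) * A" using stepA[of n] by (simp add: algebra_simps)
    then show ?thesis using l1(1)[of n] by (simp add: field_simps)
  qed
  have lim1: "(\<lambda>n. k0 + (1 - l n) * k n) \<longlonglongrightarrow> k0 + (1 - 0) * q (1 / p) (1 - 1 / p)"
  proof (intro tendsto_intros)
    show "l \<longlonglongrightarrow> 0" unfolding l_def by real_asymp
    show "k \<longlonglongrightarrow> q (1 / p) (1 - 1 / p)" using cont' by (simp add: k_def[abs_def] \<delta>_def)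
  qed
  \<comment> \<open>To first order C = 1 - 2 l + 2 p \<delta>, where 2 l = 2 / (n + 2) and 2 p
    \<delta> = 2 / (n + 1) differ only at second order. Hence the unknown supremum \<open>A\<close>
    drops out of the limit, and only the values at the two stopping points remain.\<close>
  have lim2: "(\<lambda>n. ((1 - C n) / l n) * A) \<longlonglongrightarrow> 0 * A"
  proof (intro tendsto_mult tendsto_const)
    show "(\<lambda>n. (1 - C n) / l n) \<longlonglongrightarrow> 0"
      unfolding C_def l_def \<delta>_def using p by real_asymp
  qed
  have "k0 + (1 - 0) * q (1 / p) (1 - 1 / p) \<le> 0 * A"
    by (rule LIMSEQ_le[OF lim1 lim2]) (use ineq in auto)
  then show ?thesis by (simp add: k0_def)
qed

definition ratio_defect :: "real \<Rightarrow> real \<Rightarrow> real \<Rightarrow> real \<Rightarrow> real" where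
  "ratio_defect p C x y = \<bar>y\<bar> powr p - C powr p * \<bar>x\<bar> powr p"

text \<open>The arguments are the two pure second differences of a planar function: their sum is the
  Laplacian, the test function, and their difference is its transform up to sign. Changing only
  \<open>s\<close> moves this pair along slope 1, changing only \<open>t\<close> along slope
  -1.\<close>

definition hessian_defect :: "real \<Rightarrow> real \<Rightarrow> real \<Rightarrow> real \<Rightarrow> real" where
  "hessian_defect p C s t = ratio_defect p C (s + t) (s - t)"

lemma hessian_defect_bounded:
  assumes p: "1 < p"
  shows "\<exists>K. \<forall>s t. \<bar>s\<bar> \<le> B \<longrightarrow> \<bar>t\<bar> \<le> B \<longrightarrow> \<bar>hessian_defect p C s t\<bar> \<le> K"
proof (intro exI allI impI)
  fix s t assume B: "\<bar>s\<bar> \<le> B" "\<bar>t\<bar> \<le> B"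
  have *: "\<bar>s - t\<bar> powr p \<le> (2 * B) powr p" "\<bar>s + t\<bar> powr p \<le> (2 * B) powr p"
    using B p by (auto intro!: powr_mono2)
  have "C powr p * \<bar>s + t\<bar> powr p \<le> C powr p * (2 * B) powr p" using * by (intro mult_left_mono) auto
  moreover have "0 \<le> \<bar>s - t\<bar> powr p" "0 \<le> C powr p * \<bar>s + t\<bar> powr p" by auto
  ultimately show "\<bar>hessian_defect p C s t\<bar> \<le> (2 * B) powr p + C powr p * (2 * B) powr p"
    unfolding hessian_defect_def ratio_defect_def using * by linarith
qed

text \<open>At the stopping points (1/p, 1 - 1/p) and (-1/p, 1 - 1/p) the ratio |y| / |x| is p - 1,
  and a constant \<open>C\<close> that works for all laminates must be at least this ratio.
  Exchanging x and y preserves the two families of moves and replaces the ratio by its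
  inverse.\<close>

lemma hessian_ratio_lower_bound:
  fixes p C :: real
  assumes p: "1 < p" and C: "0 \<le> C"
    and nonpos: "\<And>u L H. 0 < L \<Longrightarrow> 0 < H \<Longrightarrow> box_supp L H u \<Longrightarrow> box_sum (hessian_defect p C) 0 0 u L H \<le> 0"
  shows "max (p - 1) (inverse (p - 1)) \<le> C"
proof -
  define W where "W x y = achieves (hessian_defect p C) ((x + y) / 2) ((x - y) / 2)" for x y
  note hb = hessian_defect_bounded[OF p]
  have self: "W x y (ratio_defect p C x y)" for x y
  proof -
    have "hessian_defect p C ((x + y) / 2) ((x - y) / 2) = ratio_defect p C x y"
      by (simp add: hessian_defect_def field_simps)
    then show ?thesis using achieves_self[of "hessian_defect p C" "(x + y) / 2" "(x - y) / 2"] by (simp add: W_def)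
  qed
  have up: "W (1 / real n * x1 + (1 - 1 / real n) * x2) (1 / real n * y1 + (1 - 1 / real n) * y2)
        (1 / real n * v1 + (1 - 1 / real n) * v2)"
    if n: "2 \<le> n" and e: "x1 - y1 = x2 - y2" and W: "W x1 y1 v1" "W x2 y2 v2" for x1 y1 x2 y2 v1 v2 n
  proof -
    define r where "r = 1 / real n"
    have b: "(x2 - y2) / 2 = (x1 - y1) / 2" using e by simp
    have "achieves (hessian_defect p C) (r * ((x1 + y1) / 2) + (1 - r) * ((x2 + y2) / 2)) ((x1 - y1) / 2)
        (r * v1 + (1 - r) * v2)"
      unfolding r_def using W unfolding W_def b by (intro achieves_combine_x hb n)
    moreover have "r * ((x1 + y1) / 2) + (1 - r) * ((x2 + y2) / 2)
        = (r * x1 + (1 - r) * x2 + (r * y1 + (1 - r) * y2)) / 2" by (simp add: field_simps)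
    moreover have "(x1 - y1) / 2 = (r * x1 + (1 - r) * x2 - (r * y1 + (1 - r) * y2)) / 2"
    proof -
      have "r * x1 + (1 - r) * x2 - (r * y1 + (1 - r) * y2) = r * (x1 - y1) + (1 - r) * (x2 - y2)"
        by (simp add: algebra_simps)
      also have "\<dots> = x1 - y1" unfolding e[symmetric] by (simp add: algebra_simps)
      finally show ?thesis by simp
    qed
    ultimately show ?thesis unfolding W_def r_def[symmetric] by (simp only:)
  qed
  have down: "W (1 / real n * x1 + (1 - 1 / real n) * x2) (1 / real n * y1 + (1 - 1 / real n) * y2)
        (1 / real n * v1 + (1 - 1 / real n) * v2)"
    if n: "2 \<le> n" and e: "x1 + y1 = x2 + y2" and W: "W x1 y1 v1" "W x2 y2 v2" for x1 y1 x2 y2 v1 v2 n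
  proof -
    define r where "r = 1 / real n"
    have b: "(x2 + y2) / 2 = (x1 + y1) / 2" using e by simp
    have "achieves (hessian_defect p C) ((x1 + y1) / 2) (r * ((x1 - y1) / 2) + (1 - r) * ((x2 - y2) / 2))
        (r * v1 + (1 - r) * v2)"
      unfolding r_def using W unfolding W_def b by (intro achieves_combine_y hb n)
    moreover have "r * ((x1 - y1) / 2) + (1 - r) * ((x2 - y2) / 2)
        = (r * x1 + (1 - r) * x2 - (r * y1 + (1 - r) * y2)) / 2" by (simp add: field_simps)
    moreover have "(x1 + y1) / 2 = (r * x1 + (1 - r) * x2 + (r * y1 + (1 - r) * y2)) / 2"
    proof -
      have "r * x1 + (1 - r) * x2 + (r * y1 + (1 - r) * y2) = r * (x1 + y1) + (1 - r) * (x2 + y2)"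
        by (simp add: algebra_simps)
      also have "\<dots> = x1 + y1" unfolding e[symmetric] by (simp add: algebra_simps)
      finally show ?thesis by simp
    qed
    ultimately show ?thesis unfolding W_def r_def[symmetric] by (simp only:)
  qed
  have scale: "W (s * x) (s * y) (s powr p * v)" if s: "0 < s" and W: "W x y v" for s x y v
  proof -
    have "hessian_defect p C (s * a) (s * b) = s powr p * hessian_defect p C a b" for a b
    proof -
      have "\<bar>s * a - s * b\<bar> = s * \<bar>a - b\<bar>" "\<bar>s * a + s * b\<bar> = s * \<bar>a + b\<bar>"
        using s by (simp_all add: abs_mult flip: right_diff_distrib distrib_left)
      then show ?thesis by (simp add: hessian_defect_def ratio_defect_def powr_mult algebra_simps)
    qed
    then have "achieves (hessian_defect p C) (s * ((x + y) / 2)) (s * ((x - y) / 2)) (s powr p * v)"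
      using s W unfolding W_def by (intro achieves_scale) auto
    moreover have "s * ((x + y) / 2) = (s * x + s * y) / 2" "s * ((x - y) / 2) = (s * x - s * y) / 2"
      by (simp_all add: field_simps)
    ultimately show ?thesis by (simp add: W_def)
  qed
  have zero: "v \<le> 0" if v: "W 0 0 v" for v
  proof (rule field_le_epsilon)
    fix \<epsilon> :: real assume "0 < \<epsilon>"
    then obtain L H u where *: "0 < L" "0 < H" "box_supp L H u"
      "(v - \<epsilon>) * (of_int L * of_int H) \<le> box_sum (hessian_defect p C) 0 0 u L H"
      using v unfolding W_def achieves_def by (simp del: of_int_mult) meson
    then have "(v - \<epsilon>) * (of_int L * of_int H) \<le> 0" using nonpos[OF *(1-3)] by linarith
    moreover have "0 < (of_int L * of_int H :: real)" using * by simp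
    ultimately have "v - \<epsilon> \<le> 0" using mult_pos_pos[of "v - \<epsilon>" "of_int L * of_int H"] by linarith
    then show "v \<le> 0 + \<epsilon>" by simp
  qed
  \<comment> \<open>The supremum in the zigzag argument must be finite. A value at (x, y) enters a
    value at the origin with weight 1/4: the average with the mirror point (y, x) along slope -1
    lies on the diagonal, and the average with its antipode along slope 1 is the origin, where all
    values are nonpositive.\<close>
  have bound: "\<exists>M. \<forall>v. W x y v \<longrightarrow> v \<le> M" for x y
  proof -
    define q1 where "q1 = ratio_defect p C y x"
    define q2 where "q2 = ratio_defect p C (- (x + y) / 2) (- (x + y) / 2)"
    have "v \<le> - q1 - 2 * q2" if v: "W x y v" for v
    proof -
      have "W (1 / real 2 * y + (1 - 1 / real 2) * x) (1 / real 2 * x + (1 - 1 / real 2) * y)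
          (1 / real 2 * q1 + (1 - 1 / real 2) * v)"
        unfolding q1_def by (rule down[OF _ _ self v]) auto
      then have m: "W ((x + y) / 2) ((x + y) / 2) (1 / real 2 * q1 + (1 - 1 / real 2) * v)"
        by (simp add: field_simps)
      have "W (1 / real 2 * (- (x + y) / 2) + (1 - 1 / real 2) * ((x + y) / 2))
          (1 / real 2 * (- (x + y) / 2) + (1 - 1 / real 2) * ((x + y) / 2))
          (1 / real 2 * q2 + (1 - 1 / real 2) * (1 / real 2 * q1 + (1 - 1 / real 2) * v))"
        unfolding q2_def by (rule up[OF _ _ self m]) auto
      then have "W 0 0 (1 / real 2 * q2 + (1 - 1 / real 2) * (1 / real 2 * q1 + (1 - 1 / real 2) * v))"
        by (simp add: field_simps)
      from zero[OF this] show ?thesis by (simp add: field_simps)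
    qed
    then show ?thesis by blast
  qed
  have lim: "(\<lambda>n. real (n + 2) / (p * (real n + 1))) \<longlonglongrightarrow> 1 / p"
    "(\<lambda>n. 1 + 2 / (p * (real n + 1)) - real (n + 2) / (p * (real n + 1))) \<longlonglongrightarrow> 1 - 1 / p"
    using p by (real_asymp simp: field_simps)+
  have tp: "(\<lambda>n. \<bar>g n\<bar> powr p) \<longlonglongrightarrow> \<bar>a\<bar> powr p" if "g \<longlonglongrightarrow> a" for g :: "nat \<Rightarrow> real" and a
    using p that by (intro tendsto_powr2 tendsto_rabs tendsto_const) auto
  have ab: "\<bar>1 - 1 / p\<bar> powr p = (p - 1) powr p * (1 / p) powr p" "\<bar>1 / p\<bar> powr p = (1 / p) powr p"
    "\<bar>- 1 / p\<bar> powr p = (1 / p) powr p"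
  proof -
    have "1 - 1 / p = (p - 1) * (1 / p)" using p by (simp add: field_simps)
    then show "\<bar>1 - 1 / p\<bar> powr p = (p - 1) powr p * (1 / p) powr p"
      using p by (simp only: powr_mult[symmetric]) (simp add: abs_mult)
  qed (use p in auto)
  have P: "0 < (1 / p) powr p" using p by simp
  obtain M1 where M1: "\<And>v. W 0 1 v \<Longrightarrow> v \<le> M1" using bound by blast
  obtain M2 where M2: "\<And>v. W 1 0 v \<Longrightarrow> v \<le> M2" using bound by blast
  have "ratio_defect p C (- 1 / p) (1 - 1 / p) + ratio_defect p C (1 / p) (1 - 1 / p) \<le> 0"
  proof (rule zigzag_extremal[where W = W and q = "ratio_defect p C" and M = M1, OF p self up down scale M1])
    show "(\<lambda>n. ratio_defect p C (real (n + 2) / (p * (real n + 1))) (1 + 2 / (p * (real n + 1)) - real (n + 2) / (p * (real n + 1))))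
        \<longlonglongrightarrow> ratio_defect p C (1 / p) (1 - 1 / p)"
      unfolding ratio_defect_def by (intro tendsto_diff tendsto_mult tendsto_const tp lim)
  qed
  then have "((p - 1) powr p - C powr p) * (1 / p) powr p \<le> 0"
    unfolding ratio_defect_def ab by (simp add: algebra_simps)
  then have "(p - 1) powr p \<le> C powr p" using P by (simp add: mult_le_0_iff)
  then have 1: "p - 1 \<le> C" using p C by (metis diff_ge_0_iff_ge less_imp_le less_trans not_le powr_less_mono2 zero_less_one)
  have "ratio_defect p C (1 - 1 / p) (- 1 / p) + ratio_defect p C (1 - 1 / p) (1 / p) \<le> 0"
  proof (rule zigzag_extremal[where W = "\<lambda>x y. W y x" and q = "\<lambda>x y. ratio_defect p C y x" and M = M2, OF p self _ _ scale M2])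
    show "W (1 / real n * y1 + (1 - 1 / real n) * y2) (1 / real n * x1 + (1 - 1 / real n) * x2)
        (1 / real n * v1 + (1 - 1 / real n) * v2)"
      if "2 \<le> n" "x1 - y1 = x2 - y2" "W y1 x1 v1" "W y2 x2 v2" for x1 y1 x2 y2 v1 v2 n
      using that by (intro up) auto
    show "W (1 / real n * y1 + (1 - 1 / real n) * y2) (1 / real n * x1 + (1 - 1 / real n) * x2)
        (1 / real n * v1 + (1 - 1 / real n) * v2)"
      if "2 \<le> n" "x1 + y1 = x2 + y2" "W y1 x1 v1" "W y2 x2 v2" for x1 y1 x2 y2 v1 v2 n
      using that by (intro down) auto
    show "(\<lambda>n. ratio_defect p C (1 + 2 / (p * (real n + 1)) - real (n + 2) / (p * (real n + 1))) (real (n + 2) / (p * (real n + 1))))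
        \<longlonglongrightarrow> ratio_defect p C (1 - 1 / p) (1 / p)"
      unfolding ratio_defect_def by (intro tendsto_diff tendsto_mult tendsto_const tp lim)
  qed
  then have "(1 - C powr p * (p - 1) powr p) * (1 / p) powr p \<le> 0"
    unfolding ratio_defect_def ab by (simp add: algebra_simps)
  then have "1 \<le> (C * (p - 1)) powr p" using P by (simp add: mult_le_0_iff powr_mult)
  then have "1 \<le> C * (p - 1)"
    using p C by (metis diff_ge_0_iff_ge less_imp_le less_trans mult_nonneg_nonneg not_le powr_less_mono2 powr_one_eq_one zero_less_one)
  then have "inverse (p - 1) \<le> C" using p by (simp add: field_simps)
  then show ?thesis using 1 by simp
qed

section \<open>Sharpness: transfer of the planar estimate to the operator norm\<close>

section \<open>Testing the operator on Laplacians\<close>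

definition axis_diff2 :: "'n::finite \<Rightarrow> (int ^ 'n \<Rightarrow> real) \<Rightarrow> int ^ 'n \<Rightarrow> real" where
  "axis_diff2 i f x = f (x + unit_vec i) - 2 * f x + f (x + - unit_vec i)"

lemma laplacian_axis_diff2: "laplacian f x = (\<Sum>i\<in>UNIV. axis_diff2 i f x)"
  by (simp add: laplacian_def axis_diff2_def)

lemma has_symbol_axis_diff2: "has_symbol (axis_diff2 i) (\<lambda>\<theta>. of_real (2 * cos (\<theta> $ i) - 2))"
proof (rule has_symbol_cong)
  show "has_symbol (\<lambda>f x. (f (x + unit_vec i) - 2 * f x) + f (x + - unit_vec i))
      (\<lambda>\<theta>. (char_at \<theta> (unit_vec i) - of_real 2 * 1) + char_at \<theta> (- unit_vec i))"
    by (intro has_symbol_add has_symbol_diff has_symbol_cmult has_symbol_shift has_symbol_id)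
  fix \<theta> :: "real ^ 'a"
  show "(char_at \<theta> (unit_vec i) - of_real 2 * 1) + char_at \<theta> (- unit_vec i) = complex_of_real (2 * cos (\<theta> $ i) - 2)"
    using cis_add_cis_minus[of "\<theta> $ i"] by (simp add: char_at_axis algebra_simps)
qed (simp add: axis_diff2_def)

lemma has_symbol_laplacian:
  "has_symbol laplacian (\<lambda>\<theta> :: real ^ 'n::finite. - of_real (sym_neg_lap \<theta>))"
proof (rule has_symbol_cong)
  show "has_symbol (\<lambda>f x. \<Sum>i\<in>UNIV. axis_diff2 i f x)
     (\<lambda>\<theta> :: real ^ 'n. \<Sum>i\<in>UNIV. of_real (2 * cos (\<theta> $ i) - 2))"
    by (intro has_symbol_sum has_symbol_axis_diff2) auto
  fix \<theta> :: "real ^ 'n"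
  have "(\<Sum>i\<in>UNIV. 2 * cos (\<theta> $ i) - 2) = - sym_neg_lap \<theta>"
    unfolding sym_neg_lap_cos sum_negf[symmetric] by (intro sum.cong) auto
  then show "(\<Sum>i\<in>UNIV. complex_of_real (2 * cos (\<theta> $ i) - 2)) = - of_real (sym_neg_lap \<theta>)"
    by (metis of_real_minus of_real_sum)
qed (simp add: laplacian_axis_diff2)

lemma fin_supp_lp:
  assumes "fin_supp f" "0 < p"
  shows "f \<in> lp p" "lp_norm p f = lattice_sum (\<lambda>x. \<bar>f x\<bar> powr p) powr (1 / p)"
  using fin_supp_summable[OF fin_supp_powr[OF assms(1), of p]]
  by (simp_all add: lp_def lp_norm_def lattice_sum_def)

text \<open>The symbol of the Laplacian cancels the denominator in \<open>sym_riesz_sq\<close>, and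
  a trigonometric polynomial remains. Membership in l^2 merely provides an exponent for
  \<open>riesz_sq_kernel_op\<close>.\<close>

lemma riesz_sq_laplacian:
  fixes f :: "int ^ 'n::finite \<Rightarrow> real"
  assumes f: "fin_supp f"
  shows "riesz_sq i i (laplacian f) x = - axis_diff2 i f x"
proof -
  note lap = has_symbolD[OF has_symbol_laplacian f]
  have lp: "laplacian f \<in> lp 2" by (rule fin_supp_lp[OF lap(1)]) simp
  have K: "kernel_op (sym_riesz_sq i i) (laplacian f) (riesz_sq i i (laplacian f))"
    by (rule riesz_sq_kernel_op[OF _ lp]) simp
  have "riesz_sq i i (laplacian f) x = (\<Sum>\<^sub>\<infinity>z. laplacian f z * multiplier_kernel (sym_riesz_sq i i) (x - z))"
  proof -
    have "((\<lambda>z. laplacian f z * multiplier_kernel (sym_riesz_sq i i) (x - z)) has_sum riesz_sq i i (laplacian f) x) UNIV"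
      using K by (simp add: kernel_op_def)
    from infsumI[OF this] show ?thesis by simp
  qed
  also have "\<dots> = (\<Sum>\<^sub>\<infinity>z\<in>{z. laplacian f z \<noteq> 0}. laplacian f z * multiplier_kernel (sym_riesz_sq i i) (x - z))"
    by (rule infsum_cong_neutral) auto
  also have "\<dots> = (\<Sum>z | laplacian f z \<noteq> 0. laplacian f z * multiplier_kernel (sym_riesz_sq i i) (x - z))"
    using lap(1) by simp
  also have "\<dots> = multiplier_fin (sym_riesz_sq i i) (laplacian f) x"
    by (rule multiplier_fin_kernel[symmetric]) (use K lap(1) in \<open>auto simp: kernel_op_def\<close>)
  also have "\<dots> = multiplier_fin (\<lambda>_. 1) (\<lambda>x. - 1 * axis_diff2 i f x) x"
  proof -
    have s: "has_symbol (\<lambda>f x. - 1 * axis_diff2 i f x) (\<lambda>\<theta>. of_real (- 1) * of_real (2 * cos (\<theta> $ i) - 2))"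
      by (intro has_symbol_cmult has_symbol_axis_diff2)
    have "sym_riesz_sq i i \<theta> * fourier (laplacian f) \<theta> = 1 * fourier (\<lambda>x. - 1 * axis_diff2 i f x) \<theta>" for \<theta>
    proof -
      have "sym_riesz_sq i i \<theta> * - of_real (sym_neg_lap \<theta>) = of_real (- 1) * of_real (2 * cos (\<theta> $ i) - 2)"
      proof (cases "sym_neg_lap \<theta> = 0")
        \<comment> \<open>The quotient is 0 by division by zero, and the right side vanishes too
          because \<open>sym_neg_lap\<close> dominates 2 - 2 cos.\<close>
        case True
        have "2 - 2 * cos (\<theta> $ i) \<le> sym_neg_lap \<theta>"
          unfolding sym_neg_lap_cos by (rule member_le_sum[where f = "\<lambda>k. 2 - 2 * cos (\<theta> $ k)"]) auto
        then have "cos (\<theta> $ i) = 1" using True cos_le_one[of "\<theta> $ i"] by linarith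
        then show ?thesis using True by simp
      next
        case False
        then show ?thesis by (simp add: sym_riesz_sq_def)
      qed
      then show ?thesis unfolding lap(2) has_symbolD(2)[OF s f] by (metis mult.assoc mult_1)
    qed
    then show ?thesis by (simp add: multiplier_fin_def)
  qed
  also have "\<dots> = - 1 * axis_diff2 i f x"
    using multiplier_fin_1[of "\<lambda>x. - 1 * axis_diff2 i f x"] fin_supp_cmult[OF has_symbolD(1)[OF has_symbol_axis_diff2 f], of "- 1" i]
    by simp
  finally show ?thesis by simp
qed

text \<open>The operator norm only speaks about the unit ball; homogeneity extends the bound to
  every \<open>f\<close>.\<close>

lemma opnorm_test_laplacian:
  fixes f :: "int ^ 'n::{finite,linorder} \<Rightarrow> real"
  assumes p: "1 < p" and ij: "i \<noteq> j" and C: "0 \<le> C"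
    and bound: "lp_opnorm p (riesz_sq_comb (\<lambda>k. if k = i then 1 else if k = j then - 1 else 0) {}) \<le> ennreal C"
    and f: "fin_supp f"
  shows "lattice_sum (\<lambda>x. \<bar>axis_diff2 i f x - axis_diff2 j f x\<bar> powr p)
     \<le> C powr p * lattice_sum (\<lambda>x. \<bar>laplacian f x\<bar> powr p)"
proof -
  define T where "T = riesz_sq_comb (\<lambda>k. if k = i then 1 else if k = j then - 1 else (0 :: real)) {}"
  define G where "G f x = axis_diff2 i f x - axis_diff2 j f x" for f :: "(int, 'n) vec \<Rightarrow> real" and x
  have fG: "fin_supp (G h)" if "fin_supp h" for h
    unfolding G_def using that by (intro fin_supp_diff has_symbolD(1)[OF has_symbol_axis_diff2])
  have T: "T (laplacian h) x = - G h x" if h: "fin_supp h" for h x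
  proof -
    have "T (laplacian h) x = (\<Sum>k\<in>UNIV. (if k = i then 1 else if k = j then - 1 else 0) * riesz_sq k k (laplacian h) x)"
      by (simp add: T_def riesz_sq_comb_def unpaired_def)
    also have "\<dots> = (\<Sum>k\<in>{i, j}. (if k = i then 1 else if k = j then - 1 else 0) * riesz_sq k k (laplacian h) x)"
      by (rule sum.mono_neutral_right) auto
    also have "\<dots> = - G h x" using ij by (simp add: riesz_sq_laplacian[OF h] G_def)
    finally show ?thesis .
  qed
  have p0: "0 < p" using p by simp
  have unit: "lp_norm p (G h) \<le> C" if h: "fin_supp h" "lp_norm p (laplacian h) \<le> 1" for h
  proof -
    have lh: "laplacian h \<in> lp p" by (rule fin_supp_lp(1)[OF has_symbolD(1)[OF has_symbol_laplacian h(1)] p0])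
    have "lp_enorm p (laplacian h) \<le> 1" using lh h(2) by (simp add: lp_enorm_def)
    then have "lp_enorm p (T (laplacian h)) \<le> lp_opnorm p T"
      unfolding lp_opnorm_def by (intro SUP_upper) auto
    then have le: "lp_enorm p (T (laplacian h)) \<le> ennreal C" using bound by (simp add: T_def)
    have "T (laplacian h) = (\<lambda>x. - G h x)" using T[OF h(1)] by auto
    moreover have "(\<lambda>x. - G h x) \<in> lp p" "lp_norm p (\<lambda>x. - G h x) = lp_norm p (G h)"
      using fin_supp_lp(1)[OF fG[OF h(1)] p0] by (simp_all add: lp_def lp_norm_def)
    ultimately have "ennreal (lp_norm p (G h)) \<le> ennreal C" using le by (simp add: lp_enorm_def)
    then show ?thesis using C by simp
  qed
  define S where "S = lp_norm p (laplacian f)"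
  define R where "R = lp_norm p (G f)"
  have S0: "0 \<le> S" and R0: "0 \<le> R" by (simp_all add: S_def R_def lp_norm_def)
  have hom: "lp_norm p (\<lambda>x. t * h x) = t * lp_norm p h" if "0 < t" for t and h :: "(int, 'n) vec \<Rightarrow> real"
    using that p by (simp add: lp_norm_def abs_mult powr_mult infsum_cmult_right' powr_powr)
  have scaled: "t * R \<le> C" if t: "0 < t" "t * S \<le> 1" for t
  proof -
    have "laplacian (\<lambda>x. t * f x) = (\<lambda>x. t * laplacian f x)"
      by (rule ext) (simp add: laplacian_def sum_distrib_left algebra_simps)
    moreover have "G (\<lambda>x. t * f x) = (\<lambda>x. t * G f x)"
      by (rule ext) (simp add: G_def axis_diff2_def algebra_simps)
    ultimately show ?thesis
      using unit[of "\<lambda>x. t * f x"] fin_supp_cmult[OF f] t f by (simp add: hom S_def R_def)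
  qed
  have RS: "R \<le> C * S"
  proof (cases "S = 0")
    \<comment> \<open>All positive multiples of \<open>f\<close> remain in the unit ball, so the
      bound on their images forces \<open>R = 0\<close>.\<close>
    case True
    show ?thesis
    proof (rule ccontr)
      assume "\<not> R \<le> C * S"
      then have "0 < R" using True by simp
      then have "(C + 1) / R * R \<le> C" using True C by (intro scaled) auto
      then show False using \<open>0 < R\<close> by simp
    qed
  next
    case False
    then have "0 < S" using S0 by simp
    then have "1 / S * R \<le> C" by (intro scaled) auto
    then show ?thesis using \<open>0 < S\<close> by (simp add: field_simps)
  qed
  have rS: "S powr p = lattice_sum (\<lambda>x. \<bar>laplacian f x\<bar> powr p)"
    unfolding S_def fin_supp_lp(2)[OF has_symbolD(1)[OF has_symbol_laplacian f] p0]
    using p by (simp add: powr_powr lattice_sum_def infsum_nonneg)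
  have rR: "R powr p = lattice_sum (\<lambda>x. \<bar>G f x\<bar> powr p)"
    unfolding R_def fin_supp_lp(2)[OF fG[OF f] p0]
    using p by (simp add: powr_powr lattice_sum_def infsum_nonneg)
  have "R powr p \<le> (C * S) powr p" using RS R0 p by (intro powr_mono2) auto
  then show ?thesis by (simp add: powr_mult rS rR G_def)
qed

section \<open>Lifting planar functions to the lattice\<close>

definition slab :: "'n \<Rightarrow> 'n \<Rightarrow> int \<Rightarrow> int \<Rightarrow> int \<Rightarrow> int \<Rightarrow> (int ^ 'n::finite) set" where
  "slab i j L H lo hi = {x. x $ i \<in> {0..<L} \<and> x $ j \<in> {0..<H} \<and> (\<forall>k. k \<noteq> i \<longrightarrow> k \<noteq> j \<longrightarrow> x $ k \<in> {lo..<hi})}"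

lemma slab_sum:
  fixes g :: "int \<Rightarrow> int \<Rightarrow> real" and i j :: "'n::finite"
  assumes ij: "i \<noteq> j" and lh: "lo \<le> hi"
  shows "finite (slab i j L H lo hi :: (int ^ 'n) set)"
    "(\<Sum>x\<in>slab i j L H lo hi. g (x $ i) (x $ j)) =
      of_int (hi - lo) ^ card (UNIV - {i, j}) * (\<Sum>s\<in>{0..<L}. \<Sum>t\<in>{0..<H}. g s t)"
proof -
  let ?R = "UNIV - {i, j}"
  let ?P = "PiE ?R (\<lambda>_. {lo..<hi})"
  let ?D = "({0..<L} \<times> {0..<H}) \<times> ?P"
  define mk where "mk = (\<lambda>((s, t), r). \<chi> k. if k = i then s else if k = j then t else (r k :: int))"
  define un where "un x = ((x $ i, x $ j), restrict (($) x) ?R)" for x :: "int ^ 'n"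
  have un: "un x \<in> ?D" "mk (un x) = x" if "x \<in> slab i j L H lo hi" for x
    using that ij by (auto simp: un_def mk_def slab_def vec_eq_iff)
  have mk: "mk d \<in> slab i j L H lo hi" "un (mk d) = d" if "d \<in> ?D" for d
  proof -
    obtain s t r where d: "d = ((s, t), r)" by (cases d) auto
    have r: "r \<in> ?P" using that d by auto
    have "restrict (\<lambda>k. if k = i then s else if k = j then t else r k) ?R = r"
      using r by (auto simp: fun_eq_iff restrict_def PiE_def extensional_def)
    moreover have "restrict (($) (mk d)) ?R = restrict (\<lambda>k. if k = i then s else if k = j then t else r k) ?R"
      by (rule ext) (simp add: d mk_def restrict_def)
    ultimately show "un (mk d) = d" using ij by (simp add: un_def) (simp add: d mk_def)
    show "mk d \<in> slab i j L H lo hi" using that ij by (auto simp: d mk_def slab_def PiE_def)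
  qed
  have finP: "finite ?P" by (intro finite_PiE) auto
  have "slab i j L H lo hi \<subseteq> mk ` ?D"
  proof
    fix x assume x: "x \<in> slab i j L H lo hi"
    show "x \<in> mk ` ?D" by (rule image_eqI[of _ mk "un x"]) (use un[OF x] in simp_all)
  qed
  then show "finite (slab i j L H lo hi :: (int ^ 'n) set)"
    by (rule finite_subset) (use finP in simp)
  have "(\<Sum>x\<in>slab i j L H lo hi. g (x $ i) (x $ j)) = (\<Sum>d\<in>?D. g (fst (fst d)) (snd (fst d)))"
    by (rule sum.reindex_bij_witness[where i = mk and j = un]) (use un mk in \<open>auto simp: un_def\<close>)
  also have "\<dots> = (\<Sum>st\<in>{0..<L} \<times> {0..<H}. \<Sum>r\<in>?P. g (fst st) (snd st))"
    by (subst sum.cartesian_product) (simp add: case_prod_unfold)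
  also have "\<dots> = of_nat (card ?P) * (\<Sum>st\<in>{0..<L} \<times> {0..<H}. g (fst st) (snd st))"
    by (simp add: sum_distrib_left)
  also have "(\<Sum>st\<in>{0..<L} \<times> {0..<H}. g (fst st) (snd st)) = (\<Sum>s\<in>{0..<L}. \<Sum>t\<in>{0..<H}. g s t)"
    by (subst sum.cartesian_product) (simp add: case_prod_unfold)
  also have "real (card ?P) = of_int (hi - lo) ^ card ?R"
    using lh by (simp add: card_PiE)
  finally show "(\<Sum>x\<in>slab i j L H lo hi. g (x $ i) (x $ j)) =
      of_int (hi - lo) ^ card (UNIV - {i, j}) * (\<Sum>s\<in>{0..<L}. \<Sum>t\<in>{0..<H}. g s t)" .
qed

text \<open>The planar function is extended as a constant in the other e = N - 2 coordinates and cut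
  off there. The interior contributes m^e copies of the planar sums; the cut-off affects at most (m
  + 4)^e - m^e layers, where the crude bound \<open>K\<close> suffices. Dividing by m^e and letting
  m grow removes the error.\<close>

lemma box_sum_nonpos_of_opnorm:
  fixes i j :: "'n::{finite,linorder}"
  assumes p: "1 < p" and ij: "i \<noteq> j" and C: "0 \<le> C"
    and bound: "lp_opnorm p (riesz_sq_comb (\<lambda>k. if k = i then 1 else if k = j then - 1 else 0) {}
        :: ((int, 'n) vec \<Rightarrow> real) \<Rightarrow> (int, 'n) vec \<Rightarrow> real) \<le> ennreal C"
    and L: "0 < L" and H: "0 < H" and u: "box_supp L H u"
  shows "(\<Sum>s\<in>{0..<L}. \<Sum>t\<in>{0..<H}. \<bar>dxx u s t - dyy u s t\<bar> powr p)
     \<le> C powr p * (\<Sum>s\<in>{0..<L}. \<Sum>t\<in>{0..<H}. \<bar>dxx u s t + dyy u s t\<bar> powr p)"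
proof -
  define G where "G = (\<Sum>s\<in>{0..<L}. \<Sum>t\<in>{0..<H}. \<bar>dxx u s t - dyy u s t\<bar> powr p)"
  define F where "F = (\<Sum>s\<in>{0..<L}. \<Sum>t\<in>{0..<H}. \<bar>dxx u s t + dyy u s t\<bar> powr p)"
  define e where "e = card (UNIV - {i, j})"
  obtain B where B: "0 \<le> B" "\<And>x y. \<bar>u x y\<bar> \<le> B" using box_supp_bounded[OF u] by blast
  define K where "K = (4 * real CARD('n) * B) powr p"
  \<comment> \<open>Width \<open>m + 2 * d\<close> in the extra coordinates: for
    \<open>d = 0\<close> the interior, where the lifted function is locally constant in them;
    \<open>d = 1\<close> contains its support, and \<open>d = 2\<close> also the support of its
    Laplacian.\<close>
  define S :: "nat \<Rightarrow> int \<Rightarrow> (int, 'n) vec set" where "S m d = slab i j L H (1 - d) (int m + 1 + d)" for m d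
  define f where "f m x = (if \<forall>k. k \<noteq> i \<longrightarrow> k \<noteq> j \<longrightarrow> x $ k \<in> {0..<int m + 2} then u (x $ i) (x $ j) else 0)"
    for m and x :: "(int, 'n) vec"
  have u0: "u s t = 0" if "s \<notin> {1..L - 2} \<or> t \<notin> {1..H - 2}" for s t
    using u that unfolding box_supp_def by force
  have SC: "finite (S m d)" "(\<Sum>x\<in>S m d. g (x $ i) (x $ j)) = (real m + 2 * of_int d) ^ e * (\<Sum>s\<in>{0..<L}. \<Sum>t\<in>{0..<H}. g s t)"
    if "0 \<le> d" for m d g
    using slab_sum[OF ij, where lo = "1 - d" and hi = "int m + 1 + d"] that by (auto simp: S_def e_def)
  have fz: "f m x = 0" if "x \<notin> S m 1" for m x
    using that u0 by (auto simp: f_def S_def slab_def)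
  have ff: "fin_supp (f m)" for m
    by (rule finite_subset[OF _ SC(1)[of 1 m]]) (use fz in auto)
  have ax_i: "axis_diff2 i (f m) x = dxx u (x $ i) (x $ j)"
    and ax_j: "axis_diff2 j (f m) x = dyy u (x $ i) (x $ j)"
    and ax_k: "k \<noteq> i \<Longrightarrow> k \<noteq> j \<Longrightarrow> axis_diff2 k (f m) x = 0"
    if x: "x \<in> S m 0" for m x k
  proof -
    have r: "x $ k \<in> {1..<int m + 1}" if "k \<noteq> i" "k \<noteq> j" for k
      using x that by (auto simp: S_def slab_def)
    have N: "f m (x + v) = u (x $ i + v $ i) (x $ j + v $ j)" if v: "\<And>l. \<bar>v $ l\<bar> \<le> 1" for v
    proof -
      have "(x + v) $ l \<in> {0..<int m + 2}" if "l \<noteq> i" "l \<noteq> j" for l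
        using r[OF that] v[of l] by (simp add: abs_le_iff)
      then show ?thesis unfolding f_def by simp
    qed
    have N0: "f m x = u (x $ i) (x $ j)" using N[of 0] by simp
    have Nk: "f m (x + unit_vec l) = u (x $ i + (if i = l then 1 else 0)) (x $ j + (if j = l then 1 else 0))"
      "f m (x + - unit_vec l) = u (x $ i - (if i = l then 1 else 0)) (x $ j - (if j = l then 1 else 0))" for l
      using N[of "unit_vec l"] N[of "- unit_vec l"] by (auto simp: axis_def)
    show "axis_diff2 i (f m) x = dxx u (x $ i) (x $ j)" "axis_diff2 j (f m) x = dyy u (x $ i) (x $ j)"
      unfolding axis_diff2_def dxx_def dyy_def Nk N0 using ij by simp_all
    assume k: "k \<noteq> i" "k \<noteq> j"
    show "axis_diff2 k (f m) x = 0"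
      unfolding axis_diff2_def Nk N0 using k by auto
  qed
  have lap0: "laplacian (f m) x = (dxx u (x $ i) (x $ j) + dyy u (x $ i) (x $ j))" if "x \<in> S m 0" for m x
  proof -
    have "laplacian (f m) x = (\<Sum>k\<in>{i, j}. axis_diff2 k (f m) x)"
      unfolding laplacian_axis_diff2 by (rule sum.mono_neutral_right) (use ax_k[OF that] in auto)
    then show ?thesis using ij ax_i[OF that] ax_j[OF that] by simp
  qed
  have fB: "\<bar>f m x\<bar> \<le> B" for m x using B by (auto simp: f_def)
  have lapB: "\<bar>laplacian (f m) x\<bar> powr p \<le> K" for m x
  proof -
    have "\<bar>axis_diff2 k (f m) x\<bar> \<le> 4 * B" for k
      unfolding axis_diff2_def using fB[of m "x + unit_vec k"] fB[of m x] fB[of m "x + - unit_vec k"] by linarith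
    then have "\<bar>laplacian (f m) x\<bar> \<le> (\<Sum>k\<in>(UNIV :: 'n set). 4 * B)"
      unfolding laplacian_axis_diff2 by (intro order_trans[OF sum_abs] sum_mono)
    then show ?thesis unfolding K_def using p by (intro powr_mono2) auto
  qed
  have lapS: "laplacian (f m) x = 0" if x: "x \<notin> S m 2" for m x
  proof -
    have "axis_diff2 k (f m) x = 0" for k
    proof -
      have n: "f m (x + v) = 0" if v: "v = 0 \<or> v = unit_vec k \<or> v = - unit_vec k" for v
      proof (rule ccontr)
        assume nz: "f m (x + v) \<noteq> 0"
        have vl: "\<bar>v $ l\<bar> \<le> 1" for l using v by (auto simp: axis_def)
        have in_supp: "(x + v) $ i \<in> {1..L - 2}" "(x + v) $ j \<in> {1..H - 2}"
          "\<And>l. l \<noteq> i \<Longrightarrow> l \<noteq> j \<Longrightarrow> (x + v) $ l \<in> {0..<int m + 2}"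
          using nz u0[of "(x + v) $ i" "(x + v) $ j"] unfolding f_def by (auto split: if_splits)
        have "x $ i \<in> {0..<L}" "x $ j \<in> {0..<H}"
          using in_supp(1,2) vl[of i] vl[of j] by (simp_all add: abs_le_iff)
        moreover have "x $ l \<in> {1 - 2..<int m + 1 + 2}" if "l \<noteq> i" "l \<noteq> j" for l
          using in_supp(3)[OF that] vl[of l] by (simp add: abs_le_iff)
        ultimately show False using x by (auto simp: S_def slab_def)
      qed
      show ?thesis using n[of 0] n[of "unit_vec k"] n[of "- unit_vec k"] by (simp add: axis_diff2_def)
    qed
    then show ?thesis by (simp add: laplacian_axis_diff2)
  qed
  have main: "real m ^ e * G \<le> C powr p * (real m ^ e * F + ((real m + 4) ^ e - real m ^ e) * (of_int L * of_int H * K))" for m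
  proof -
    let ?g = "\<lambda>x. \<bar>axis_diff2 i (f m) x - axis_diff2 j (f m) x\<bar> powr p"
    let ?l = "\<lambda>x. \<bar>laplacian (f m) x\<bar> powr p"
    have fsg: "fin_supp (\<lambda>x. axis_diff2 i (f m) x - axis_diff2 j (f m) x)"
      by (intro fin_supp_diff has_symbolD(1)[OF has_symbol_axis_diff2] ff)
    have "real m ^ e * G = (\<Sum>x\<in>S m 0. \<bar>dxx u (x $ i) (x $ j) - dyy u (x $ i) (x $ j)\<bar> powr p)"
      using SC(2)[of 0 "\<lambda>s t. \<bar>dxx u s t - dyy u s t\<bar> powr p" m] by (simp add: G_def)
    also have "\<dots> = (\<Sum>x\<in>S m 0. ?g x)" by (intro sum.cong refl) (simp add: ax_i ax_j)
    also have "\<dots> \<le> lattice_sum ?g"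
      unfolding lattice_sum_def using SC(1)[of 0 m]
      by (intro finite_sum_le_infsum fin_supp_summable fin_supp_powr fsg) auto
    also have "\<dots> \<le> C powr p * lattice_sum ?l" by (rule opnorm_test_laplacian[OF p ij C bound ff])
    also have "lattice_sum ?l = (\<Sum>\<^sub>\<infinity>x\<in>S m 2. ?l x)"
      unfolding lattice_sum_def by (rule infsum_cong_neutral) (use lapS in auto)
    also have "\<dots> = (\<Sum>x\<in>S m 2. ?l x)" using SC(1)[of 2 m] by simp
    also have "\<dots> = (\<Sum>x\<in>S m 0. ?l x) + (\<Sum>x\<in>S m 2 - S m 0. ?l x)"
    proof -
      have "S m 0 \<subseteq> S m 2" by (auto simp: S_def slab_def)
      then show ?thesis using SC(1)[of 2 m] by (subst sum.subset_diff[of "S m 0" "S m 2"]) auto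
    qed
    also have "(\<Sum>x\<in>S m 0. ?l x) = real m ^ e * F"
    proof -
      have "(\<Sum>x\<in>S m 0. ?l x) = (\<Sum>x\<in>S m 0. \<bar>dxx u (x $ i) (x $ j) + dyy u (x $ i) (x $ j)\<bar> powr p)"
        by (intro sum.cong refl) (simp add: lap0)
      then show ?thesis using SC(2)[of 0 "\<lambda>s t. \<bar>dxx u s t + dyy u s t\<bar> powr p" m] by (simp add: F_def)
    qed
    also have "(\<Sum>x\<in>S m 2 - S m 0. ?l x) \<le> (\<Sum>x\<in>S m 2 - S m 0. K)" by (intro sum_mono lapB)
    also have "(\<Sum>x\<in>S m 2 - S m 0. K) = ((real m + 4) ^ e - real m ^ e) * (of_int L * of_int H * K)"
    proof -
      have sub: "S m 0 \<subseteq> S m 2" by (auto simp: S_def slab_def)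
      have "(\<Sum>x\<in>S m 2 - S m 0. K) = (\<Sum>x\<in>S m 2. K) - (\<Sum>x\<in>S m 0. K)"
        using sub SC(1)[of 2 m] by (rule_tac sum_diff) auto
      also have "(\<Sum>x\<in>S m 2. K) = (real m + 4) ^ e * (of_int L * of_int H * K)"
        using SC(2)[of 2 "\<lambda>s t. K" m] L H by simp
      also have "(\<Sum>x\<in>S m 0. K) = real m ^ e * (of_int L * of_int H * K)"
        using SC(2)[of 0 "\<lambda>s t. K" m] L H by simp
      finally show ?thesis by (simp add: left_diff_distrib)
    qed
    finally show ?thesis by (simp add: mult_left_mono)
  qed
  have lim: "(\<lambda>m. ((real m + 4) / real m) ^ e) \<longlonglongrightarrow> 1 ^ e"
    by (intro tendsto_power) real_asymp
  have "(\<lambda>m. C powr p * (F + (((real m + 4) / real m) ^ e - 1) * (of_int L * of_int H * K))) \<longlonglongrightarrow>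
      C powr p * (F + (1 ^ e - 1) * (of_int L * of_int H * K))"
    by (intro tendsto_intros lim)
  moreover have "\<forall>\<^sub>F m in sequentially. G \<le> C powr p * (F + (((real m + 4) / real m) ^ e - 1) * (of_int L * of_int H * K))"
    using eventually_gt_at_top[of "0 :: nat"]
  proof eventually_elim
    case (elim m)
    define z where "z = real m ^ e"
    have z: "0 < z" using elim by (simp add: z_def)
    have "(real m + 4) ^ e = z * ((real m + 4) / real m) ^ e"
      using elim by (simp add: z_def power_divide)
    then have eq: "C powr p * (real m ^ e * F + ((real m + 4) ^ e - real m ^ e) * (of_int L * of_int H * K))
       = z * (C powr p * (F + (((real m + 4) / real m) ^ e - 1) * (of_int L * of_int H * K)))"
      by (simp add: z_def[symmetric] algebra_simps)
    have "z * G \<le> z * (C powr p * (F + (((real m + 4) / real m) ^ e - 1) * (of_int L * of_int H * K)))"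
      using main[of m] unfolding eq unfolding z_def .
    then show ?case using z by simp
  qed
  ultimately have "G \<le> C powr p * (F + (1 ^ e - 1) * (of_int L * of_int H * K))"
    by (intro tendsto_lowerbound) auto
  then show ?thesis by (simp add: G_def F_def)
qed

lemma opnorm_lower_bound:
  fixes i j :: "'n::{finite,linorder}"
  assumes p: "1 < p" and ij: "i \<noteq> j"
    and bound: "lp_opnorm p (riesz_sq_comb (\<lambda>k. if k = i then 1 else if k = j then - 1 else 0) {}
        :: ((int, 'n) vec \<Rightarrow> real) \<Rightarrow> (int, 'n) vec \<Rightarrow> real) \<le> C"
  shows "ennreal (pstar p - 1) \<le> C"
proof (cases C)
  case (real c)
  have "max (p - 1) (inverse (p - 1)) \<le> c"
  proof (rule hessian_ratio_lower_bound[OF p])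
    show "0 \<le> c" by (rule real(1))
    fix u L H assume *: "0 < L" "0 < H" "box_supp L H u"
    have "box_sum (hessian_defect p c) 0 0 u L H
        = (\<Sum>s\<in>{0..<L}. \<Sum>t\<in>{0..<H}. \<bar>dxx u s t - dyy u s t\<bar> powr p)
          - c powr p * (\<Sum>s\<in>{0..<L}. \<Sum>t\<in>{0..<H}. \<bar>dxx u s t + dyy u s t\<bar> powr p)"
      by (simp add: box_sum_def hessian_defect_def ratio_defect_def sum_subtractf sum_distrib_left)
    then show "box_sum (hessian_defect p c) 0 0 u L H \<le> 0"
      using box_sum_nonpos_of_opnorm[OF p ij real(1) bound[unfolded real(2)] *] by simp
  qed
  then show ?thesis using real by (simp add: pstar_def ennreal_leI)
qed simp

text \<open>Sharpness means that no smaller constant serves all admissible choices at once. With a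
  single coordinate the operator is -\<alpha> times the identity, of norm at most 1, which is why
  sharpness is stated for at least two coordinates.\<close>

theorem theorem2:
  fixes p :: real
  assumes "1 < p"
  shows
    "(\<forall>(A :: ('n::{finite,linorder} \<times> 'n) set) (\<alpha> :: 'n \<Rightarrow> real).
        pairing A \<longrightarrow> admissible_weights A \<alpha> \<longrightarrow>
        lp_opnorm p (riesz_sq_comb \<alpha> A) \<le> ennreal (pstar p - 1)) \<and>
     (2 \<le> CARD('n) \<longrightarrow>
       (\<forall>C :: ennreal.
         (\<forall>(A :: ('n \<times> 'n) set) (\<alpha> :: 'n \<Rightarrow> real).
            pairing A \<longrightarrow> admissible_weights A \<alpha> \<longrightarrow> lp_opnorm p (riesz_sq_comb \<alpha> A) \<le> C) \<longrightarrow>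
         ennreal (pstar p - 1) \<le> C))"
proof (intro conjI allI impI)
  show "lp_opnorm p (riesz_sq_comb \<alpha> A) \<le> ennreal (pstar p - 1)"
    if "pairing A" "admissible_weights A \<alpha>" for A :: "('n \<times> 'n) set" and \<alpha>
    using assms that by (rule riesz_sq_comb_opnorm)
next
  fix C :: ennreal
  assume card: "2 \<le> CARD('n)"
    and C: "\<forall>(A :: ('n \<times> 'n) set) \<alpha>. pairing A \<longrightarrow> admissible_weights A \<alpha> \<longrightarrow>
      lp_opnorm p (riesz_sq_comb \<alpha> A) \<le> C"
  obtain i j :: 'n where ij: "i \<noteq> j"
    using card by (metis card_2_iff' card_le_Suc0_iff_eq finite_class.finite_UNIV not_less_eq_eq numeral_2_eq_2 UNIV_I)
  have "pairing ({} :: ('n \<times> 'n) set)" by (simp add: pairing_def)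
  moreover have "admissible_weights {} (\<lambda>k. if k = i then 1 else if k = j then - 1 else 0)"
    by (simp add: admissible_weights_def)
  ultimately have "lp_opnorm p (riesz_sq_comb (\<lambda>k. if k = i then 1 else if k = j then - 1 else 0) {}
        :: ((int, 'n) vec \<Rightarrow> real) \<Rightarrow> (int, 'n) vec \<Rightarrow> real) \<le> C"
    using C by blast
  with assms ij show "ennreal (pstar p - 1) \<le> C" by (rule opnorm_lower_bound)
qed

end
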